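(* Let $n\ge2$, let $\Omega\subset\mathbb{C}^n$ be a domain, let $\pi:E\to\Omega$ be a holomorphic vector bundle, let $h$ be a smooth Hermitian metric on $E$ with Chern curvature $\Theta_h$, and let $1\le q\le n-1$. Then the following are equivalent: (1) $\sqrt{-1}\Theta_h\equiv0$ on $\Omega$; (2) $L^{(q)}_h\equiv1$, i.e. $L^{(q)}_h(a,r,s,A,\xi)=1$ for all $a\in\Omega$, $r,s>0$, $A\in\mathbf{U}(n)$ with $a+P^{(q)}_{r,s,A}\subset\Omega$ and all $\xi\in E_a\setminus\{0\}$.
   Context: $\mathbf{U}(n)$ is the unitary group of degree $n$, and $\mathbb{B}^{k}_s\subset\mathbb{C}^k$ is the open ball of radius $s$ centered at $0$. For $r,s>0$, $A\in\mathbf{U}(n)$, put $P^{(q)}_{r,s,A}=A(\mathbb{B}^q_r\times\mathbb{B}^{n-q}_s)$, with Lebesgue measure $|P^{(q)}_{r,s,A}|$. For $a\in\Omega$, $r,s>0$, $A\in\mathbf{U}(n)$ with $a+P^{(q)}_{r,s,A}\subset\Omega$, and $\xi\in E_a\setminus\{0\}$, the $q$-$L^2$-extension index of $h$ is $$L^{(q)}_h(a,r,s,A,\xi)=\inf\left\{\frac{\int_{a+P^{(q)}_{r,s,A}}|\sigma|_h^2}{|P^{(q)}_{r,s,A}|\,|\xi|^2_{h(a)}}\ \middle|\ \sigma\in A^2(a+P^{(q)}_{r,s,A},E;h),\ \sigma(a)=\xi\right\},$$ where $A^2(a+P^{(q)}_{r,s,A},E;h)$ is the space of holomorphic sections of $E$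 on $a+P^{(q)}_{r,s,A}$ that are square integrable with respect to $h$ (and Lebesgue measure). *)

theory Defs
  imports "HOL-Analysis.Analysis"
begin

section \<open>Calculus on \<open>\<complex>\<^sup>n\<close>\<close>

text \<open>Several-variable holomorphy: real differentiability with complex-linear derivative.\<close>

definition holomorphic_vec_on :: "((complex^'n) \<Rightarrow> complex) \<Rightarrow> (complex^'n) set \<Rightarrow> bool" where
  "holomorphic_vec_on f S \<longleftrightarrow>
     (\<forall>z\<in>S. \<exists>f'. (f has_derivative f') (at z) \<and> (\<forall>c v. f' (c *s v) = c * f' v))"

text \<open>Smoothness is real \<open>C\<^sup>\<infinity>\<close> smoothness, meant for open sets.\<close>

primrec Ck_on :: "nat \<Rightarrow> ('a::real_normed_vector \<Rightarrow> 'b::real_normed_vector) \<Rightarrow> 'a set \<Rightarrow> bool" where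
  "Ck_on 0 f S \<longleftrightarrow> continuous_on S f"
| "Ck_on (Suc k) f S \<longleftrightarrow>
     (\<forall>x\<in>S. f differentiable (at x)) \<and> (\<forall>v. Ck_on k (\<lambda>x. frechet_derivative f (at x) v) S)"

definition smooth_on :: "('a::real_normed_vector \<Rightarrow> 'b::real_normed_vector) \<Rightarrow> 'a set \<Rightarrow> bool" where
  "smooth_on f S \<longleftrightarrow> (\<forall>k. Ck_on k f S)"

text \<open>The Wirtinger derivatives \<open>\<partial>/\<partial>z\<^sub>j = (\<partial>/\<partial>x\<^sub>j - \<i> \<partial>/\<partial>y\<^sub>j)/2\<close> and
  \<open>\<partial>/\<partial>\<zeta>\<^sub>j = (\<partial>/\<partial>x\<^sub>j + \<i> \<partial>/\<partial>y\<^sub>j)/2\<close>, where \<open>z\<^sub>j = x\<^sub>j + \<i> y\<^sub>j\<close> and \<open>\<zeta>\<^sub>j = cnj z\<^sub>j\<close>.\<close>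

definition wirtinger :: "'n \<Rightarrow> ((complex^'n) \<Rightarrow> complex) \<Rightarrow> (complex^'n) \<Rightarrow> complex" where
  "wirtinger j f z =
     (frechet_derivative f (at z) (axis j 1) - \<i> * frechet_derivative f (at z) (axis j \<i>)) / 2"

definition wirtinger_bar :: "'n \<Rightarrow> ((complex^'n) \<Rightarrow> complex) \<Rightarrow> (complex^'n) \<Rightarrow> complex" where
  "wirtinger_bar j f z =
     (frechet_derivative f (at z) (axis j 1) + \<i> * frechet_derivative f (at z) (axis j \<i>)) / 2"


section \<open>Holomorphic vector bundles\<close>

text \<open>
  A bundle consists of a total space, a projection, fibrewise vector space operations, and an
  atlas of local trivializations. An atlas element \<open>(U, \<phi>)\<close> stands for the trivialization
  \<open>v \<mapsto> (proj v, \<phi> v)\<close> of the part of the total space over \<open>U\<close>, with values in \<open>U \<times> \<complex>\<^sup>r\<close>.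
  The complex manifold structure of the total space is the one for which all of these are
  biholomorphic; it exists because the transition maps are holomorphic. The fibrewise vector
  space axioms are inherited from \<open>\<complex>\<^sup>r\<close> through the linear bijections \<open>\<phi>\<close>.
\<close>

record ('e, 'n::finite, 'r::finite) vbundle =
  total :: "'e set"
  proj :: "'e \<Rightarrow> complex^'n"
  fzero :: "complex^'n \<Rightarrow> 'e"
  fadd :: "'e \<Rightarrow> 'e \<Rightarrow> 'e"
  fscale :: "complex \<Rightarrow> 'e \<Rightarrow> 'e"
  atlas :: "((complex^'n) set \<times> ('e \<Rightarrow> complex^'r)) set"

definition fibre :: "('e, 'n::finite, 'r::finite) vbundle \<Rightarrow> complex^'n \<Rightarrow> 'e set" where
  "fibre E a = {v \<in> total E. proj E v = a}"

definition triv_inv ::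
    "('e, 'n::finite, 'r::finite) vbundle \<Rightarrow> ('e \<Rightarrow> complex^'r) \<Rightarrow> complex^'n \<Rightarrow> complex^'r \<Rightarrow> 'e" where
  "triv_inv E \<phi> a w = the_inv_into (fibre E a) \<phi> w"

definition holomorphic_vector_bundle ::
    "(complex^'n) set \<Rightarrow> ('e, 'n::finite, 'r::finite) vbundle \<Rightarrow> bool" where
  "holomorphic_vector_bundle \<Omega> E \<longleftrightarrow>
     proj E ` total E \<subseteq> \<Omega> \<and>
     (\<forall>a\<in>\<Omega>. fzero E a \<in> fibre E a) \<and>
     (\<forall>a\<in>\<Omega>. \<forall>v\<in>fibre E a. \<forall>w\<in>fibre E a. fadd E v w \<in> fibre E a) \<and>
     (\<forall>a\<in>\<Omega>. \<forall>c. \<forall>v\<in>fibre E a. fscale E c v \<in> fibre E a) \<and>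
     (\<Union>(U, \<phi>)\<in>atlas E. U) = \<Omega> \<and>
     (\<forall>(U, \<phi>)\<in>atlas E. open U \<and>
        (\<forall>a\<in>U. bij_betw \<phi> (fibre E a) UNIV \<and>
           \<phi> (fzero E a) = 0 \<and>
           (\<forall>v\<in>fibre E a. \<forall>w\<in>fibre E a. \<phi> (fadd E v w) = \<phi> v + \<phi> w) \<and>
           (\<forall>c. \<forall>v\<in>fibre E a. \<phi> (fscale E c v) = c *s \<phi> v))) \<and>
     (\<forall>(U, \<phi>)\<in>atlas E. \<forall>(V, \<psi>)\<in>atlas E. \<forall>w i.
        holomorphic_vec_on (\<lambda>z. \<psi> (triv_inv E \<phi> z w) $ i) (U \<inter> V))"

definition holomorphic_section ::
    "('e, 'n::finite, 'r::finite) vbundle \<Rightarrow> (complex^'n) set \<Rightarrow> (complex^'n \<Rightarrow> 'e) \<Rightarrow> bool" where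
  "holomorphic_section E S \<sigma> \<longleftrightarrow>
     (\<forall>z\<in>S. \<sigma> z \<in> fibre E z) \<and>
     (\<forall>(U, \<phi>)\<in>atlas E. \<forall>i. holomorphic_vec_on (\<lambda>z. \<phi> (\<sigma> z) $ i) (S \<inter> U))"


section \<open>Hermitian metrics and Chern curvature\<close>

text \<open>The Gram matrix \<open>H\<^sub>\<alpha>\<^sub>\<beta> = h(e\<^sub>\<alpha>, e\<^sub>\<beta>)\<close> of the holomorphic frame \<open>(e\<^sub>\<alpha>)\<close> that a
  trivialization \<open>\<phi>\<close> induces.\<close>

definition gram ::
    "('e, 'n::finite, 'r::finite) vbundle \<Rightarrow> ('e \<Rightarrow> 'e \<Rightarrow> complex) \<Rightarrow> ('e \<Rightarrow> complex^'r)
       \<Rightarrow> complex^'n \<Rightarrow> complex^'r^'r" where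
  "gram E h \<phi> z = (\<chi> \<alpha> \<beta>. h (triv_inv E \<phi> z (axis \<alpha> 1)) (triv_inv E \<phi> z (axis \<beta> 1)))"

text \<open>\<open>h v w\<close> is linear in \<open>v\<close> and conjugate-linear in \<open>w\<close>; the latter follows from the
  Hermitian symmetry.\<close>

definition smooth_hermitian_metric ::
    "(complex^'n) set \<Rightarrow> ('e, 'n::finite, 'r::finite) vbundle \<Rightarrow> ('e \<Rightarrow> 'e \<Rightarrow> complex) \<Rightarrow> bool" where
  "smooth_hermitian_metric \<Omega> E h \<longleftrightarrow>
     (\<forall>a\<in>\<Omega>. \<forall>u\<in>fibre E a. \<forall>v\<in>fibre E a. \<forall>w\<in>fibre E a.
        h (fadd E u v) w = h u w + h v w) \<and>
     (\<forall>a\<in>\<Omega>. \<forall>c. \<forall>v\<in>fibre E a. \<forall>w\<in>fibre E a. h (fscale E c v) w = c * h v w) \<and>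
     (\<forall>a\<in>\<Omega>. \<forall>v\<in>fibre E a. \<forall>w\<in>fibre E a. h w v = cnj (h v w)) \<and>
     (\<forall>a\<in>\<Omega>. \<forall>v\<in>fibre E a. v \<noteq> fzero E a \<longrightarrow> 0 < Re (h v v)) \<and>
     (\<forall>(U, \<phi>)\<in>atlas E. \<forall>\<alpha> \<beta>. smooth_on (\<lambda>z. gram E h \<phi> z $ \<alpha> $ \<beta>) U)"

text \<open>
  The Chern connection is the connection \<open>D\<close> with \<open>(0,1)\<close>-part \<open>\<partial>bar\<close> that is compatible with
  \<open>h\<close>. Writing \<open>D e\<^sub>\<alpha> = \<Sum>\<beta>. \<theta>\<^sub>\<alpha>\<^sub>\<beta> \<otimes> e\<^sub>\<beta>\<close> in the frame above, these two conditions say that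
  \<open>\<theta>\<close> is of type \<open>(1,0)\<close> and \<open>\<partial>H = \<theta> H\<close>, hence \<open>\<theta> = (\<partial>H) H\<^sup>-\<^sup>1\<close>; the matrix below is the
  coefficient of \<open>dz\<^sub>j\<close> in \<open>\<theta>\<close>.
\<close>

definition chern_connection ::
    "('e, 'n::finite, 'r::finite) vbundle \<Rightarrow> ('e \<Rightarrow> 'e \<Rightarrow> complex) \<Rightarrow> ('e \<Rightarrow> complex^'r)
       \<Rightarrow> 'n \<Rightarrow> complex^'n \<Rightarrow> complex^'r^'r" where
  "chern_connection E h \<phi> j z =
     (\<chi> \<alpha> \<beta>. wirtinger j (\<lambda>w. gram E h \<phi> w $ \<alpha> $ \<beta>) z) ** matrix_inv (gram E h \<phi> z)"

text \<open>
  The curvature \<open>\<Theta> = D\<^sup>2\<close> has matrix \<open>d\<theta> - \<theta> \<and> \<theta> = \<partial>bar \<theta>\<close> in this frame, that is,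
  \<open>\<Theta> = \<Sum>j k. \<Theta>\<^sub>j\<^sub>k dz\<^sub>j \<and> d\<zeta>\<^sub>k\<close> with \<open>\<zeta>\<^sub>k = cnj z\<^sub>k\<close>, where \<open>\<Theta>\<^sub>j\<^sub>k\<close> is
  minus the derivative of \<open>\<theta>\<^sub>j\<close> along \<open>\<partial>/\<partial>\<zeta>\<^sub>k\<close> (the sign comes from \<open>d\<zeta>\<^sub>k \<and> dz\<^sub>j = - dz\<^sub>j \<and> d\<zeta>\<^sub>k\<close>).
\<close>

definition chern_curvature ::
    "('e, 'n::finite, 'r::finite) vbundle \<Rightarrow> ('e \<Rightarrow> 'e \<Rightarrow> complex) \<Rightarrow> ('e \<Rightarrow> complex^'r)
       \<Rightarrow> 'n \<Rightarrow> 'n \<Rightarrow> complex^'n \<Rightarrow> complex^'r^'r" where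
  "chern_curvature E h \<phi> j k z =
     (\<chi> \<alpha> \<beta>. - wirtinger_bar k (\<lambda>w. chern_connection E h \<phi> j w $ \<alpha> $ \<beta>) z)"

text \<open>\<open>\<surd>-1 \<Theta>\<^sub>h \<equiv> 0\<close>: this \<open>End(E)\<close>-valued \<open>(1,1)\<close>-form vanishes at every point, i.e. so does its
  coefficient matrix in every local frame of the atlas.\<close>

definition i_chern_curvature_zero ::
    "('e, 'n::finite, 'r::finite) vbundle \<Rightarrow> ('e \<Rightarrow> 'e \<Rightarrow> complex) \<Rightarrow> bool" where
  "i_chern_curvature_zero E h \<longleftrightarrow>
     (\<forall>(U, \<phi>)\<in>atlas E. \<forall>z\<in>U. \<forall>j k \<alpha> \<beta>. \<i> * chern_curvature E h \<phi> j k z $ \<alpha> $ \<beta> = 0)"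


section \<open>The extension index\<close>

definition unitary :: "complex^'n^'n \<Rightarrow> bool" where
  "unitary A \<longleftrightarrow> A ** map_matrix cnj (transpose A) = mat 1 \<and> map_matrix cnj (transpose A) ** A = mat 1"

text \<open>The linear order on the index type fixes which coordinates of \<open>\<complex>\<^sup>n\<close> are the first \<open>q\<close>.\<close>

definition first_coords :: "nat \<Rightarrow> ('n::{finite,linorder}) set" where
  "first_coords q = {i. card {j. j < i} < q}"

definition polyball ::
    "nat \<Rightarrow> real \<Rightarrow> real \<Rightarrow> complex^('n::{finite,linorder})^('n::{finite,linorder}) \<Rightarrow> (complex^('n::{finite,linorder})) set" where
  "polyball q r s A = (\<lambda>z. A *v z) `
     {z. L2_set (\<lambda>i. norm (z $ i)) (first_coords q) < r \<and>
         L2_set (\<lambda>i. norm (z $ i)) (- first_coords q) < s}"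

definition sq_integral ::
    "('e \<Rightarrow> 'e \<Rightarrow> complex) \<Rightarrow> (complex^'n) set \<Rightarrow> (complex^'n \<Rightarrow> 'e) \<Rightarrow> ennreal" where
  "sq_integral h S \<sigma> = (\<integral>\<^sup>+z\<in>S. ennreal (Re (h (\<sigma> z) (\<sigma> z))) \<partial>lebesgue)"

definition A2 ::
    "('e, 'n::finite, 'r::finite) vbundle \<Rightarrow> ('e \<Rightarrow> 'e \<Rightarrow> complex) \<Rightarrow> (complex^'n) set
       \<Rightarrow> (complex^'n \<Rightarrow> 'e) set" where
  "A2 E h S = {\<sigma>. holomorphic_section E S \<sigma> \<and> sq_integral h S \<sigma> < \<infinity>}"

text \<open>The infimum is taken in \<open>[0, \<infinity>]\<close>, so that it is \<open>\<infinity>\<close> when no extension exists.\<close>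

definition extension_index ::
    "('e, 'n::{finite,linorder}, 'r::finite) vbundle \<Rightarrow> ('e \<Rightarrow> 'e \<Rightarrow> complex) \<Rightarrow> nat
       \<Rightarrow> complex^('n::{finite,linorder}) \<Rightarrow> real \<Rightarrow> real \<Rightarrow> complex^('n::{finite,linorder})^('n::{finite,linorder}) \<Rightarrow> 'e \<Rightarrow> ennreal" where
  "extension_index E h q a r s A \<xi> =
     Inf {sq_integral h ((+) a ` polyball q r s A) \<sigma> /
            (emeasure lebesgue (polyball q r s A) * ennreal (Re (h \<xi> \<xi>))) | \<sigma>.
          \<sigma> \<in> A2 E h ((+) a ` polyball q r s A) \<and> \<sigma> a = \<xi>}"

end

theory Submission
  imports Defs "HOL-Complex_Analysis.Cauchy_Integral_Formula"
begin

text \<open>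
  Both implications are statements about averages. The polyballs \<open>a + P\<close> are the images
  of one product of unit balls under affine maps, and Lebesgue measure is transformed by a constant
  factor; so the quotient in the extension index of \<open>\<xi>\<close> is the mean of
  \<open>|\<sigma>|\<^sup>2\<close> over the polyball, divided by \<open>|\<xi>|\<^sup>2\<close>
  (\<open>sq_integral_ratio\<close>). Below, \<open>H\<close> is the Gram matrix of \<open>h\<close>
  in a holomorphic frame and \<open>\<theta> = (\<partial>H) H\<^sup>-\<^sup>1\<close> the
  connection matrix.

  \<^bold>\<open>Vanishing curvature gives index one.\<close> Suppose that a parallel section
  \<open>\<tau>\<close> with \<open>\<tau>(a) = \<xi>\<close> exists on the polyball. Then
  \<open>|\<tau>|\<^sup>2\<close> is holomorphic and real, hence constant, so \<open>\<tau>\<close>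
  itself realises the quotient 1. Any other extension \<open>\<sigma>\<close> pairs with
  \<open>\<tau>\<close> to a holomorphic function \<open>F = h(\<sigma>,\<tau>)\<close>; the mean
  value inequality for \<open>F\<^sup>2\<close> and Cauchy-Schwarz give \<open>|\<xi>|\<^sup>4 \<le>
  |\<xi>|\<^sup>2 \<cdot> mean |\<sigma>|\<^sup>2\<close>, so no extension does better
  (\<open>extension_index_eq_1_of_parallel\<close>). To find \<open>\<tau>\<close> on a small ball,
  transport \<open>\<xi>\<close> along the rays from the centre: since \<open>\<partial>bar \<theta>
  = 0\<close>, the coefficients of this ordinary differential equation are holomorphic, and so is
  the resulting frame coordinate vector \<open>f\<close>. The vector of pairings \<open>H cnj
  f\<close> satisfies a radial equation with holomorphic coefficients as well, so it is holomorphic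
  too, and this is what it means for the section to be parallel
  (\<open>local_parallel_section\<close>). No integrability theorem is involved: uniqueness for the
  radial equation replaces it. Parallel sections are determined by one value, and polyballs are
  convex, so the local sections can be continued along segments and glued
  (\<open>parallel_section_convex\<close>).

  \<^bold>\<open>Index one gives vanishing curvature.\<close> That the index is at least 1 says that
  \<open>h(u,u)\<close> has the sub-mean value property over small polyballs for every holomorphic
  section \<open>u\<close> (\<open>index_ge_1_submean\<close>). That it is at most 1 gives
  extensions which are almost as small as \<open>|\<xi>|\<^sup>2\<close> on average, and pairing
  these with holomorphic sections of the dual bundle shows that the dual metric has the same
  sub-mean value property (\<open>index_le_1_dual_submean\<close>). Now let \<open>u\<close> be
  parallel to first order at \<open>a\<close> with value \<open>\<xi>\<close> there. In the second
  order expansion of \<open>h(u,u)\<close> at \<open>a\<close> only the curvature survives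
  averaging, so the mean of the curvature form over the polyball has one sign on
  \<open>\<xi>\<close> (\<open>levi_mean_nonneg\<close>). The curvature of the dual metric is the
  negative transpose, so the dual property gives the opposite sign, and all these means vanish
  (\<open>levi_mean_zero\<close>). A mean over the polyball only sees a weighted trace of a form.
  Varying \<open>r\<close> and \<open>s\<close> splits the trace into the contributions of the two
  factors, and varying the unitary matrix moves single vectors of a unitary frame from one factor to
  the other; as neither factor is trivial, the form vanishes on every unit vector, hence everywhere
  (\<open>unitary_averages_zero\<close>).
\<close>

section \<open>Linear images of Lebesgue measure\<close>

text \<open>Integrate \<open>1\<^sub>S(x) 1\<^sub>B(x + y)\<close> against \<open>\<nu> \<otimes> Lebesgue\<close>
  in both orders, using translation invariance of Lebesgue measure in one order and that of
  \<open>\<nu>\<close> in the other.\<close>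

lemma translation_invariant_measure_unique:
  fixes \<nu> :: "'a::euclidean_space measure"
  assumes sets: "sets \<nu> = sets borel" and "sigma_finite_measure \<nu>"
    and inv: "\<And>c. distr \<nu> borel ((+) c) = \<nu>"
    and S: "S \<in> sets borel" and B: "B \<in> sets borel"
  shows "emeasure \<nu> S * emeasure lborel B = emeasure lborel S * emeasure \<nu> B"
proof -
  interpret sigma_finite_measure \<nu> by fact
  interpret pair_sigma_finite \<nu> lborel ..
  note [measurable_cong] = sets
  note [measurable] = S B
  have refl: "distr lborel borel (\<lambda>y. x - y) = (lborel :: 'a measure)" for x :: 'a
    using lborel_affine[of "-1" x] by (simp add: density_1)
  have "emeasure \<nu> S * emeasure lborel B = (\<integral>\<^sup>+x. indicator S x * emeasure lborel B \<partial>\<nu>)"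
    by (subst nn_integral_multc) (auto simp: sets)
  also have "\<dots> = (\<integral>\<^sup>+x. indicator S x * (\<integral>\<^sup>+y. indicator B y \<partial>distr lborel borel ((+) x)) \<partial>\<nu>)"
    by (simp add: lborel_distr_plus)
  also have "\<dots> = (\<integral>\<^sup>+x. (\<integral>\<^sup>+y. indicator S x * indicator B (x + y) \<partial>lborel) \<partial>\<nu>)"
    by (subst nn_integral_distr) (auto simp: nn_integral_cmult)
  also have "\<dots> = (\<integral>\<^sup>+y. (\<integral>\<^sup>+x. indicator S x * indicator B (x + y) \<partial>\<nu>) \<partial>lborel)"
    by (rule Fubini'[symmetric]) simp
  also have "\<dots> = (\<integral>\<^sup>+y. (\<integral>\<^sup>+x. indicator S x * indicator B (x + y) \<partial>distr \<nu> borel ((+) (- y))) \<partial>lborel)"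
    by (simp only: inv)
  also have "\<dots> = (\<integral>\<^sup>+y. (\<integral>\<^sup>+x. indicator S (x - y) * indicator B x \<partial>\<nu>) \<partial>lborel)"
    by (simp add: nn_integral_distr)
  also have "\<dots> = (\<integral>\<^sup>+x. (\<integral>\<^sup>+y. indicator S (x - y) * indicator B x \<partial>lborel) \<partial>\<nu>)"
    by (rule Fubini') simp
  also have "\<dots> = (\<integral>\<^sup>+x. (\<integral>\<^sup>+y. indicator S y \<partial>distr lborel borel (\<lambda>y. x - y)) * indicator B x \<partial>\<nu>)"
    by (subst nn_integral_distr) (auto simp: nn_integral_multc)
  also have "\<dots> = (\<integral>\<^sup>+x. emeasure lborel S * indicator B x \<partial>\<nu>)"
    by (simp only: refl) simp
  also have "\<dots> = emeasure lborel S * emeasure \<nu> B"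
    by (subst nn_integral_cmult) (auto simp: sets)
  finally show ?thesis .
qed

text \<open>Pulling Lebesgue measure back along \<open>T\<close> gives a translation invariant measure, so
  \<open>T\<close> changes volumes by a constant factor. As only quotients of volumes matter later, this
  form of the statement avoids the determinant that computes the factor.\<close>

lemma emeasure_linear_image_proportional:
  fixes T :: "'a::euclidean_space \<Rightarrow> 'a"
  assumes T: "linear T" "bij T" and X: "X \<in> sets borel" and S: "S \<in> sets borel"
  shows "emeasure lborel (T ` X) * emeasure lborel S = emeasure lborel X * emeasure lborel (T ` S)"
proof -
  obtain T' where T': "linear T'" and TT': "T \<circ> T' = id" "T' \<circ> T = id"
    by (metis T bij_is_inj linear_injective_left_inverse linear_inverse_left)
  have [measurable]: "T \<in> borel \<rightarrow>\<^sub>M borel" "T' \<in> borel \<rightarrow>\<^sub>M borel"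
    using T T' by (auto intro!: borel_measurable_continuous_onI linear_continuous_on simp: linear_conv_bounded_linear)
  define \<nu> where "\<nu> = distr lborel borel T'"
  have "distr \<nu> borel T = lborel"
    unfolding \<nu>_def by (subst distr_distr) (auto simp: TT' id_def distr_id2)
  then have "sigma_finite_measure \<nu>"
    using sigma_finite_lborel sigma_finite_measure_distr[of \<nu> borel T]
    by (metis \<nu>_def \<open>T \<in> borel \<rightarrow>\<^sub>M borel\<close> measurable_distr_eq1)
  moreover have "distr \<nu> borel ((+) c) = \<nu>" for c
  proof -
    have "distr \<nu> borel ((+) c) = distr lborel borel (\<lambda>y. T' (T c + y))"
      unfolding \<nu>_def using TT'
      by (subst distr_distr) (auto simp: o_def linear_add[OF T'] fun_eq_iff)
    also have "\<dots> = distr (distr lborel borel ((+) (T c))) borel T'"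
      by (subst distr_distr) (auto simp: o_def)
    finally show ?thesis by (simp add: lborel_distr_plus \<nu>_def)
  qed
  ultimately have *: "emeasure \<nu> X * emeasure lborel S = emeasure lborel X * emeasure \<nu> S"
    using X S by (intro translation_invariant_measure_unique) (auto simp: \<nu>_def)
  have vim: "T' -` Y = T ` Y" for Y
    using TT' by (auto simp: fun_eq_iff image_iff) metis
  show ?thesis
    using * X S unfolding \<nu>_def by (simp add: emeasure_distr vim)
qed

lemma emeasure_lborel_translation:
  fixes a :: "'a::euclidean_space"
  assumes "(+) a ` Y \<in> sets borel"
  shows "emeasure lborel ((+) a ` Y) = emeasure lborel Y"
proof -
  have "emeasure lborel ((+) a ` Y) = emeasure (distr lborel borel ((+) a)) ((+) a ` Y)"
    by (simp add: lborel_distr_plus)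
  also have "\<dots> = emeasure lborel Y"
    using assms by (subst emeasure_distr) (auto intro!: arg_cong[of _ _ "emeasure lborel"])
  finally show ?thesis .
qed

lemma uniform_measure_affine_image:
  fixes T :: "'a::euclidean_space \<Rightarrow> 'a"
  assumes T: "linear T" "bij T" and S: "S \<in> sets borel"
    and pos: "emeasure lborel S \<noteq> 0" "emeasure lborel S \<noteq> \<infinity>"
    and im: "(+) a ` T ` S \<in> sets borel"
      "emeasure lborel ((+) a ` T ` S) \<noteq> 0" "emeasure lborel ((+) a ` T ` S) \<noteq> \<infinity>"
  shows "uniform_measure lborel ((+) a ` T ` S) = distr (uniform_measure lborel S) borel (\<lambda>w. a + T w)"
proof (rule measure_eqI)
  have Tm[measurable]: "T \<in> borel \<rightarrow>\<^sub>M borel"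
    using T by (auto intro!: borel_measurable_continuous_onI linear_continuous_on simp: linear_conv_bounded_linear)
  fix X assume "X \<in> sets (uniform_measure lborel ((+) a ` T ` S))"
  then have X[measurable]: "X \<in> sets borel" by simp
  have XX: "(\<lambda>w. a + T w) -` X \<in> sets borel"
    by (rule measurable_sets_borel[of _ borel, OF _ X]) measurable
  let ?Y = "S \<inter> (\<lambda>w. a + T w) -` X"
  have img: "(+) a ` T ` S \<inter> X = (+) a ` T ` ?Y" by auto
  have e1: "emeasure lborel ((+) a ` T ` S) = emeasure lborel (T ` S)"
    and e2: "emeasure lborel ((+) a ` T ` S \<inter> X) = emeasure lborel (T ` ?Y)"
    using emeasure_lborel_translation[of a "T ` S"] emeasure_lborel_translation[of a "T ` ?Y"] im X by (auto simp flip: img)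
  have p: "emeasure lborel (T ` ?Y) * emeasure lborel S = emeasure lborel ?Y * emeasure lborel (T ` S)"
    using S XX by (intro emeasure_linear_image_proportional T) auto
  have "emeasure lborel (T ` ?Y) / emeasure lborel (T ` S) = emeasure lborel ?Y / emeasure lborel S"
    using p pos im(2,3) unfolding e1
    by (metis (no_types, lifting) ennreal_times_divide ennreal_mult_divide_eq infinity_ennreal_def mult.commute mult_divide_eq_ennreal)
  then show "emeasure (uniform_measure lborel ((+) a ` T ` S)) X
      = emeasure (distr (uniform_measure lborel S) borel (\<lambda>w. a + T w)) X"
    using S XX im X e1 e2 by (simp add: emeasure_distr)
qed simp

section \<open>The polyballs\<close>

definition unit_polyball :: "nat \<Rightarrow> (complex^('n::{finite,linorder})) set" where
  "unit_polyball q = {z. L2_set (\<lambda>i. norm (z $ i)) (first_coords q) < 1 \<and>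
         L2_set (\<lambda>i. norm (z $ i)) (- first_coords q) < 1}"

definition polyball_map ::
  "nat \<Rightarrow> real \<Rightarrow> real \<Rightarrow> complex^('n::{finite,linorder})^('n::{finite,linorder})
     \<Rightarrow> complex^('n::{finite,linorder}) \<Rightarrow> complex^('n::{finite,linorder})" where
  "polyball_map q r s A w = A *v (\<chi> i. of_real (if i \<in> first_coords q then r else s) * w $ i)"

lemma unit_polyball_open: "open (unit_polyball q)"
proof -
  have "continuous_on UNIV (\<lambda>z::complex^'n. L2_set (\<lambda>i. norm (z $ i)) X)" for X
    unfolding L2_set_def by (intro continuous_intros)
  then show ?thesis
    unfolding unit_polyball_def Collect_conj_eq
    by (intro open_Int open_Collect_less) (auto intro: continuous_intros)
qed

lemma unit_polyball_scale:
  assumes "z \<in> unit_polyball q" "norm c \<le> 1"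
  shows "c *s z \<in> unit_polyball q"
proof -
  have "L2_set (\<lambda>i. norm ((c *s z) $ i)) X \<le> L2_set (\<lambda>i. norm (z $ i)) X" for X
    using assms(2) by (intro L2_set_mono) (auto simp: norm_mult mult_left_le_one_le)
  then show ?thesis
    using assms(1) unfolding unit_polyball_def by (auto intro: le_less_trans)
qed

lemma unit_polyball_cong:
  assumes "z \<in> unit_polyball q" "\<And>i. norm (w $ i) = norm ((z :: complex^('n::{finite,linorder})) $ i)"
  shows "w \<in> unit_polyball q"
  using assms by (simp add: unit_polyball_def)

lemma zero_in_unit_polyball: "0 \<in> unit_polyball q"
  by (simp add: unit_polyball_def L2_set_def)

lemma unit_polyball_convex: "convex (unit_polyball q)"
proof (rule convexI)
  fix x y :: "complex^('n::{finite,linorder})" and u v :: real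
  assume xy: "x \<in> unit_polyball q" "y \<in> unit_polyball q" and uv: "0 \<le> u" "0 \<le> v" "u + v = 1"
  have "L2_set (\<lambda>i. norm ((u *\<^sub>R x + v *\<^sub>R y) $ i)) X < 1"
    if "L2_set (\<lambda>i. norm (x $ i)) X < 1" "L2_set (\<lambda>i. norm (y $ i)) X < 1" for X
  proof -
    have "L2_set (\<lambda>i. norm ((u *\<^sub>R x + v *\<^sub>R y) $ i)) X
        \<le> L2_set (\<lambda>i. u * norm (x $ i) + v * norm (y $ i)) X"
      using uv by (intro L2_set_mono) (auto intro!: order_trans[OF norm_triangle_ineq])
    also have "\<dots> \<le> L2_set (\<lambda>i. u * norm (x $ i)) X + L2_set (\<lambda>i. v * norm (y $ i)) X"
      by (rule L2_set_triangle_ineq)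
    also have "\<dots> = u * L2_set (\<lambda>i. norm (x $ i)) X + v * L2_set (\<lambda>i. norm (y $ i)) X"
      using uv by (simp add: L2_set_right_distrib)
    also have "\<dots> < 1"
      using that uv convex_bound_lt by blast
    finally show ?thesis .
  qed
  with xy show "u *\<^sub>R x + v *\<^sub>R y \<in> unit_polyball q"
    by (auto simp: unit_polyball_def)
qed

lemma unit_polyball_norm_component: "z \<in> unit_polyball q \<Longrightarrow> norm (z $ i) \<le> 1"
  using member_le_L2_set[of "first_coords q" i "\<lambda>i. norm (z $ i)"]
    member_le_L2_set[of "- first_coords q" i "\<lambda>i. norm (z $ i)"]
  by (cases "i \<in> first_coords q") (force simp: unit_polyball_def)+

lemma unit_polyball_bounded: "bounded (unit_polyball q :: (complex^('n::{finite,linorder})) set)"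
proof (rule boundedI)
  fix z :: "complex^('n::{finite,linorder})" assume "z \<in> unit_polyball q"
  then have "(\<Sum>i\<in>UNIV. norm (z $ i)) \<le> (\<Sum>i\<in>(UNIV::'n set). 1)"
    by (intro sum_mono unit_polyball_norm_component)
  then show "norm z \<le> real CARD('n)"
    using L2_set_le_sum[of UNIV "\<lambda>i. norm (z $ i)"]
    by (simp add: norm_vec_def)
qed

lemma polyball_eq_image:
  fixes A :: "complex^('n::{finite,linorder})^('n::{finite,linorder})"
  assumes "0 < r" "0 < s"
  shows "polyball q r s A = polyball_map q r s A ` unit_polyball q"
proof -
  let ?D = "\<lambda>r s w. (\<chi> i. of_real (if i \<in> first_coords q then r else s) * w $ i) :: complex^('n::{finite,linorder})"
  have "{z :: complex^('n::{finite,linorder}). L2_set (\<lambda>i. norm (z $ i)) (first_coords q) < r \<and>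
         L2_set (\<lambda>i. norm (z $ i)) (- first_coords q) < s} = ?D r s ` unit_polyball q" (is "?L = _")
  proof (intro equalityI subsetI)
    fix z assume z: "z \<in> ?L"
    have "L2_set (\<lambda>i. norm (?D (1/r) (1/s) z $ i)) (first_coords q) = (1/r) * L2_set (\<lambda>i. norm (z $ i)) (first_coords q)"
      using assms by (subst L2_set_right_distrib) (auto simp: norm_divide intro!: L2_set_cong)
    moreover have "L2_set (\<lambda>i. norm (?D (1/r) (1/s) z $ i)) (- first_coords q) = (1/s) * L2_set (\<lambda>i. norm (z $ i)) (- first_coords q)"
      using assms by (subst L2_set_right_distrib) (auto simp: norm_divide intro!: L2_set_cong)
    ultimately have "?D (1/r) (1/s) z \<in> unit_polyball q"
      using z assms unfolding unit_polyball_def mem_Collect_eq by simp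
    moreover have "z = ?D r s (?D (1/r) (1/s) z)"
      using assms by (simp add: vec_eq_iff)
    ultimately show "z \<in> ?D r s ` unit_polyball q" by blast
  next
    fix z assume "z \<in> ?D r s ` unit_polyball q"
    then obtain w where w: "w \<in> unit_polyball q" "z = ?D r s w" by blast
    have "L2_set (\<lambda>i. norm (?D r s w $ i)) (first_coords q) = r * L2_set (\<lambda>i. norm (w $ i)) (first_coords q)"
      using assms by (subst L2_set_right_distrib) (auto simp: norm_mult intro!: L2_set_cong)
    moreover have "L2_set (\<lambda>i. norm (?D r s w $ i)) (- first_coords q) = s * L2_set (\<lambda>i. norm (w $ i)) (- first_coords q)"
      using assms by (subst L2_set_right_distrib) (auto simp: norm_mult intro!: L2_set_cong)
    ultimately show "z \<in> ?L"
      using w assms by (simp add: unit_polyball_def)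
  qed
  then show ?thesis
    by (simp add: polyball_def image_image polyball_map_def)
qed

lemma polyball_map_scale: "polyball_map q r s A (c *s w) = c *s polyball_map q r s A w"
proof -
  have "(\<chi> i. of_real (if i \<in> first_coords q then r else s) * (c *s w) $ i)
     = c *s (\<chi> i. of_real (if i \<in> first_coords q then r else s) * w $ i)"
    by (simp add: vec_eq_iff)
  then show ?thesis by (simp add: polyball_map_def vector_scalar_commute)
qed

lemma polyball_map_linear:
  fixes A :: "complex^('n::{finite,linorder})^('n::{finite,linorder})"
  shows "linear (polyball_map q r s A)"
proof (rule linearI)
  show "polyball_map q r s A (x + y) = polyball_map q r s A x + polyball_map q r s A y" for x y
    unfolding polyball_map_def matrix_vector_right_distrib[symmetric]
    by (rule arg_cong[of _ _ "(*v) A"]) (simp add: vec_eq_iff distrib_left)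
  have "c *\<^sub>R x = complex_of_real c *s x" for c :: real and x :: "complex^('n::{finite,linorder})"
    by (simp add: vec_eq_iff scaleR_conv_of_real[where 'a=complex])
  then show "polyball_map q r s A (c *\<^sub>R x) = c *\<^sub>R polyball_map q r s A x" for c x
    by (simp add: polyball_map_scale)
qed

lemma polyball_map_bij:
  assumes "0 < r" "0 < s" "unitary A"
  shows "bij (polyball_map q r s A)"
proof -
  have "inj (polyball_map q r s A)"
  proof (rule injI)
    fix x y assume "polyball_map q r s A x = polyball_map q r s A y"
    then have "map_matrix cnj (transpose A) *v polyball_map q r s A x
       = map_matrix cnj (transpose A) *v polyball_map q r s A y" by simp
    then have *: "(\<chi> i. of_real (if i \<in> first_coords q then r else s) * x $ i)
       = (\<chi> i. of_real (if i \<in> first_coords q then r else s) * y $ i)"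
      using assms by (simp add: polyball_map_def matrix_vector_mul_assoc unitary_def)
    show "x = y"
      unfolding vec_eq_iff
    proof
      fix i show "x $ i = y $ i"
        using arg_cong[OF *, of "\<lambda>v. v $ i"] assms by (simp split: if_splits)
    qed
  qed
  then show ?thesis
    using linear_inj_imp_surj[OF polyball_map_linear] by (simp add: bij_def)
qed

lemma open_linear_bij_image:
  fixes T :: "'a::euclidean_space \<Rightarrow> 'a"
  assumes "linear T" "bij T" "open S" shows "open ((+) a ` T ` S)"
  using assms by (metis bij_is_surj open_surjective_linear_image open_translation)

text \<open>Means over the various polyballs are all expressed through this one probability measure: radii, unitary
  matrix and centre move into the integrand through \<open>w \<mapsto> a + polyball_map q r s A w\<close>.\<close>

definition avg :: "nat \<Rightarrow> (complex^('n::{finite,linorder})) measure" where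
  "avg q = uniform_measure lborel (unit_polyball q)"

lemma emeasure_open_bounded:
  fixes S :: "'a::euclidean_space set"
  assumes "open S" "bounded S" "S \<noteq> {}"
  shows "emeasure lborel S \<noteq> 0" "emeasure lborel S \<noteq> \<infinity>"
proof -
  show "emeasure lborel S \<noteq> \<infinity>"
    using emeasure_bounded_finite[OF assms(2)] by (simp add: top.not_eq_extremum)
  show "emeasure lborel S \<noteq> 0"
    using open_not_negligible[OF assms(1,3)] assms(1)
    by (metis emeasure_notin_sets negligible_iff_null_sets null_setsI null_sets_completionI sets_lborel borel_open)
qed

lemma avg_affine:
  fixes T :: "complex^('n::{finite,linorder}) \<Rightarrow> complex^('n::{finite,linorder})"
  assumes "linear T" "bij T"
  shows "uniform_measure lborel ((+) a ` T ` unit_polyball q) = distr (avg q) borel (\<lambda>w. a + T w)"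
  unfolding avg_def
  using assms unit_polyball_open[of q] unit_polyball_bounded[of q] zero_in_unit_polyball[of q]
  by (intro uniform_measure_affine_image emeasure_open_bounded)
     (auto intro!: emeasure_open_bounded open_linear_bij_image bounded_translation bounded_linear_image borel_open
        simp: linear_conv_bounded_linear)

lemma avg_invariant:
  fixes T :: "complex^('n::{finite,linorder}) \<Rightarrow> complex^('n::{finite,linorder})"
  assumes "linear T" "bij T" "T ` unit_polyball q = unit_polyball q"
  shows "distr (avg q) borel T = avg q"
  using avg_affine[OF assms(1,2), of 0 q] assms(3) by (simp add: avg_def image_image)

lemma emeasure_avg_UNIV: "emeasure (avg q :: (complex^('n::{finite,linorder})) measure) UNIV = 1"
proof -
  have "(unit_polyball q :: (complex,'n) vec set) \<noteq> {}" using zero_in_unit_polyball by blast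
  note * = emeasure_open_bounded[OF unit_polyball_open unit_polyball_bounded this]
  show ?thesis
    using * by (simp add: avg_def unit_polyball_open ennreal_divide_self top.not_eq_extremum)
qed

lemma finite_measure_avg: "finite_measure (avg q)"
  by (rule finite_measureI) (simp add: avg_def emeasure_avg_UNIV[unfolded avg_def])

lemma sets_avg[measurable_cong, simp]: "sets (avg q) = sets borel"
  by (simp add: avg_def)

lemma AE_avg: "AE w in avg q. w \<in> unit_polyball q"
  unfolding avg_def by (intro AE_uniform_measureI) (auto simp: unit_polyball_open)

section \<open>Holomorphic functions of several variables\<close>

lemma norm_vector_scalar_mult: "norm (c *s (w :: complex^'n)) = norm c * norm w"
  by (simp add: norm_vec_def L2_set_right_distrib norm_mult)

lemma scaleR_eq_vector_scalar_mult: "r *\<^sub>R (w :: complex^'n) = complex_of_real r *s w"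
  by (simp add: vec_eq_iff scaleR_conv_of_real[where 'a=complex])

lemma continuous_on_vector_scalar_mult [continuous_intros]:
  fixes g :: "'a::topological_space \<Rightarrow> complex^'n"
  assumes "continuous_on S f" "continuous_on S g"
  shows "continuous_on S (\<lambda>x. f x *s g x)"
  unfolding vector_scalar_mult_def
  by (intro continuous_on_vec_lambda continuous_intros assms)

lemma has_derivative_line:
  fixes w :: "complex^'n"
  shows "((\<lambda>\<zeta>. a + \<zeta> *s w) has_derivative (\<lambda>\<zeta>. \<zeta> *s w)) (at x)"
proof -
  have "bounded_linear (\<lambda>\<zeta>::complex. \<zeta> *s w)"
    by (rule bounded_linear_intro[where K="norm w"])
       (auto simp: vec_eq_iff algebra_simps norm_vector_scalar_mult scaleR_conv_of_real[where 'a=complex])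
  then show ?thesis
    by (auto intro!: derivative_eq_intros bounded_linear_imp_has_derivative)
qed

lemma open_line_vimage:
  fixes w :: "complex^'n"
  assumes "open S" shows "open {\<zeta>. a + \<zeta> *s w \<in> S}"
proof -
  have "continuous_on UNIV (\<lambda>\<zeta>. a + \<zeta> *s w)" by (intro continuous_intros)
  then show ?thesis using assms by (simp add: continuous_on_open_vimage vimage_def)
qed

lemma holomorphic_vec_on_subset: "holomorphic_vec_on f T \<Longrightarrow> S \<subseteq> T \<Longrightarrow> holomorphic_vec_on f S"
  by (auto simp: holomorphic_vec_on_def)

lemma holomorphic_vec_on_const: "holomorphic_vec_on (\<lambda>z. c) S"
  unfolding holomorphic_vec_on_def by (auto intro!: exI[of _ "\<lambda>v. 0"])

lemma holomorphic_vec_on_component: "holomorphic_vec_on (\<lambda>z. z $ i) S"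
  unfolding holomorphic_vec_on_def
  by (auto intro!: exI[of _ "\<lambda>v. v $ i"] bounded_linear_imp_has_derivative bounded_linear_vec_nth)

lemma holomorphic_vec_on_add:
  assumes "holomorphic_vec_on f S" "holomorphic_vec_on g S"
  shows "holomorphic_vec_on (\<lambda>z. f z + g z) S"
  unfolding holomorphic_vec_on_def
proof
  fix z assume "z \<in> S"
  then obtain f' g' where "(f has_derivative f') (at z)" "\<forall>c v. f' (c *s v) = c * f' v"
    "(g has_derivative g') (at z)" "\<forall>c v. g' (c *s v) = c * g' v"
    using assms unfolding holomorphic_vec_on_def by metis
  then show "\<exists>h'. ((\<lambda>z. f z + g z) has_derivative h') (at z) \<and> (\<forall>c v. h' (c *s v) = c * h' v)"
    by (intro exI[of _ "\<lambda>v. f' v + g' v"]) (auto intro: derivative_eq_intros simp: algebra_simps)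
qed

lemma holomorphic_vec_on_mult:
  assumes "holomorphic_vec_on f S" "holomorphic_vec_on g S"
  shows "holomorphic_vec_on (\<lambda>z. f z * g z) S"
  unfolding holomorphic_vec_on_def
proof
  fix z assume "z \<in> S"
  then obtain f' g' where "(f has_derivative f') (at z)" "\<forall>c v. f' (c *s v) = c * f' v"
    "(g has_derivative g') (at z)" "\<forall>c v. g' (c *s v) = c * g' v"
    using assms unfolding holomorphic_vec_on_def by metis
  then show "\<exists>h'. ((\<lambda>z. f z * g z) has_derivative h') (at z) \<and> (\<forall>c v. h' (c *s v) = c * h' v)"
    by (intro exI[of _ "\<lambda>v. f z * g' v + f' v * g z"]) (auto intro!: has_derivative_mult simp: algebra_simps)
qed

lemma holomorphic_vec_on_sum:
  "(\<And>i. i \<in> I \<Longrightarrow> holomorphic_vec_on (f i) S) \<Longrightarrow> holomorphic_vec_on (\<lambda>z. \<Sum>i\<in>I. f i z) S"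
  by (induction I rule: infinite_finite_induct)
     (auto intro: holomorphic_vec_on_add holomorphic_vec_on_const)

lemma holomorphic_vec_on_diff:
  assumes "holomorphic_vec_on f S" "holomorphic_vec_on g S"
  shows "holomorphic_vec_on (\<lambda>z. f z - g z) S"
  using holomorphic_vec_on_add[OF assms(1) holomorphic_vec_on_mult[OF holomorphic_vec_on_const[of "-1"] assms(2)]]
  by simp

lemmas holomorphic_vec_on_intros =
  holomorphic_vec_on_const holomorphic_vec_on_component holomorphic_vec_on_add holomorphic_vec_on_diff
  holomorphic_vec_on_mult holomorphic_vec_on_sum

lemma holomorphic_vec_on_cong_open:
  assumes "holomorphic_vec_on f S" "open S" "\<And>z. z \<in> S \<Longrightarrow> f z = g z"
  shows "holomorphic_vec_on g S"
  unfolding holomorphic_vec_on_def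
proof
  fix z assume z: "z \<in> S"
  then obtain f' where f': "(f has_derivative f') (at z)" "\<forall>c v. f' (c *s v) = c * f' v"
    using assms(1) unfolding holomorphic_vec_on_def by metis
  have "(g has_derivative f') (at z)"
    by (rule has_derivative_transform_within_open[OF f'(1) assms(2) z]) (use assms(3) in auto)
  with f'(2) show "\<exists>f'. (g has_derivative f') (at z) \<and> (\<forall>c v. f' (c *s v) = c * f' v)" by blast
qed

lemma holomorphic_vec_on_continuous: "holomorphic_vec_on f S \<Longrightarrow> continuous_on S f"
  unfolding holomorphic_vec_on_def
  by (meson continuous_at_imp_continuous_on has_derivative_continuous)

lemma holomorphic_vec_on_line:
  assumes "holomorphic_vec_on f S"
  shows "(\<lambda>\<zeta>. f (a + \<zeta> *s w)) holomorphic_on {\<zeta>. a + \<zeta> *s w \<in> S}"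
  unfolding holomorphic_on_def
proof
  fix x assume "x \<in> {\<zeta>. a + \<zeta> *s w \<in> S}"
  then obtain f' where f': "(f has_derivative f') (at (a + x *s w))" "\<forall>c v. f' (c *s v) = c * f' v"
    using assms unfolding holomorphic_vec_on_def by blast
  have "((\<lambda>\<zeta>. f (a + \<zeta> *s w)) has_derivative (\<lambda>\<zeta>. f' (\<zeta> *s w))) (at x)"
    using has_derivative_compose[OF has_derivative_line f'(1)] .
  then have "((\<lambda>\<zeta>. f (a + \<zeta> *s w)) has_field_derivative f' w) (at x)"
    unfolding has_field_derivative_def using f'(2) by (simp add: mult.commute[of _ "f' w"])
  then show "(\<lambda>\<zeta>. f (a + \<zeta> *s w)) field_differentiable at x within {\<zeta>. a + \<zeta> *s w \<in> S}"
    using field_differentiable_at_within field_differentiable_def by blast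
qed

text \<open>The derivative takes real values, but it is complex-linear, so it vanishes.\<close>

lemma holomorphic_vec_on_real_valued_constant:
  assumes hol: "holomorphic_vec_on f S" and S: "open S" "convex S"
    and real: "\<And>z. z \<in> S \<Longrightarrow> Im (f z) = 0" and ab: "a \<in> S" "b \<in> S"
  shows "f a = f b"
proof -
  have "(f has_derivative (\<lambda>v. 0)) (at z within S)" if z: "z \<in> S" for z
  proof -
    obtain f' where f': "(f has_derivative f') (at z)" "\<And>c v. f' (c *s v) = c * f' v"
      using hol z unfolding holomorphic_vec_on_def by blast
    have "((\<lambda>z. Im (f z)) has_derivative (\<lambda>v. Im (f' v))) (at z)"
      using f'(1) by (auto intro!: derivative_eq_intros)
    moreover have "((\<lambda>z. Im (f z)) has_derivative (\<lambda>v. 0)) (at z)"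
      by (rule has_derivative_transform_within_open[OF _ S(1) z, of "\<lambda>_. 0"]) (use real in auto)
    ultimately have "Im (f' v) = 0" for v
      by (metis has_derivative_unique)
    from this[of "\<i> *s _"] this have "f' v = 0" for v
      by (simp add: f'(2) complex_eq_iff)
    then have "f' = (\<lambda>v. 0)" by auto
    with f' show ?thesis using has_derivative_at_withinI by blast
  qed
  from has_derivative_zero_constant[OF S(2) this] obtain c where "\<forall>x\<in>S. f x = c" by blast
  with ab show ?thesis by auto
qed

subsection \<open>Osgood's lemma\<close>

text \<open>The constant comes from Cauchy's estimate for the second derivative on circles of radius
  \<open>1/4\<close> about points of the disc of radius \<open>1/2\<close>: \<open>2! B / (1/4)\<^sup>2 =
  32 B\<close>.\<close>

lemma holomorphic_remainder_bound:
  assumes hol: "g holomorphic_on ball 0 1" and B: "\<And>z. z \<in> ball 0 1 \<Longrightarrow> norm (g z) \<le> B"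
    and t: "norm t \<le> 1/2"
  shows "norm (g t - g 0 - t * deriv g 0) \<le> 32 * B * (norm t)\<^sup>2"
proof -
  have hol1: "deriv g holomorphic_on ball 0 1" by (simp add: hol holomorphic_deriv)
  have B2: "norm (deriv (deriv g) z) \<le> 32 * B" if z: "norm z \<le> 1/2" for z
  proof -
    have sub: "cball z (1/4) \<subseteq> ball 0 1"
    proof
      fix x assume "x \<in> cball z (1/4)"
      then have "norm (x - z) \<le> 1/4" by (simp add: dist_norm norm_minus_commute)
      with z norm_triangle_ineq[of "x - z" z] show "x \<in> ball 0 1" by (simp add: dist_norm)
    qed
    have "norm ((deriv ^^ 2) g z) \<le> fact 2 * B / (1/4)^2"
    proof (rule Cauchy_inequality)
      show "g holomorphic_on ball z (1/4)"
        using hol by (rule holomorphic_on_subset) (use sub ball_subset_cball in blast)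
      show "continuous_on (cball z (1/4)) g"
        using hol sub continuous_on_subset holomorphic_on_imp_continuous_on by blast
    qed (use B sub in \<open>auto simp: subset_iff dist_norm\<close>)
    then show ?thesis by (simp add: numeral_2_eq_2)
  qed
  have d1: "norm (deriv g x - deriv g 0) \<le> 32 * B * norm t" if "norm x \<le> norm t" for x
  proof -
    have "norm (deriv g x - deriv g 0) \<le> 32 * B * norm (x - 0)"
    proof (rule field_differentiable_bound[of "cball 0 (1/2)" _ "deriv (deriv g)"])
      show "(deriv g has_field_derivative deriv (deriv g) z) (at z within cball 0 (1/2))"
        if "z \<in> cball 0 (1/2)" for z
        by (rule has_field_derivative_at_within, rule holomorphic_derivI[OF hol1]) (use that in auto)
    qed (use B2 t that in \<open>auto simp: dist_norm\<close>)
    also have "\<dots> \<le> 32 * B * norm t"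
      using that order_trans[OF norm_ge_zero B2[of 0]] by (intro mult_left_mono) auto
    finally show ?thesis .
  qed
  have "norm ((g t - t * deriv g 0) - (g 0 - 0 * deriv g 0)) \<le> 32 * B * norm t * norm (t - 0)"
  proof (rule field_differentiable_bound[of "cball 0 (norm t)" _ "\<lambda>x. deriv g x - deriv g 0"])
    show "((\<lambda>z. g z - z * deriv g 0) has_field_derivative deriv g z - deriv g 0) (at z within cball 0 (norm t))"
      if "z \<in> cball 0 (norm t)" for z
    proof -
      have "(g has_field_derivative deriv g z) (at z within cball 0 (norm t))"
        by (rule has_field_derivative_at_within, rule holomorphic_derivI[OF hol]) (use that t in auto)
      then show ?thesis by (auto intro!: derivative_eq_intros)
    qed
  qed (use d1 in \<open>auto simp: dist_norm\<close>)
  then show ?thesis by (simp add: power2_eq_square algebra_simps)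
qed

text \<open>This is what makes it possible to reduce parameter integrals and limits to one complex variable. The
  complex directional derivatives \<open>D x w\<close> exist by hypothesis and are homogeneous in
  \<open>w\<close>; the Cauchy estimates bound the Taylor remainder on lines by \<open>C
  |w|\<^sup>2\<close>, uniformly in the direction. Only the additivity of \<open>D z\<close> is not
  automatic: it follows by going from \<open>z\<close> to \<open>z + t(u + v)\<close> directly and through
  \<open>z + t u\<close>, because \<open>D x v\<close> is continuous in \<open>x\<close> by the Cauchy
  estimate for differences.\<close>

theorem holomorphic_vec_on_lines:
  fixes f :: "complex^'n \<Rightarrow> complex"
  assumes S: "open S" and cont: "continuous_on S f"
    and hol: "\<And>a w. a \<in> S \<Longrightarrow> (\<lambda>\<zeta>. f (a + \<zeta> *s w)) holomorphic_on {\<zeta>. a + \<zeta> *s w \<in> S}"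
  shows "holomorphic_vec_on f S"
  unfolding holomorphic_vec_on_def
proof
  fix z assume z: "z \<in> S"
  obtain \<rho>' where \<rho>': "\<rho>' > 0" "cball z \<rho>' \<subseteq> S"
    using S z open_contains_cball by blast
  define \<rho> where "\<rho> = \<rho>' / 2"
  have \<rho>: "\<rho> > 0" "cball z (2 * \<rho>) \<subseteq> S" using \<rho>' by (auto simp: \<rho>_def)
  have contz: "continuous_on (cball z (2 * \<rho>)) f" using cont \<rho>(2) continuous_on_subset by blast
  obtain B where B: "\<And>x. x \<in> cball z (2 * \<rho>) \<Longrightarrow> norm (f x) \<le> B"
    using compact_imp_bounded[OF compact_continuous_image[OF contz compact_cball]]
    unfolding bounded_iff by blast
  have inS: "x + \<zeta> *s w \<in> cball z (2 * \<rho>)" if "x \<in> cball z \<rho>" "norm w \<le> \<rho>" "norm \<zeta> \<le> 1" for x w \<zeta>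
  proof -
    have "norm (\<zeta> *s w) \<le> \<rho>"
      using that \<rho>(1) mult_mono[of "norm \<zeta>" 1 "norm w" \<rho>] by (simp add: norm_vector_scalar_mult)
    then show ?thesis
      using that norm_triangle_ineq[of "x - z" "\<zeta> *s w"] by (simp add: dist_norm norm_minus_commute algebra_simps)
  qed
  define D where "D x w = deriv (\<lambda>\<zeta>. f (x + \<zeta> *s w)) 0" for x w
  have zS: "x \<in> S" if "x \<in> cball z \<rho>" for x using that \<rho> by auto
  have D_scale: "D x (c *s w) = c * D x w" if "x \<in> S" for x c w
  proof -
    have "(\<lambda>\<zeta>. f (x + \<zeta> *s w)) field_differentiable at 0"
      by (rule holomorphic_on_imp_differentiable_at[OF hol[OF that] open_line_vimage[OF S]]) (use that in simp)
    then have 1: "((\<lambda>\<zeta>. f (x + \<zeta> *s w)) has_field_derivative D x w) (at (0 * c))"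
      by (simp add: D_def DERIV_deriv_iff_field_differentiable)
    have "((\<lambda>\<zeta>. f (x + (\<zeta> * c) *s w)) has_field_derivative D x w * c) (at 0)"
      by (rule DERIV_chain'[of "\<lambda>\<zeta>. \<zeta> * c" _ _ _ "\<lambda>\<zeta>. f (x + \<zeta> *s w)", OF _ 1, THEN DERIV_cong]) (auto intro!: derivative_eq_intros)
    then show ?thesis
      unfolding D_def by (simp add: DERIV_imp_deriv vector_smult_assoc)
  qed
  have disc: "(\<lambda>\<zeta>. f (x + \<zeta> *s w)) holomorphic_on ball 0 1"
    if "x \<in> cball z \<rho>" "norm w \<le> \<rho>" for x w
    using hol[OF zS[OF that(1)], of w] by (rule holomorphic_on_subset) (use inS[OF that] \<rho>(2) in \<open>auto simp: subset_iff\<close>)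
  define C where "C = 32 * B / \<rho>\<^sup>2"
  have rem: "norm (f (x + w) - f x - D x w) \<le> C * (norm w)\<^sup>2"
    if x: "x \<in> cball z \<rho>" and w: "norm w \<le> \<rho> / 2" for x w
  proof (cases "w = 0")
    case True
    then show ?thesis using D_scale[OF zS[OF x], of 0 0] by simp
  next
    case False
    define t where "t = complex_of_real (norm w / \<rho>)"
    define u where "u = complex_of_real (\<rho> / norm w) *s w"
    have tu: "t *s u = w" using False \<rho>(1) by (simp add: t_def u_def vector_smult_assoc)
    have u: "norm u \<le> \<rho>" using False \<rho>(1) by (simp add: u_def norm_vector_scalar_mult norm_divide)
    have t: "norm t = norm w / \<rho>" using \<rho>(1) by (simp add: t_def norm_divide)
    have t2: "norm t \<le> 1/2" using w \<rho>(1) unfolding t by (simp add: field_simps)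
    have "norm (f (x + t *s u) - f (x + 0 *s u) - t * D x u) \<le> 32 * B * (norm t)\<^sup>2"
      unfolding D_def
      by (rule holomorphic_remainder_bound[OF disc[OF x u]]) (use inS[OF x u] B t2 in auto)
    then show ?thesis
      by (simp add: tu t D_scale[OF zS[OF x], symmetric] C_def power_divide)
  qed
  have Dcont: "((\<lambda>x. D x w) \<longlongrightarrow> D z w) (at z)" for w
  proof -
    define c where "c = norm w / \<rho> + 1"
    \<comment> \<open>homogeneity reduces to directions short enough for the disc of radius 1 to stay inside the
      ball\<close>
    define u where "u = complex_of_real (1 / c) *s w"
    have c: "c > 0" using \<rho>(1) by (simp add: c_def add_nonneg_pos)
    have wu: "w = complex_of_real c *s u" using c by (simp add: u_def vector_smult_assoc)
    have "norm w \<le> \<rho> * c" using \<rho>(1) by (simp add: c_def field_simps)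
    then have u: "norm u \<le> \<rho>" using c by (simp add: u_def norm_vector_scalar_mult norm_divide field_simps)
    have "((\<lambda>x. D x u) \<longlongrightarrow> D z u) (at z)"
      unfolding Lim_at
    proof (intro allI impI)
      fix e :: real assume e: "e > 0"
      have "uniformly_continuous_on (cball z (2 * \<rho>)) f"
        using contz by (simp add: compact_uniformly_continuous)
      then obtain d where d: "d > 0" "\<And>x y. x \<in> cball z (2 * \<rho>) \<Longrightarrow> y \<in> cball z (2 * \<rho>) \<Longrightarrow> dist y x < d \<Longrightarrow> dist (f y) (f x) < e / 4"
        unfolding uniformly_continuous_on_def using e by (metis divide_pos_pos zero_less_numeral)
      show "\<exists>d>0. \<forall>x. 0 < dist x z \<and> dist x z < d \<longrightarrow> dist (D x u) (D z u) < e"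
      proof (intro exI conjI allI impI)
        show "min d \<rho> > 0" using d \<rho> by auto
        fix x assume "0 < dist x z \<and> dist x z < min d \<rho>"
        then have x: "x \<in> cball z \<rho>" "dist x z < d" by (auto simp: dist_commute)
        have zz: "z \<in> cball z \<rho>" using \<rho> by auto
        let ?h = "\<lambda>\<zeta>. f (x + \<zeta> *s u) - f (z + \<zeta> *s u)"
        have holh: "?h holomorphic_on ball 0 1"
          by (intro holomorphic_intros disc x zz u)
        have "norm ((deriv ^^ 1) ?h 0) \<le> fact 1 * (e / 4) / (1/2)^1"
        proof (rule Cauchy_inequality)
          show "?h holomorphic_on ball 0 (1/2)" by (rule holomorphic_on_subset[OF holh]) auto
          show "continuous_on (cball 0 (1/2)) ?h"
            by (rule continuous_on_subset[OF holomorphic_on_imp_continuous_on[OF holh]]) auto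
          fix \<zeta> :: complex assume "norm (0 - \<zeta>) = 1/2"
          then have "norm \<zeta> \<le> 1" by simp
          from d(2)[OF inS[OF zz u this] inS[OF x(1) u this]] x(2)
          show "norm (?h \<zeta>) \<le> e / 4" by (simp add: dist_norm)
        qed simp
        moreover have "deriv ?h 0 = D x u - D z u"
          unfolding D_def
          by (rule deriv_diff; rule holomorphic_on_imp_differentiable_at[OF disc]) (use x zz u in auto)
        ultimately show "dist (D x u) (D z u) < e" using e by (simp add: dist_norm)
      qed
    qed
    then have "((\<lambda>x. complex_of_real c * D x u) \<longlongrightarrow> complex_of_real c * D z u) (at z)"
      by (intro tendsto_intros)
    moreover have "\<forall>\<^sub>F x in at z. complex_of_real c * D x u = D x w"
      using eventually_at_ball[OF \<rho>(1), of z UNIV]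
      by eventually_elim (use zS in \<open>auto simp: wu D_scale\<close>)
    ultimately show ?thesis
      using z by (simp add: wu D_scale Lim_transform_eventually)
  qed
  have D_add: "D z (u + v) = D z u + D z v" for u v
  proof -
    define K where "K = C * ((norm (u + v))\<^sup>2 + (norm u)\<^sup>2 + (norm v)\<^sup>2)"
    have "\<forall>\<^sub>F t in at_right (0::real). norm (D z (u + v) - D z u - D z v) \<le>
        K * t + norm (D (z + t *\<^sub>R u) v - D z v)"
    proof -
      define m where "m = \<rho> / 2 / (norm u + norm v + norm (u + v) + 1)"
      have m: "m > 0" using \<rho> by (auto simp: m_def intro!: divide_pos_pos add_nonneg_pos)
      have "\<forall>\<^sub>F t in at_right (0::real). 0 < t \<and> t < m"
        using m by (auto simp: eventually_at_right[of 0 1] intro!: exI[of _ m])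
      then show ?thesis
      proof eventually_elim
        case (elim t)
        have small: "norm (t *\<^sub>R x) \<le> \<rho> / 2" if "norm x \<le> norm u + norm v + norm (u + v) + 1" for x :: "complex^'n"
        proof -
          have "norm (t *\<^sub>R x) \<le> m * (norm u + norm v + norm (u + v) + 1)"
            using elim that by (simp add: mult_mono)
          also have "\<dots> = \<rho> / 2"
          proof -
            have "norm u + norm v + norm (u + v) + 1 \<noteq> 0"
              using add_nonneg_pos[of "norm u + norm v + norm (u + v)" 1] by simp
            then show ?thesis unfolding m_def by (metis nonzero_mult_div_cancel_right times_divide_eq_left)
          qed
          finally show ?thesis .
        qed
        have su: "norm (t *\<^sub>R u) \<le> \<rho> / 2" and sv: "norm (t *\<^sub>R v) \<le> \<rho> / 2" and suv: "norm (t *\<^sub>R (u + v)) \<le> \<rho> / 2"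
          by (rule small, simp add: add_nonneg_nonneg)+
        have zz: "z \<in> cball z \<rho>" "z + t *\<^sub>R u \<in> cball z \<rho>" using \<rho> su by (auto simp: dist_norm)
        have DR: "D x (t *\<^sub>R w) = of_real t * D x w" if "x \<in> cball z \<rho>" for x w
          using D_scale[OF zS[OF that], of "of_real t"] by (simp add: scaleR_eq_vector_scalar_mult)
        define R1 where "R1 = f (z + t *\<^sub>R (u + v)) - f z - D z (t *\<^sub>R (u + v))"
        define R2 where "R2 = f (z + t *\<^sub>R u) - f z - D z (t *\<^sub>R u)"
        define R3 where "R3 = f (z + t *\<^sub>R u + t *\<^sub>R v) - f (z + t *\<^sub>R u) - D (z + t *\<^sub>R u) (t *\<^sub>R v)"
        have R: "norm R1 \<le> C * (norm (t *\<^sub>R (u + v)))\<^sup>2" "norm R2 \<le> C * (norm (t *\<^sub>R u))\<^sup>2"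
           "norm R3 \<le> C * (norm (t *\<^sub>R v))\<^sup>2"
          unfolding R1_def R2_def R3_def by (rule rem zz su sv suv)+
        \<comment> \<open>the values of f at the three points cancel\<close>
        have "of_real t * (D z (u + v) - D z u - D z v) = - R1 + R2 + R3 + of_real t * (D (z + t *\<^sub>R u) v - D z v)"
          unfolding R1_def R2_def R3_def DR[OF zz(1)] DR[OF zz(2)]
          by (simp add: algebra_simps)
        then have "norm (of_real t * (D z (u + v) - D z u - D z v))
           \<le> norm R1 + norm R2 + norm R3 + norm (of_real t * (D (z + t *\<^sub>R u) v - D z v))"
          by (smt (verit, best) norm_minus_cancel norm_triangle_ineq)
        also have "\<dots> \<le> C * (norm (t *\<^sub>R (u + v)))\<^sup>2 + C * (norm (t *\<^sub>R u))\<^sup>2 + C * (norm (t *\<^sub>R v))\<^sup>2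
            + norm (of_real t * (D (z + t *\<^sub>R u) v - D z v))"
          using R by linarith
        also have "\<dots> = t * (K * t + norm (D (z + t *\<^sub>R u) v - D z v))"
          using elim unfolding norm_scaleR norm_mult K_def
          by (simp add: power2_eq_square distrib_left distrib_right mult_ac)
        finally show ?case using elim by (simp add: norm_mult)
      qed
    qed
    moreover have "((\<lambda>t. K * t + norm (D (z + t *\<^sub>R u) v - D z v)) \<longlongrightarrow> K * 0 + norm (D z v - D z v)) (at_right 0)"
    proof (intro tendsto_intros)
      have "((\<lambda>x. D x v) \<longlongrightarrow> D z v) (nhds z)"
        using Dcont[of v] by (simp add: tendsto_nhds_iff)
      moreover have "filterlim (\<lambda>t. z + t *\<^sub>R u) (nhds z) (at_right (0::real))"
        by (auto intro!: tendsto_eq_intros)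
      ultimately show "((\<lambda>t. D (z + t *\<^sub>R u) v) \<longlongrightarrow> D z v) (at_right 0)"
        by (rule filterlim_compose)
    qed
    ultimately have "norm (D z (u + v) - D z u - D z v) \<le> K * 0 + norm (D z v - D z v)"
      by (intro tendsto_le[OF _ _ tendsto_const]) auto
    then have "D z (u + v) - D z u - D z v = 0" by simp
    then show ?thesis by (simp add: diff_eq_eq add.commute)
  qed
  have "linear (D z)"
    using D_add D_scale[OF z] by (intro linearI) (auto simp: scaleR_eq_vector_scalar_mult scaleR_conv_of_real)
  then have bl: "bounded_linear (D z)" by (simp add: linear_conv_bounded_linear)
  have "(f has_derivative D z) (at z)"
    unfolding has_derivative_at
  proof (intro conjI bl)
    have "\<forall>\<^sub>F h in at 0. norm (norm (f (z + h) - f z - D z h) / norm h) \<le> C * norm h"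
    proof -
      have "\<forall>\<^sub>F h in at (0 :: complex^'n). h \<in> ball 0 (\<rho>/2) \<and> h \<in> UNIV"
        using \<rho>(1) by (intro eventually_at_ball) auto
      then show ?thesis
      proof eventually_elim
      case (elim h)
      then show ?case
        using rem[of z h] \<rho>(1) by (cases "h = 0") (auto simp: divide_simps power2_eq_square mult.assoc)
      qed
    qed
    moreover have "((\<lambda>h. C * norm h) \<longlongrightarrow> 0) (at 0)"
      by (auto intro!: tendsto_eq_intros)
    ultimately show "(\<lambda>h. norm (f (z + h) - f z - D z h) / norm h) \<midarrow>0\<rightarrow> 0"
      using tendsto_0_le[where K=1 and g="\<lambda>h. C * norm h"] Lim_null_comparison by fast
  qed
  with D_scale[OF z] show "\<exists>f'. (f has_derivative f') (at z) \<and> (\<forall>c v. f' (c *s v) = c * f' v)"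
    by blast
qed

section \<open>Mean value inequality over polyballs\<close>

text \<open>Cauchy's integral formula for the unit circle, with absolute values under the integral.\<close>

lemma circle_mean_value_inequality:
  assumes "open U" "cball 0 1 \<subseteq> U" "g holomorphic_on U"
  shows "ennreal (norm (g 0)) \<le> (\<integral>\<^sup>+t. ennreal (norm (g (exp (2 * of_real pi * \<i> * of_real t)))) * indicator {0..1} t \<partial>lborel)"
proof -
  let ?c = "\<lambda>t::real. exp (2 * of_real pi * \<i> * of_real t)"
  have holc: "g holomorphic_on cball 0 1" using assms holomorphic_on_subset by blast
  have "((\<lambda>u. g u / (u - 0)) has_contour_integral (2 * of_real pi * \<i> * g 0)) (circlepath 0 1)"
    by (rule Cauchy_integral_circlepath_simple[OF holc]) auto
  then have "((\<lambda>x. g (circlepath 0 1 x) / (circlepath 0 1 x - 0) * vector_derivative (circlepath 0 1) (at x within {0..1}))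
      has_integral (2 * of_real pi * \<i> * g 0)) {0..1}"
    by (simp add: has_contour_integral_def)
  then have "((\<lambda>x. (2 * of_real pi * \<i>) * g (?c x)) has_integral (2 * of_real pi * \<i> * g 0)) {0..1}"
    by (rule has_integral_eq[rotated]) (simp add: vector_derivative_circlepath01, simp add: circlepath)
  from has_integral_mult_right[OF this, of "1 / (2 * of_real pi * \<i>)"]
  have I: "((\<lambda>x. g (?c x)) has_integral g 0) {0..1}" by simp
  have cont: "continuous_on {0..1} (\<lambda>x. g (?c x))"
    by (rule continuous_on_compose2[OF holomorphic_on_imp_continuous_on[OF holc]])
       (auto intro!: continuous_intros simp: dist_norm norm_exp_eq_Re)
  then have cn: "continuous_on {0..1} (\<lambda>x. norm (g (?c x)))" by (intro continuous_intros)
  then have J: "((\<lambda>x. norm (g (?c x))) has_integral integral {0..1} (\<lambda>x. norm (g (?c x)))) {0..1}"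
    using integrable_continuous_interval by blast
  have "norm (g 0) \<le> integral {0..1} (\<lambda>x. norm (g (?c x)))"
    using integral_norm_bound_integral[of "\<lambda>x. g (?c x)" "{0..1}" "\<lambda>x. norm (g (?c x))"] I J
    by (metis has_integral_integrable integral_unique order_refl)
  moreover have "(\<integral>\<^sup>+t. ennreal (norm (g (?c t)) * indicator {0..1} t) \<partial>lborel) = ennreal (integral {0..1} (\<lambda>x. norm (g (?c x))))"
  proof (rule nn_integral_has_integral_lborel)
    show "(\<lambda>t. norm (g (?c t)) * indicator {0..1} t) \<in> borel_measurable borel"
      using borel_measurable_continuous_on_indicator[OF _ cn] by (simp add: mult.commute)
    show "((\<lambda>t. norm (g (?c t)) * indicator {0..1} t) has_integral integral {0..1} (\<lambda>x. norm (g (?c x)))) UNIV"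
      using J by (subst (asm) has_integral_restrict_UNIV[symmetric], elim has_integral_eq[rotated]) (auto simp: indicator_def)
  qed auto
  ultimately show ?thesis
    by (simp add: ennreal_mult'' ennreal_leI ennreal_indicator[symmetric] ennreal_mult)
qed

lemma unit_polyball_rotation_image:
  assumes "norm c = 1" shows "(*s) c ` unit_polyball q = unit_polyball q"
proof
  show "(*s) c ` unit_polyball q \<subseteq> unit_polyball q"
    using assms by (auto intro: unit_polyball_scale)
  show "unit_polyball q \<subseteq> (*s) c ` unit_polyball q"
  proof
    fix z assume "z \<in> unit_polyball q"
    then have "inverse c *s z \<in> unit_polyball q"
      using assms by (intro unit_polyball_scale) (auto simp: norm_inverse)
    moreover have "c \<noteq> 0" using assms by auto
    then have "z = c *s (inverse c *s z)" by (simp add: vector_smult_assoc)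
    ultimately show "z \<in> (*s) c ` unit_polyball q" by blast
  qed
qed

lemma linear_vector_scalar_mult: "linear ((*s) (c :: complex) :: complex^'n \<Rightarrow> complex^'n)"
  by (rule linearI) (auto simp: vec_eq_iff algebra_simps)

lemma bij_vector_scalar_mult: "c \<noteq> 0 \<Longrightarrow> bij ((*s) (c :: complex) :: complex^'n \<Rightarrow> complex^'n)"
  by (rule o_bij[of "(*s) (inverse c)"]) (auto simp: fun_eq_iff vector_smult_assoc)

lemma avg_rotation:
  fixes c :: complex
  assumes "norm c = 1" shows "distr (avg q) borel ((*s) c) = avg q"
proof (rule avg_invariant[OF linear_vector_scalar_mult bij_vector_scalar_mult unit_polyball_rotation_image[OF assms]])
  show "c \<noteq> 0" using assms by auto
qed

lemma borel_measurable_restrict_unit_polyball: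
  fixes G :: "(complex^('n::{finite,linorder})) \<Rightarrow> 'b::{real_normed_vector}"
  assumes "continuous_on (unit_polyball q) G"
  shows "(\<lambda>w. if w \<in> unit_polyball q then G w else 0) \<in> borel_measurable borel"
  using borel_measurable_continuous_on_if[OF _ assms continuous_on_const[of _ 0]]
  by (simp add: unit_polyball_open borel_open)

text \<open>Every complex line through 0 meets the polyball in a disc, and the inequality on the circle through
  \<open>w\<close> is averaged over \<open>w\<close>; the polyball and its measure are invariant under the
  rotations \<open>w \<mapsto> c w\<close> with \<open>|c| = 1\<close>, so that averaging over the circle
  drops out.\<close>

lemma polyball_mean_value_inequality_unit:
  fixes G :: "(complex^('n::{finite,linorder})) \<Rightarrow> complex"
  assumes G: "continuous_on (unit_polyball q) G"
    and hol: "\<And>w. w \<in> unit_polyball q \<Longrightarrow> (\<lambda>\<zeta>. G (\<zeta> *s w)) holomorphic_on {\<zeta>. \<zeta> *s w \<in> unit_polyball q}"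
  shows "ennreal (norm (G 0)) \<le> (\<integral>\<^sup>+w. ennreal (norm (G w)) \<partial>avg q)"
proof -
  let ?P = "unit_polyball q :: (complex,'n) vec set"
  let ?c = "\<lambda>t::real. exp (2 * of_real pi * \<i> * of_real t)"
  \<comment> \<open>extension by 0, since G need not be measurable outside the polyball\<close>
  define G0 where "G0 w = (if w \<in> ?P then G w else 0)" for w
  have G0[measurable]: "G0 \<in> borel_measurable borel"
    unfolding G0_def by (rule borel_measurable_restrict_unit_polyball[OF G])
  interpret finite_measure "avg q :: (complex,'n) vec measure" by (rule finite_measure_avg)
  interpret pair_sigma_finite "lborel :: real measure" "avg q :: (complex,'n) vec measure" ..
  have nc: "norm (?c t) = 1" for t by (simp add: norm_exp_eq_Re)
  have cm[measurable]: "(\<lambda>(t, w). ?c t *s w) \<in> borel_measurable (borel \<Otimes>\<^sub>M borel :: (real \<times> (complex,'n) vec) measure)"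
    unfolding borel_prod split_beta
    by (intro borel_measurable_continuous_onI continuous_intros)
  have cm2[measurable]: "(\<lambda>w. c *s w) \<in> borel_measurable (borel :: (complex,'n) vec measure)" for c
    by (intro borel_measurable_continuous_onI continuous_intros)
  have "ennreal (norm (G 0)) = (\<integral>\<^sup>+w. ennreal (norm (G 0)) \<partial>(avg q :: (complex,'n) vec measure))"
    using emeasure_avg_UNIV[of q, where 'n='n] by (simp add: avg_def)
  also have "\<dots> \<le> (\<integral>\<^sup>+w. (\<integral>\<^sup>+t. ennreal (norm (G0 (?c t *s w))) * indicator {0..1} t \<partial>lborel) \<partial>avg q)"
  proof (rule nn_integral_mono_AE, rule AE_mp[OF AE_avg], rule AE_I2, rule impI)
    fix w assume w: "w \<in> ?P"
    have op: "open {\<zeta>. \<zeta> *s w \<in> ?P}"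
      using open_line_vimage[OF unit_polyball_open, of 0 w] by simp
    have "ennreal (norm (G (0 *s w))) \<le> (\<integral>\<^sup>+t. ennreal (norm (G (?c t *s w))) * indicator {0..1} t \<partial>lborel)"
      by (rule circle_mean_value_inequality[OF op _ hol[OF w]])
         (use unit_polyball_scale[OF w] in \<open>auto simp: dist_norm\<close>)
    then show "ennreal (norm (G 0)) \<le> (\<integral>\<^sup>+t. ennreal (norm (G0 (?c t *s w))) * indicator {0..1} t \<partial>lborel)"
      using unit_polyball_scale[OF w] nc by (simp add: G0_def)
  qed
  also have "\<dots> = (\<integral>\<^sup>+t. (\<integral>\<^sup>+w. ennreal (norm (G0 (?c t *s w))) * indicator {0..1} t \<partial>avg q) \<partial>lborel)"
  proof (rule Fubini')
    have "(\<lambda>x. G0 ((\<lambda>(t, w). ?c t *s w) x)) \<in> borel_measurable (borel \<Otimes>\<^sub>M borel)" by measurable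
    then have [measurable]: "(\<lambda>(t, w). G0 (?c t *s w)) \<in> borel_measurable (lborel \<Otimes>\<^sub>M avg q)"
      by (simp add: split_beta cong: measurable_cong_sets)
    show "(\<lambda>(t, w). ennreal (norm (G0 (?c t *s w))) * indicator {0..1} t) \<in> borel_measurable (lborel \<Otimes>\<^sub>M avg q)"
      by measurable
  qed
  also have "\<dots> = (\<integral>\<^sup>+t. (\<integral>\<^sup>+w. ennreal (norm (G0 w)) \<partial>avg q) * indicator {0..1} (t::real) \<partial>lborel)"
  proof (rule nn_integral_cong)
    fix t :: real
    have "(\<integral>\<^sup>+w. ennreal (norm (G0 (?c t *s w))) * indicator {0..1} t \<partial>avg q)
       = (\<integral>\<^sup>+w. ennreal (norm (G0 (?c t *s w))) \<partial>avg q) * indicator {0..1} t"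
      by (rule nn_integral_multc) measurable
    also have "(\<integral>\<^sup>+w. ennreal (norm (G0 (?c t *s w))) \<partial>avg q) = (\<integral>\<^sup>+w. ennreal (norm (G0 w)) \<partial>distr (avg q) borel ((*s) (?c t)))"
      by (subst nn_integral_distr) auto
    finally show "(\<integral>\<^sup>+w. ennreal (norm (G0 (?c t *s w))) * indicator {0..1} t \<partial>avg q)
       = (\<integral>\<^sup>+w. ennreal (norm (G0 w)) \<partial>avg q) * indicator {0..1} t"
      by (simp add: avg_rotation nc)
  qed
  also have "\<dots> = (\<integral>\<^sup>+w. ennreal (norm (G0 w)) \<partial>avg q)"
    by (simp add: nn_integral_cmult)
  also have "\<dots> = (\<integral>\<^sup>+w. ennreal (norm (G w)) \<partial>avg q)"
    using AE_avg[of q] by (intro nn_integral_cong_AE) (auto simp: G0_def)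
  finally show ?thesis .
qed

lemma polyball_mean_value_inequality:
  fixes T :: "complex^('n::{finite,linorder}) \<Rightarrow> complex^('n::{finite,linorder})"
  assumes T: "linear T" "\<And>c w. T (c *s w) = c *s T w"
    and F: "holomorphic_vec_on F ((+) a ` T ` unit_polyball q)"
  shows "ennreal (norm (F a)) \<le> (\<integral>\<^sup>+w. ennreal (norm (F (a + T w))) \<partial>avg q)"
proof -
  have "ennreal (norm (F (a + T 0))) \<le> (\<integral>\<^sup>+w. ennreal (norm (F (a + T w))) \<partial>avg q)"
  proof (rule polyball_mean_value_inequality_unit)
    show "continuous_on (unit_polyball q) (\<lambda>w. F (a + T w))"
      using T(1)
      by (intro continuous_on_compose2[OF holomorphic_vec_on_continuous[OF F]] continuous_intros linear_continuous_on)
         (auto simp: linear_conv_bounded_linear)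
    show "(\<lambda>\<zeta>. F (a + T (\<zeta> *s w))) holomorphic_on {\<zeta>. \<zeta> *s w \<in> unit_polyball q}" for w
      unfolding T(2) using holomorphic_vec_on_line[OF F, of a "T w"]
      by (rule holomorphic_on_subset) (auto simp: T(2)[symmetric])
  qed
  then show ?thesis using T(1) by (simp add: linear_0)
qed

section \<open>Hermitian holomorphic vector bundles\<close>

lemma complex_linear_functional_sum:
  fixes f :: "complex^'r \<Rightarrow> complex"
  assumes add: "\<And>x y. f (x + y) = f x + f y" and scale: "\<And>c x. f (c *s x) = c * f x"
  shows "f x = (\<Sum>\<alpha>\<in>UNIV. x $ \<alpha> * f (axis \<alpha> 1))"
proof -
  have f0: "f 0 = 0" using scale[of 0 0] by simp
  have "f (\<Sum>\<alpha>\<in>A. x $ \<alpha> *s axis \<alpha> 1) = (\<Sum>\<alpha>\<in>A. x $ \<alpha> * f (axis \<alpha> 1))" for A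
    by (induction A rule: infinite_finite_induct) (auto simp: f0 add scale)
  from this[of UNIV] show ?thesis
    by (simp add: basis_expansion)
qed

definition hform :: "complex^'r^'r \<Rightarrow> complex^'r \<Rightarrow> complex^'r \<Rightarrow> complex" where
  "hform X x y = (\<Sum>\<alpha>\<in>UNIV. \<Sum>\<beta>\<in>UNIV. x $ \<alpha> * cnj (y $ \<beta>) * X $ \<alpha> $ \<beta>)"

text \<open>The lemmas that follow restate the two definitions as rules for single charts and fibres. Fibre elements
  carry their own addition and scaling, so even the Cauchy-Schwarz inequality has to be proved here.\<close>

locale hermitian_bundle =
  fixes \<Omega> :: "(complex^('n::finite)) set"
    and E :: "('e, 'n, 'r::finite) vbundle"
    and h :: "'e \<Rightarrow> 'e \<Rightarrow> complex"
  assumes vec_bundle: "holomorphic_vector_bundle \<Omega> E"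
    and metric: "smooth_hermitian_metric \<Omega> E h"
begin

lemma chart_cover: "(\<Union>(U, \<phi>)\<in>atlas E. U) = \<Omega>"
  using vec_bundle unfolding holomorphic_vector_bundle_def by (elim conjE)

lemma chart_exists: "a \<in> \<Omega> \<Longrightarrow> \<exists>U \<phi>. (U, \<phi>) \<in> atlas E \<and> a \<in> U"
  using chart_cover by auto

lemma chart_subset: "(U, \<phi>) \<in> atlas E \<Longrightarrow> U \<subseteq> \<Omega>"
  using chart_cover by auto

lemma fibre_ops:
  assumes a: "a \<in> \<Omega>"
  shows "fzero E a \<in> fibre E a"
    and "\<And>v w. v \<in> fibre E a \<Longrightarrow> w \<in> fibre E a \<Longrightarrow> fadd E v w \<in> fibre E a"
    and "\<And>c v. v \<in> fibre E a \<Longrightarrow> fscale E c v \<in> fibre E a"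
proof -
  note b = vec_bundle[unfolded holomorphic_vector_bundle_def]
  show "fzero E a \<in> fibre E a"
    by (rule b[THEN conjunct2, THEN conjunct1, rule_format, OF a])
  show "\<And>v w. v \<in> fibre E a \<Longrightarrow> w \<in> fibre E a \<Longrightarrow> fadd E v w \<in> fibre E a"
    by (rule b[THEN conjunct2, THEN conjunct2, THEN conjunct1, rule_format, OF a])
  show "\<And>c v. v \<in> fibre E a \<Longrightarrow> fscale E c v \<in> fibre E a"
    by (rule b[THEN conjunct2, THEN conjunct2, THEN conjunct2, THEN conjunct1, rule_format, OF a])
qed

lemma chart_props:
  assumes "(U, \<phi>) \<in> atlas E" "a \<in> U"
  shows "bij_betw \<phi> (fibre E a) UNIV" and "\<phi> (fzero E a) = 0"
    and "\<And>v w. v \<in> fibre E a \<Longrightarrow> w \<in> fibre E a \<Longrightarrow> \<phi> (fadd E v w) = \<phi> v + \<phi> w"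
    and "\<And>c v. v \<in> fibre E a \<Longrightarrow> \<phi> (fscale E c v) = c *s \<phi> v"
proof -
  have "\<forall>(U, \<phi>)\<in>atlas E. open U \<and>
        (\<forall>a\<in>U. bij_betw \<phi> (fibre E a) UNIV \<and>
           \<phi> (fzero E a) = 0 \<and>
           (\<forall>v\<in>fibre E a. \<forall>w\<in>fibre E a. \<phi> (fadd E v w) = \<phi> v + \<phi> w) \<and>
           (\<forall>c. \<forall>v\<in>fibre E a. \<phi> (fscale E c v) = c *s \<phi> v))"
    using vec_bundle unfolding holomorphic_vector_bundle_def by (elim conjE)
  from bspec[OF this assms(1)]
  have *: "open U \<and> (\<forall>a\<in>U. bij_betw \<phi> (fibre E a) UNIV \<and>
           \<phi> (fzero E a) = 0 \<and>
           (\<forall>v\<in>fibre E a. \<forall>w\<in>fibre E a. \<phi> (fadd E v w) = \<phi> v + \<phi> w) \<and>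
           (\<forall>c. \<forall>v\<in>fibre E a. \<phi> (fscale E c v) = c *s \<phi> v))" by simp
  note this[THEN conjunct2, rule_format, OF assms(2)]
  then show "bij_betw \<phi> (fibre E a) UNIV" and "\<phi> (fzero E a) = 0"
    and "\<And>v w. v \<in> fibre E a \<Longrightarrow> w \<in> fibre E a \<Longrightarrow> \<phi> (fadd E v w) = \<phi> v + \<phi> w"
    and "\<And>c v. v \<in> fibre E a \<Longrightarrow> \<phi> (fscale E c v) = c *s \<phi> v" by simp_all
qed

lemma chart_open: "(U, \<phi>) \<in> atlas E \<Longrightarrow> open U"
proof -
  assume *: "(U, \<phi>) \<in> atlas E"
  have "\<forall>(U, \<phi>)\<in>atlas E. open U \<and>
        (\<forall>a\<in>U. bij_betw \<phi> (fibre E a) UNIV \<and>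
           \<phi> (fzero E a) = 0 \<and>
           (\<forall>v\<in>fibre E a. \<forall>w\<in>fibre E a. \<phi> (fadd E v w) = \<phi> v + \<phi> w) \<and>
           (\<forall>c. \<forall>v\<in>fibre E a. \<phi> (fscale E c v) = c *s \<phi> v))"
    using vec_bundle unfolding holomorphic_vector_bundle_def by (elim conjE)
  from bspec[OF this *] show "open U" by simp
qed

lemma transition_holomorphic:
  assumes "(U, \<phi>) \<in> atlas E" "(V, \<psi>) \<in> atlas E"
  shows "holomorphic_vec_on (\<lambda>z. \<psi> (triv_inv E \<phi> z w) $ i) (U \<inter> V)"
proof -
  have "\<forall>(U, \<phi>)\<in>atlas E. \<forall>(V, \<psi>)\<in>atlas E. \<forall>w i.
        holomorphic_vec_on (\<lambda>z. \<psi> (triv_inv E \<phi> z w) $ i) (U \<inter> V)"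
    using vec_bundle unfolding holomorphic_vector_bundle_def by (elim conjE)
  from bspec[OF bspec[OF this assms(1), simplified] assms(2)] show ?thesis by simp
qed

lemma triv_inv_fibre [simp]:
  assumes "(U, \<phi>) \<in> atlas E" "a \<in> U"
  shows "triv_inv E \<phi> a w \<in> fibre E a"
  using chart_props(1)[OF assms] unfolding triv_inv_def bij_betw_def
  by (metis UNIV_I order_refl the_inv_into_into)

lemma chart_triv_inv [simp]:
  assumes "(U, \<phi>) \<in> atlas E" "a \<in> U"
  shows "\<phi> (triv_inv E \<phi> a w) = w"
  using chart_props(1)[OF assms] unfolding triv_inv_def bij_betw_def
  by (metis UNIV_I f_the_inv_into_f)

lemma triv_inv_chart [simp]:
  assumes "(U, \<phi>) \<in> atlas E" "a \<in> U" "v \<in> fibre E a"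
  shows "triv_inv E \<phi> a (\<phi> v) = v"
  using chart_props(1)[OF assms(1,2)] assms(3) unfolding triv_inv_def bij_betw_def
  by (metis the_inv_into_f_f)

lemma chart_inj:
  assumes "(U, \<phi>) \<in> atlas E" "a \<in> U" "v \<in> fibre E a" "w \<in> fibre E a" "\<phi> v = \<phi> w"
  shows "v = w"
  using assms triv_inv_chart by metis

lemma triv_inv_add:
  assumes "(U, \<phi>) \<in> atlas E" "a \<in> U"
  shows "triv_inv E \<phi> a (x + y) = fadd E (triv_inv E \<phi> a x) (triv_inv E \<phi> a y)"
proof -
  have "a \<in> \<Omega>" using chart_subset assms by blast
  with assms show ?thesis
    by (intro chart_inj[OF assms]) (simp_all add: chart_props fibre_ops)
qed

lemma triv_inv_scale:
  assumes "(U, \<phi>) \<in> atlas E" "a \<in> U"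
  shows "triv_inv E \<phi> a (c *s x) = fscale E c (triv_inv E \<phi> a x)"
proof -
  have "a \<in> \<Omega>" using chart_subset assms by blast
  with assms show ?thesis
    by (intro chart_inj[OF assms]) (simp_all add: chart_props fibre_ops)
qed

lemma metric_add: "a \<in> \<Omega> \<Longrightarrow> u \<in> fibre E a \<Longrightarrow> v \<in> fibre E a \<Longrightarrow> w \<in> fibre E a \<Longrightarrow>
    h (fadd E u v) w = h u w + h v w"
  by (rule metric[unfolded smooth_hermitian_metric_def, THEN conjunct1, rule_format])

lemma metric_scale: "a \<in> \<Omega> \<Longrightarrow> v \<in> fibre E a \<Longrightarrow> w \<in> fibre E a \<Longrightarrow> h (fscale E c v) w = c * h v w"
  by (rule metric[unfolded smooth_hermitian_metric_def, THEN conjunct2, THEN conjunct1, rule_format])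

lemma metric_sym: "a \<in> \<Omega> \<Longrightarrow> v \<in> fibre E a \<Longrightarrow> w \<in> fibre E a \<Longrightarrow> h w v = cnj (h v w)"
  by (rule metric[unfolded smooth_hermitian_metric_def, THEN conjunct2, THEN conjunct2, THEN conjunct1, rule_format])

lemma metric_pos: "a \<in> \<Omega> \<Longrightarrow> v \<in> fibre E a \<Longrightarrow> v \<noteq> fzero E a \<Longrightarrow> 0 < Re (h v v)"
  by (rule metric[unfolded smooth_hermitian_metric_def, THEN conjunct2, THEN conjunct2, THEN conjunct2,
        THEN conjunct1, rule_format])

lemma gram_smooth: "(U, \<phi>) \<in> atlas E \<Longrightarrow> smooth_on (\<lambda>z. gram E h \<phi> z $ \<alpha> $ \<beta>) U"
  using metric[unfolded smooth_hermitian_metric_def, THEN conjunct2, THEN conjunct2, THEN conjunct2, THEN conjunct2]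
  by (auto dest!: bspec)

lemma metric_add_right: "a \<in> \<Omega> \<Longrightarrow> u \<in> fibre E a \<Longrightarrow> v \<in> fibre E a \<Longrightarrow> w \<in> fibre E a \<Longrightarrow>
    h w (fadd E u v) = h w u + h w v"
  using metric_sym[of a "fadd E u v" w] metric_sym[of a u w] metric_sym[of a v w]
  by (simp add: metric_add fibre_ops)

lemma metric_scale_right: "a \<in> \<Omega> \<Longrightarrow> v \<in> fibre E a \<Longrightarrow> w \<in> fibre E a \<Longrightarrow>
    h w (fscale E c v) = cnj c * h w v"
  using metric_sym[of a "fscale E c v" w] metric_sym[of a v w]
  by (simp add: metric_scale fibre_ops)

lemma metric_real: "a \<in> \<Omega> \<Longrightarrow> v \<in> fibre E a \<Longrightarrow> h v v = of_real (Re (h v v))"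
  using metric_sym[of a v v] by (simp add: complex_eq_iff)

lemma metric_zero:
  assumes "a \<in> \<Omega>" "v \<in> fibre E a" shows "h (fzero E a) v = 0" "h v (fzero E a) = 0"
proof -
  obtain U \<phi> where U: "(U, \<phi>) \<in> atlas E" "a \<in> U" using chart_exists assms by blast
  have "fscale E 0 (fzero E a) = fzero E a"
    by (rule chart_inj[OF U]) (simp_all add: U chart_props[OF U] fibre_ops assms)
  then show "h (fzero E a) v = 0" "h v (fzero E a) = 0"
    using metric_scale[OF assms(1) fibre_ops(1)[OF assms(1)] assms(2), of 0]
      metric_scale_right[OF assms(1) fibre_ops(1)[OF assms(1)] assms(2), of 0] by simp_all
qed

lemma metric_nonneg: "a \<in> \<Omega> \<Longrightarrow> v \<in> fibre E a \<Longrightarrow> 0 \<le> Re (h v v)"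
  using metric_pos metric_zero by (cases "v = fzero E a") (auto simp: less_imp_le)

lemma metric_Cauchy_Schwarz:
  assumes a: "a \<in> \<Omega>" and v: "v \<in> fibre E a" and w: "w \<in> fibre E a"
  shows "(norm (h v w))\<^sup>2 \<le> Re (h v v) * Re (h w w)"
proof (cases "w = fzero E a")
  case True
  then show ?thesis using metric_zero[OF a v] metric_zero[OF a w] by simp
next
  case False
  define W where "W = Re (h w w)"
  have W: "W > 0" "h w w = of_real W" using metric_pos[OF a w False] metric_real[OF a w] by (simp_all add: W_def)
  define c where "c = - h v w / of_real W"
  define x where "x = fadd E v (fscale E c w)"
  have cw: "fscale E c w \<in> fibre E a" using fibre_ops(3)[OF a w] .
  have x: "x \<in> fibre E a" unfolding x_def using fibre_ops(2)[OF a v cw] .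
  have "h x x = h v v + cnj c * h v w + c * (cnj (h v w) + cnj c * of_real W)"
    unfolding x_def using fibre_ops(2)[OF a v cw]
    by (simp add: metric_add[OF a] metric_add_right[OF a] metric_scale[OF a] metric_scale_right[OF a] v w cw W(2)
         metric_sym[OF a v w] algebra_simps)
  also have "\<dots> = h v v - h v w * cnj (h v w) / of_real W"
    using W by (simp add: c_def field_simps)
  also have "h v w * cnj (h v w) = of_real ((norm (h v w))\<^sup>2)"
    by (simp only: complex_norm_square)
  finally have "Re (h x x) = Re (h v v) - (norm (h v w))\<^sup>2 / W" by simp
  then have "(norm (h v w))\<^sup>2 / W \<le> Re (h v v)" using metric_nonneg[OF a x] by simp
  then show ?thesis using W(1) by (simp add: pos_divide_le_eq W_def)
qed

lemma metric_in_frame: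
  assumes U: "(U, \<phi>) \<in> atlas E" "a \<in> U"
  shows "h (triv_inv E \<phi> a x) (triv_inv E \<phi> a y) = hform (gram E h \<phi> a) x y"
proof -
  have a: "a \<in> \<Omega>" using chart_subset U by blast
  have 1: "h (triv_inv E \<phi> a x) w = (\<Sum>\<alpha>\<in>UNIV. x $ \<alpha> * h (triv_inv E \<phi> a (axis \<alpha> 1)) w)" if "w \<in> fibre E a" for w
    by (rule complex_linear_functional_sum)
       (simp_all add: triv_inv_add[OF U] triv_inv_scale[OF U] metric_add[OF a] metric_scale[OF a] triv_inv_fibre[OF U] that)
  have 2: "h w (triv_inv E \<phi> a y) = (\<Sum>\<beta>\<in>UNIV. cnj (y $ \<beta>) * h w (triv_inv E \<phi> a (axis \<beta> 1)))" if w: "w \<in> fibre E a" for w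
  proof -
    have "cnj (h w (triv_inv E \<phi> a y)) = (\<Sum>\<beta>\<in>UNIV. y $ \<beta> * cnj (h w (triv_inv E \<phi> a (axis \<beta> 1))))"
      by (rule complex_linear_functional_sum)
         (simp_all add: triv_inv_add[OF U] triv_inv_scale[OF U] metric_add_right[OF a] metric_scale_right[OF a] triv_inv_fibre[OF U] w)
    from arg_cong[OF this, of cnj] show ?thesis by simp
  qed
  show ?thesis
    unfolding 1[OF triv_inv_fibre[OF U]] hform_def gram_def
    by (subst 2) (simp_all add: triv_inv_fibre[OF U] sum_distrib_left mult.assoc)
qed

lemma gram_component:
  assumes U: "(U, \<phi>) \<in> atlas E" "a \<in> U"
  shows "h (triv_inv E \<phi> a (axis \<beta> 1)) (triv_inv E \<phi> a y) = (\<Sum>\<gamma>\<in>UNIV. cnj (y $ \<gamma>) * gram E h \<phi> a $ \<beta> $ \<gamma>)"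
  unfolding metric_in_frame[OF U] hform_def
  by (subst sum.remove[of _ \<beta>]) (auto simp: axis_def)

lemma gram_hermitian:
  assumes "(U, \<phi>) \<in> atlas E" "a \<in> U"
  shows "gram E h \<phi> a $ \<beta> $ \<alpha> = cnj (gram E h \<phi> a $ \<alpha> $ \<beta>)"
  using assms chart_subset[OF assms(1)] by (auto simp: gram_def intro!: metric_sym)

lemma hform_gram_pos:
  assumes "(U, \<phi>) \<in> atlas E" "a \<in> U" "x \<noteq> 0"
  shows "0 < Re (hform (gram E h \<phi> a) x x)"
proof -
  have a: "a \<in> \<Omega>" using chart_subset assms by blast
  have "triv_inv E \<phi> a x \<noteq> fzero E a"
    using assms chart_triv_inv chart_props(2) by metis
  then have "0 < Re (h (triv_inv E \<phi> a x) (triv_inv E \<phi> a x))"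
    using assms a by (intro metric_pos[of a]) simp_all
  then show ?thesis using assms by (simp add: metric_in_frame)
qed

lemma holomorphic_sectionD:
  assumes "holomorphic_section E S \<sigma>"
  shows "\<And>z. z \<in> S \<Longrightarrow> \<sigma> z \<in> fibre E z"
    and "\<And>U \<phi> i. (U, \<phi>) \<in> atlas E \<Longrightarrow> holomorphic_vec_on (\<lambda>z. \<phi> (\<sigma> z) $ i) (S \<inter> U)"
  using assms unfolding holomorphic_section_def by auto

text \<open>In another chart the coordinates of the section are obtained from \<open>f\<close> by the transition
  matrix, whose entries are holomorphic.\<close>

lemma frame_section_holomorphic:
  assumes U: "(U, \<phi>) \<in> atlas E" and S: "S \<subseteq> U" "open S"
    and f: "\<And>i. holomorphic_vec_on (\<lambda>z. f z $ i) S"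
  shows "holomorphic_section E S (\<lambda>z. triv_inv E \<phi> z (f z))"
  unfolding holomorphic_section_def
proof (intro conjI ballI)
  show "triv_inv E \<phi> z (f z) \<in> fibre E z" if "z \<in> S" for z
    using that U S by auto
next
  have hol: "holomorphic_vec_on (\<lambda>z. \<psi> (triv_inv E \<phi> z (f z)) $ i) (S \<inter> V)"
    if V: "(V, \<psi>) \<in> atlas E" for V \<psi> i
  proof -
  have *: "\<psi> (triv_inv E \<phi> z (f z)) $ i = (\<Sum>\<alpha>\<in>UNIV. f z $ \<alpha> * \<psi> (triv_inv E \<phi> z (axis \<alpha> 1)) $ i)"
    if z: "z \<in> S \<inter> V" for z
  proof (rule complex_linear_functional_sum)
    have zU: "z \<in> U" "z \<in> V" using z S by auto
    show "\<psi> (triv_inv E \<phi> z (x + y)) $ i = \<psi> (triv_inv E \<phi> z x) $ i + \<psi> (triv_inv E \<phi> z y) $ i" for x y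
      using U V zU by (simp add: triv_inv_add chart_props(3))
    show "\<psi> (triv_inv E \<phi> z (c *s x)) $ i = c * \<psi> (triv_inv E \<phi> z x) $ i" for c x
      using U V zU by (simp add: triv_inv_scale chart_props(4))
  qed
  have "holomorphic_vec_on (\<lambda>z. \<Sum>\<alpha>\<in>UNIV. f z $ \<alpha> * \<psi> (triv_inv E \<phi> z (axis \<alpha> 1)) $ i) (S \<inter> V)"
    using S by (intro holomorphic_vec_on_intros holomorphic_vec_on_subset[OF f]
        holomorphic_vec_on_subset[OF transition_holomorphic[OF U V]]) auto
  then show ?thesis
    by (rule holomorphic_vec_on_cong_open) (use S chart_open[OF V] * in auto)
  qed
  show "case x of (V, \<psi>) \<Rightarrow> \<forall>i. holomorphic_vec_on (\<lambda>z. \<psi> (triv_inv E \<phi> z (f z)) $ i) (S \<inter> V)"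
    if "x \<in> atlas E" for x
    using that hol by (cases x) auto
qed

lemma gram_continuous: "(U, \<phi>) \<in> atlas E \<Longrightarrow> continuous_on U (\<lambda>z. gram E h \<phi> z $ \<alpha> $ \<beta>)"
  using gram_smooth unfolding smooth_on_def by (metis Ck_on.simps(1))

lemma metric_section_in_frame:
  assumes "holomorphic_section E S \<sigma>" "holomorphic_section E S \<tau>" "(U, \<phi>) \<in> atlas E" "z \<in> S" "z \<in> U"
  shows "h (\<sigma> z) (\<tau> z) = hform (gram E h \<phi> z) (\<phi> (\<sigma> z)) (\<phi> (\<tau> z))"
  using metric_in_frame[OF assms(3,5), of "\<phi> (\<sigma> z)" "\<phi> (\<tau> z)"] holomorphic_sectionD(1) assms by (metis triv_inv_chart)

lemma section_norm_continuous:
  assumes \<sigma>: "holomorphic_section E S \<sigma>" and S: "open S" "S \<subseteq> \<Omega>"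
  shows "continuous_on S (\<lambda>z. Re (h (\<sigma> z) (\<sigma> z)))"
proof (rule continuous_at_imp_continuous_on, rule ballI)
  fix z assume z: "z \<in> S"
  then obtain U \<phi> where U: "(U, \<phi>) \<in> atlas E" "z \<in> U" using chart_exists S by blast
  have op: "open (S \<inter> U)" using S chart_open[OF U(1)] by auto
  have c: "continuous_on (S \<inter> U) (\<lambda>z. \<phi> (\<sigma> z) $ i)" for i
    using holomorphic_sectionD(2)[OF \<sigma> U(1)] holomorphic_vec_on_continuous by blast
  have "continuous_on (S \<inter> U) (\<lambda>z. Re (hform (gram E h \<phi> z) (\<phi> (\<sigma> z)) (\<phi> (\<sigma> z))))"
    unfolding hform_def
    by (intro continuous_intros c continuous_on_subset[OF gram_continuous[OF U(1)]]) auto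
  then have "continuous_on (S \<inter> U) (\<lambda>z. Re (h (\<sigma> z) (\<sigma> z)))"
    by (rule continuous_on_eq) (use metric_section_in_frame[OF \<sigma> \<sigma> U(1)] in auto)
  then show "isCont (\<lambda>z. Re (h (\<sigma> z) (\<sigma> z))) z"
    using op z U by (simp add: continuous_on_eq_continuous_at)
qed

section \<open>Parallel sections\<close>

text \<open>This is the equation \<open>D\<tau> = 0\<close> for the Chern connection without reference to
  derivatives. For holomorphic \<open>\<tau>\<close> and \<open>e\<^sub>\<beta>\<close>, metric
  compatibility gives \<open>\<partial>bar h(e\<^sub>\<beta>, \<tau>) = h(e\<^sub>\<beta>,
  D\<tau>)\<close>, which vanishes for all \<open>\<beta>\<close> if and only if \<open>D\<tau> =
  0\<close>.\<close>

definition parallel_section :: "(complex^'n) set \<Rightarrow> (complex^'n \<Rightarrow> 'e) \<Rightarrow> bool" where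
  "parallel_section S \<tau> \<longleftrightarrow> holomorphic_section E S \<tau> \<and>
     (\<forall>(U, \<phi>)\<in>atlas E. \<forall>\<beta>. holomorphic_vec_on (\<lambda>z. h (triv_inv E \<phi> z (axis \<beta> 1)) (\<tau> z)) (S \<inter> U))"

lemma parallel_sectionD:
  assumes "parallel_section S \<tau>"
  shows "holomorphic_section E S \<tau>" and "\<And>z. z \<in> S \<Longrightarrow> \<tau> z \<in> fibre E z"
    and "\<And>U \<phi> i. (U, \<phi>) \<in> atlas E \<Longrightarrow> holomorphic_vec_on (\<lambda>z. \<phi> (\<tau> z) $ i) (S \<inter> U)"
    and "\<And>U \<phi> \<beta>. (U, \<phi>) \<in> atlas E \<Longrightarrow>
      holomorphic_vec_on (\<lambda>z. h (triv_inv E \<phi> z (axis \<beta> 1)) (\<tau> z)) (S \<inter> U)"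
  using assms holomorphic_sectionD[of S \<tau>] unfolding parallel_section_def by auto

lemma holomorphic_vec_on_open_cover:
  assumes "\<And>z. z \<in> S \<Longrightarrow> \<exists>V. open V \<and> z \<in> V \<and> holomorphic_vec_on f (S \<inter> V)"
  shows "holomorphic_vec_on f S"
  using assms unfolding holomorphic_vec_on_def by (meson IntI)

lemma frame_expansion:
  assumes U: "(U, \<phi>) \<in> atlas E" "z \<in> U" and v: "v \<in> fibre E z" and w: "w \<in> fibre E z"
  shows "h v w = (\<Sum>\<beta>\<in>UNIV. \<phi> v $ \<beta> * h (triv_inv E \<phi> z (axis \<beta> 1)) w)"
proof -
  have z: "z \<in> \<Omega>" using chart_subset U by blast
  have "h (triv_inv E \<phi> z (\<phi> v)) w = (\<Sum>\<beta>\<in>UNIV. \<phi> v $ \<beta> * h (triv_inv E \<phi> z (axis \<beta> 1)) w)"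
    by (rule complex_linear_functional_sum)
       (simp_all add: triv_inv_add[OF U] triv_inv_scale[OF U] metric_add[OF z] metric_scale[OF z] triv_inv_fibre[OF U] w)
  then show ?thesis using U v by simp
qed

text \<open>In a frame, the pairing is the sum of the products of the holomorphic functions
  \<open>\<phi>(\<sigma>)\<^sub>\<beta>\<close> and \<open>h(e\<^sub>\<beta>, \<tau>)\<close>.\<close>

lemma parallel_pairing_holomorphic:
  assumes \<sigma>: "holomorphic_section E S \<sigma>" and \<tau>: "parallel_section S \<tau>" and S: "open S" "S \<subseteq> \<Omega>"
  shows "holomorphic_vec_on (\<lambda>z. h (\<sigma> z) (\<tau> z)) S"
proof (rule holomorphic_vec_on_open_cover)
  fix z assume "z \<in> S"
  then obtain U \<phi> where U: "(U, \<phi>) \<in> atlas E" "z \<in> U" using chart_exists S by blast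
  have "holomorphic_vec_on (\<lambda>z. \<Sum>\<beta>\<in>UNIV. \<phi> (\<sigma> z) $ \<beta> * h (triv_inv E \<phi> z (axis \<beta> 1)) (\<tau> z)) (S \<inter> U)"
    using \<tau> U(1) unfolding parallel_section_def
    by (intro holomorphic_vec_on_intros holomorphic_sectionD(2)[OF \<sigma>]) auto
  then have "holomorphic_vec_on (\<lambda>z. h (\<sigma> z) (\<tau> z)) (S \<inter> U)"
  proof (rule holomorphic_vec_on_cong_open)
    show "open (S \<inter> U)" using S chart_open[OF U(1)] by auto
    show "(\<Sum>\<beta>\<in>UNIV. \<phi> (\<sigma> z) $ \<beta> * h (triv_inv E \<phi> z (axis \<beta> 1)) (\<tau> z)) = h (\<sigma> z) (\<tau> z)" if "z \<in> S \<inter> U" for z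
      by (rule frame_expansion[symmetric, OF U(1)])
         (use that \<sigma> \<tau> in \<open>auto simp: parallel_section_def holomorphic_section_def\<close>)
  qed
  with U show "\<exists>V. open V \<and> z \<in> V \<and> holomorphic_vec_on (\<lambda>z. h (\<sigma> z) (\<tau> z)) (S \<inter> V)"
    using chart_open by blast
qed

text \<open>The function \<open>h(\<tau>, \<tau>)\<close> is holomorphic, being a pairing with a parallel section,
  and it is real.\<close>

lemma parallel_norm_constant:
  assumes \<tau>: "parallel_section S \<tau>" and S: "open S" "convex S" "S \<subseteq> \<Omega>" and ab: "a \<in> S" "b \<in> S"
  shows "h (\<tau> a) (\<tau> a) = h (\<tau> b) (\<tau> b)"
proof (rule holomorphic_vec_on_real_valued_constant[OF _ S(1,2) _ ab])
  have \<tau>': "holomorphic_section E S \<tau>" using \<tau> by (simp add: parallel_section_def)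
  show "holomorphic_vec_on (\<lambda>z. h (\<tau> z) (\<tau> z)) S"
    by (rule parallel_pairing_holomorphic[OF \<tau>' \<tau> S(1,3)])
  show "Im (h (\<tau> z) (\<tau> z)) = 0" if "z \<in> S" for z
    using metric_real[of z "\<tau> z"] that S holomorphic_sectionD(1)[OF \<tau>'] by (metis Im_complex_of_real subsetD)
qed

lemma parallel_section_subset:
  assumes "parallel_section S \<tau>" "T \<subseteq> S" shows "parallel_section T \<tau>"
proof -
  have sub: "T \<inter> U \<subseteq> S \<inter> U" for U using assms(2) by blast
  show ?thesis
    using assms parallel_sectionD[OF assms(1)] unfolding parallel_section_def holomorphic_section_def
    by (auto intro: holomorphic_vec_on_subset[OF _ sub])
qed

end

section \<open>The extension index as an infimum of averages\<close>

text \<open>The measures on both sides are compared through the uniform measure on the polyball, which is the image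
  of \<open>avg q\<close> under \<open>w \<mapsto> a + polyball_map q r s A w\<close>. The function is
  only assumed continuous on the polyball itself, so it is cut off there before measurability is used.\<close>

lemma nn_integral_polyball:
  fixes A :: "complex^('n::{finite,linorder})^('n::{finite,linorder})"
  assumes rs: "0 < r" "0 < s" and A: "unitary A"
    and g: "continuous_on ((+) a ` polyball q r s A) g"
  shows "(\<integral>\<^sup>+z\<in>(+) a ` polyball q r s A. ennreal (g z) \<partial>lebesgue)
     = emeasure lebesgue (polyball q r s A) * (\<integral>\<^sup>+w. ennreal (g (a + polyball_map q r s A w)) \<partial>avg q)"
    (is "?L = ?m * ?R")
  and emeasure_polyball: "emeasure lebesgue (polyball q r s A) \<noteq> 0" "emeasure lebesgue (polyball q r s A) \<noteq> \<infinity>"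
proof -
  let ?T = "polyball_map q r s A"
  let ?P = "(+) a ` ?T ` unit_polyball q"
  note T = polyball_map_linear[of q r s A] polyball_map_bij[OF rs A, of q]
  have blT: "bounded_linear ?T" using T(1) by (simp add: linear_conv_bounded_linear)
  have P: "(+) a ` polyball q r s A = ?P" by (simp add: polyball_eq_image[OF rs])
  have opP: "open ?P" by (rule open_linear_bij_image[OF T unit_polyball_open])
  have op0: "open (?T ` unit_polyball q)" using open_linear_bij_image[OF T unit_polyball_open, of 0 q] by simp
  have bd0: "bounded (?T ` unit_polyball q)" by (intro bounded_linear_image unit_polyball_bounded blT)
  have ne: "?T ` unit_polyball q \<noteq> {}" using zero_in_unit_polyball by blast
  have m0: "emeasure lebesgue (polyball q r s A) = emeasure lborel (?T ` unit_polyball q)"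
    using op0 by (simp add: polyball_eq_image[OF rs] borel_open)
  show m: "emeasure lebesgue (polyball q r s A) \<noteq> 0" "emeasure lebesgue (polyball q r s A) \<noteq> \<infinity>"
    unfolding m0 by (rule emeasure_open_bounded[OF op0 bd0 ne])+
  have mP: "emeasure lborel ?P = ?m"
    unfolding m0 by (rule emeasure_lborel_translation) (simp add: opP borel_open)
  define g0 where "g0 z = (if z \<in> ?P then g z else 0)" for z
  have [measurable]: "g0 \<in> borel_measurable borel"
    unfolding g0_def using g P by (intro borel_measurable_continuous_on_if) (auto simp: borel_open opP)
  have [measurable]: "?P \<in> sets borel" using opP by (rule borel_open)
  have [measurable]: "?T \<in> borel \<rightarrow>\<^sub>M borel"
    using blT by (intro borel_measurable_continuous_onI linear_continuous_on)
  have "?L = (\<integral>\<^sup>+z. ennreal (g0 z) * indicator ?P z \<partial>lborel)"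
    unfolding P nn_integral_completion by (intro nn_integral_cong) (auto simp: g0_def indicator_def)
  also have "\<dots> = ?m * (\<integral>\<^sup>+z. ennreal (g0 z) \<partial>uniform_measure lborel ?P)"
  proof -
    have "x = ?m * (x / ?m)" for x
      using mult_divide_eq_ennreal[of ?m x] m by (simp add: ennreal_times_divide mult.commute[of ?m])
    then show ?thesis by (subst nn_integral_uniform_measure) (simp_all add: mP)
  qed
  also have "(\<integral>\<^sup>+z. ennreal (g0 z) \<partial>uniform_measure lborel ?P) = (\<integral>\<^sup>+w. ennreal (g0 (a + ?T w)) \<partial>avg q)"
    unfolding avg_affine[OF T] by (subst nn_integral_distr) auto
  also have "\<dots> = ?R"
    using AE_avg[of q] by (intro nn_integral_cong_AE) (auto simp: g0_def)
  finally show "?L = ?m * ?R" .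
qed

lemma translated_polyball:
  fixes A :: "complex^('n::{finite,linorder})^('n::{finite,linorder})"
  assumes rs: "0 < r" "0 < s" and A: "unitary A"
  shows "open ((+) a ` polyball q r s A)" "convex ((+) a ` polyball q r s A)" "a \<in> (+) a ` polyball q r s A"
proof -
  note T = polyball_map_linear[of q r s A] polyball_map_bij[OF rs A, of q]
  have P: "(+) a ` polyball q r s A = (+) a ` polyball_map q r s A ` unit_polyball q" by (simp add: polyball_eq_image[OF rs])
  show "open ((+) a ` polyball q r s A)"
    unfolding P by (rule open_linear_bij_image[OF T unit_polyball_open])
  show "convex ((+) a ` polyball q r s A)"
    unfolding P by (intro convex_translation convex_linear_image T(1) unit_polyball_convex)
  have "0 \<in> polyball_map q r s A ` unit_polyball q"
    using linear_0[OF T(1)] zero_in_unit_polyball by (metis imageI)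
  then show "a \<in> (+) a ` polyball q r s A" unfolding P by (auto simp: image_iff intro!: bexI[of _ 0])
qed

text \<open>Polyballs are defined relative to a linear order on the coordinates.\<close>

locale hermitian_bundle_ordered = hermitian_bundle \<Omega> E h
  for \<Omega> :: "(complex^('n::{finite,linorder})) set"
    and E :: "('e, 'n, 'r::finite) vbundle"
    and h :: "'e \<Rightarrow> 'e \<Rightarrow> complex"
begin

lemma sq_integral_polyball:
  assumes rs: "0 < r" "0 < s" and A: "unitary A" and P: "(+) a ` polyball q r s A \<subseteq> \<Omega>"
    and \<sigma>: "holomorphic_section E ((+) a ` polyball q r s A) \<sigma>"
  shows "sq_integral h ((+) a ` polyball q r s A) \<sigma> = emeasure lebesgue (polyball q r s A) *
     (\<integral>\<^sup>+w. ennreal (Re (h (\<sigma> (a + polyball_map q r s A w)) (\<sigma> (a + polyball_map q r s A w)))) \<partial>avg q)"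
  unfolding sq_integral_def
  by (rule nn_integral_polyball[OF rs A section_norm_continuous[OF \<sigma> translated_polyball(1)[OF rs A] P]])

lemma sq_integral_ratio:
  assumes rs: "0 < r" "0 < s" and A: "unitary A" and P: "(+) a ` polyball q r s A \<subseteq> \<Omega>"
    and \<sigma>: "holomorphic_section E ((+) a ` polyball q r s A) \<sigma>" and c: "0 < c"
  shows "sq_integral h ((+) a ` polyball q r s A) \<sigma> / (emeasure lebesgue (polyball q r s A) * ennreal c) =
     (\<integral>\<^sup>+w. ennreal (Re (h (\<sigma> (a + polyball_map q r s A w)) (\<sigma> (a + polyball_map q r s A w)))) \<partial>avg q) / ennreal c"
proof -
  have "m * x / (m * ennreal c) = x / ennreal c" if m: "m \<noteq> 0" "m \<noteq> \<infinity>" for m x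
    using divide_mult_eq[OF m, of x "ennreal c"] by (simp add: mult.commute)
  then show ?thesis
    using emeasure_polyball[OF rs A continuous_on_const, of q] sq_integral_polyball[OF rs A P \<sigma>] by simp
qed

text \<open>The section \<open>\<tau>\<close> has constant norm and gives the upper bound. For the lower bound, the
  mean value inequality is applied to the square of \<open>h(\<sigma>, \<tau>)\<close>, so that the
  pointwise Cauchy-Schwarz inequality suffices and none for integrals is required.\<close>

theorem extension_index_eq_1_of_parallel:
  assumes rs: "0 < r" "0 < s" and A: "unitary A" and P: "(+) a ` polyball q r s A \<subseteq> \<Omega>"
    and \<tau>: "parallel_section ((+) a ` polyball q r s A) \<tau>" and \<xi>: "\<tau> a = \<xi>" "\<xi> \<noteq> fzero E a"
  shows "extension_index E h q a r s A \<xi> = 1"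
proof -
  let ?P = "(+) a ` polyball q r s A"
  let ?T = "polyball_map q r s A"
  note Pp = translated_polyball[OF rs A, of a q]
  have \<tau>': "holomorphic_section E ?P \<tau>" using \<tau> by (simp add: parallel_section_def)
  have a: "a \<in> \<Omega>" using P Pp by auto
  have \<xi>f: "\<xi> \<in> fibre E a" using holomorphic_sectionD(1)[OF \<tau>' Pp(3)] \<xi> by simp
  define H0 where "H0 = Re (h \<xi> \<xi>)"
  have H0: "H0 > 0" "h \<xi> \<xi> = of_real H0" using metric_pos[OF a \<xi>f \<xi>(2)] metric_real[OF a \<xi>f] by (simp_all add: H0_def)
  have inP: "a + ?T w \<in> ?P" if "w \<in> unit_polyball q" for w
    using that by (auto simp: polyball_eq_image[OF rs])
  have const: "Re (h (\<tau> z) (\<tau> z)) = H0" if "z \<in> ?P" for z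
    using parallel_norm_constant[OF \<tau> Pp(1,2) P that Pp(3)] \<xi> by (simp add: H0_def)
  have int\<tau>: "(\<integral>\<^sup>+w. ennreal (Re (h (\<tau> (a + ?T w)) (\<tau> (a + ?T w)))) \<partial>avg q) = ennreal H0"
  proof -
    have "(\<integral>\<^sup>+w. ennreal (Re (h (\<tau> (a + ?T w)) (\<tau> (a + ?T w)))) \<partial>avg q) = (\<integral>\<^sup>+w. ennreal H0 \<partial>(avg q :: (complex,'n) vec measure))"
      using AE_avg[of q] by (intro nn_integral_cong_AE) (auto simp: const inP)
    then show ?thesis using emeasure_avg_UNIV[of q, where 'n='n] by (simp add: avg_def)
  qed
  show ?thesis
  proof (rule antisym)
    have "sq_integral h ?P \<tau> < \<infinity>"
      using emeasure_polyball[OF rs A continuous_on_const, of q]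
      by (simp add: sq_integral_polyball[OF rs A P \<tau>'] int\<tau> ennreal_mult_less_top top.not_eq_extremum)
    then have "\<tau> \<in> A2 E h ?P" using \<tau>' by (simp add: A2_def)
    then have "extension_index E h q a r s A \<xi> \<le> sq_integral h ?P \<tau> / (emeasure lebesgue (polyball q r s A) * ennreal (Re (h \<xi> \<xi>)))"
      unfolding extension_index_def using \<xi> by (intro Inf_lower) blast
    also have "\<dots> = 1"
      using sq_integral_ratio[OF rs A P \<tau>' H0(1)] H0(1) by (simp add: H0_def[symmetric] int\<tau> ennreal_divide_self)
    finally show "extension_index E h q a r s A \<xi> \<le> 1" .
  next
    show "1 \<le> extension_index E h q a r s A \<xi>"
      unfolding extension_index_def
    proof (rule Inf_greatest)
      fix x assume "x \<in> {sq_integral h ?P \<sigma> / (emeasure lebesgue (polyball q r s A) * ennreal (Re (h \<xi> \<xi>))) |\<sigma>.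
             \<sigma> \<in> A2 E h ?P \<and> \<sigma> a = \<xi>}"
      then obtain \<sigma> where \<sigma>: "holomorphic_section E ?P \<sigma>" "\<sigma> a = \<xi>"
        and x: "x = sq_integral h ?P \<sigma> / (emeasure lebesgue (polyball q r s A) * ennreal H0)"
        by (auto simp: A2_def H0_def)
      let ?I = "\<integral>\<^sup>+w. ennreal (Re (h (\<sigma> (a + ?T w)) (\<sigma> (a + ?T w)))) \<partial>avg q"
      \<comment> \<open>cut off outside the polyball, where the section carries no information\<close>
      let ?N = "\<lambda>z. if z \<in> ?P then Re (h (\<sigma> z) (\<sigma> z)) else 0"
      have x: "x = ?I / ennreal H0" unfolding x by (rule sq_integral_ratio[OF rs A P \<sigma>(1) H0(1)])
      have F: "holomorphic_vec_on (\<lambda>z. h (\<sigma> z) (\<tau> z) * h (\<sigma> z) (\<tau> z)) ?P"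
        by (intro holomorphic_vec_on_intros parallel_pairing_holomorphic[OF \<sigma>(1) \<tau> Pp(1) P])
      have [measurable]: "?N \<in> borel_measurable borel"
        using section_norm_continuous[OF \<sigma>(1) Pp(1) P] Pp(1) by (intro borel_measurable_continuous_on_if) (auto simp: borel_open)
      have [measurable]: "?T \<in> borel \<rightarrow>\<^sub>M borel"
        using polyball_map_linear by (intro borel_measurable_continuous_onI linear_continuous_on) (simp add: linear_conv_bounded_linear)
      have "ennreal (H0 * H0) = ennreal (norm (h (\<sigma> a) (\<tau> a) * h (\<sigma> a) (\<tau> a)))"
        using \<sigma> \<xi> H0 by (simp add: norm_mult)
      also have "\<dots> \<le> (\<integral>\<^sup>+w. ennreal (norm (h (\<sigma> (a + ?T w)) (\<tau> (a + ?T w)) * h (\<sigma> (a + ?T w)) (\<tau> (a + ?T w)))) \<partial>avg q)"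
        by (rule polyball_mean_value_inequality[OF polyball_map_linear polyball_map_scale])
           (use F in \<open>simp add: polyball_eq_image[OF rs]\<close>)
      also have "\<dots> \<le> (\<integral>\<^sup>+w. ennreal H0 * ennreal (?N (a + ?T w)) \<partial>avg q)"
      proof (rule nn_integral_mono_AE, rule AE_mp[OF AE_avg], rule AE_I2, rule impI)
        fix w :: "(complex,'n) vec" assume "w \<in> unit_polyball q"
        then have z: "a + ?T w \<in> ?P" by (rule inP)
        let ?z = "a + ?T w"
        have zO: "?z \<in> \<Omega>" using z P by blast
        have "(norm (h (\<sigma> ?z) (\<tau> ?z)))\<^sup>2 \<le> Re (h (\<sigma> ?z) (\<sigma> ?z)) * H0"
          using metric_Cauchy_Schwarz[OF zO holomorphic_sectionD(1)[OF \<sigma>(1) z] holomorphic_sectionD(1)[OF \<tau>' z]] const[OF z] by simp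
        then show "ennreal (norm (h (\<sigma> ?z) (\<tau> ?z) * h (\<sigma> ?z) (\<tau> ?z))) \<le> ennreal H0 * ennreal (?N ?z)"
          using z H0 by (simp add: norm_mult power2_eq_square ennreal_mult'[symmetric] ennreal_leI mult.commute)
      qed
      also have "\<dots> = ennreal H0 * (\<integral>\<^sup>+w. ennreal (?N (a + ?T w)) \<partial>avg q)"
        by (rule nn_integral_cmult) measurable
      also have "(\<integral>\<^sup>+w. ennreal (?N (a + ?T w)) \<partial>avg q) = ?I"
        using AE_avg[of q] by (intro nn_integral_cong_AE) (auto simp: inP)
      finally have "ennreal H0 * ennreal H0 \<le> ennreal H0 * ?I" using H0 by (simp add: ennreal_mult)
      then have "ennreal H0 \<le> ?I"
        using H0(1) by (simp add: ennreal_mult_le_mult_iff)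
      then show "1 \<le> x"
        unfolding x using H0(1) divide_right_mono_ennreal[of "ennreal H0" ?I "ennreal H0"] by (simp add: ennreal_divide_self)
    qed
  qed
qed

end

section \<open>Parameter integrals and limits of holomorphic functions\<close>

text \<open>Morera's theorem: the contour integral over a triangle may be exchanged with the integral over the
  parameter.\<close>

lemma holomorphic_on_param_integral:
  fixes G :: "real \<Rightarrow> complex \<Rightarrow> complex"
  assumes V: "open V" and cont: "continuous_on ({0..1} \<times> V) (\<lambda>(t, \<zeta>). G t \<zeta>)"
    and hol: "\<And>t. t \<in> {0..1} \<Longrightarrow> G t holomorphic_on V"
  shows "(\<lambda>\<zeta>. integral {0..1} (\<lambda>t. G t \<zeta>)) holomorphic_on V"
proof -
  let ?I = "\<lambda>\<zeta>. integral {0..1} (\<lambda>t. G t \<zeta>)"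
  have cI: "continuous_on V ?I"
  proof -
    have "continuous_on (V \<times> cbox 0 1) (\<lambda>(\<zeta>, t). G t \<zeta>)"
      unfolding split_beta
      by (rule continuous_on_compose2[OF cont, of _ "\<lambda>x. (snd x, fst x)", simplified split_beta fst_conv snd_conv])
         (auto intro!: continuous_intros)
    from integral_continuous_on_param[OF this] show ?thesis by simp
  qed
  define J where "J a b t = contour_integral (linepath a b) (G t)" for a b t
  have lin: "closed_segment a b \<subseteq> V \<Longrightarrow> continuous_on {0..1} (J a b)
      \<and> contour_integral (linepath a b) ?I = integral {0..1} (J a b)" for a b
  proof (intro conjI)
    assume ab: "closed_segment a b \<subseteq> V"
    have lp: "linepath a b t \<in> V" if "t \<in> {0..1}" for t
      using ab that linepath_in_path[of t a b] by auto
    have "continuous_on ({0..1} \<times> cbox 0 (1::real)) (\<lambda>(t, x). G t (linepath a b x) * (b - a))"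
      unfolding split_beta
      by (intro continuous_intros continuous_on_compose2[OF cont, of _ "\<lambda>x. (fst x, linepath a b (snd x))", simplified split_beta fst_conv snd_conv])
         (use lp in \<open>auto intro!: continuous_intros simp: linepath_def\<close>)
    from integral_continuous_on_param[OF this]
    show "continuous_on {0..1} (J a b)"
      by (simp add: J_def[abs_def] contour_integral_integral)
    have "contour_integral (linepath a b) (\<lambda>\<zeta>. contour_integral (linepath 0 1) (\<lambda>w. G (Re w) \<zeta>))
        = contour_integral (linepath 0 1) (\<lambda>w. contour_integral (linepath a b) (\<lambda>\<zeta>. G (Re w) \<zeta>))"
    proof (rule contour_integral_swap)
      have Re01: "Re w \<in> {0..1}" if "w \<in> closed_segment 0 1" for w
        using that by (auto simp: in_segment)
      show "continuous_on (path_image (linepath a b) \<times> path_image (linepath 0 1)) (\<lambda>(\<zeta>, w). G (Re w) \<zeta>)"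
        unfolding split_beta
        by (rule continuous_on_compose2[OF cont, of _ "\<lambda>x. (Re (snd x), fst x)", simplified split_beta fst_conv snd_conv])
           (use ab Re01 in \<open>auto intro!: continuous_intros\<close>)
    qed auto
    moreover have "contour_integral (linepath 0 1) (\<lambda>w. K (Re w)) = integral {0..1} K" for K :: "real \<Rightarrow> complex"
      by (simp add: contour_integral_integral linepath_def)
    from this[of "\<lambda>t. G t _"] this[of "\<lambda>t. contour_integral (linepath a b) (G t)"]
    have "contour_integral (linepath 0 1) (\<lambda>w. G (Re w) \<zeta>) = integral {0..1} (\<lambda>t. G t \<zeta>)"
      "contour_integral (linepath 0 1) (\<lambda>w. contour_integral (linepath a b) (G (Re w)))
        = integral {0..1} (\<lambda>t. contour_integral (linepath a b) (G t))" for \<zeta> by blast+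
    ultimately show "contour_integral (linepath a b) ?I = integral {0..1} (J a b)"
      unfolding J_def[abs_def] by simp
  qed
  have "?I analytic_on V"
  proof (rule Morera_triangle[OF cI V], intro impI)
    fix a b c assume sub: "convex hull {a, b, c} \<subseteq> V"
    have seg: "closed_segment a b \<subseteq> V" "closed_segment b c \<subseteq> V" "closed_segment c a \<subseteq> V"
      by (rule order_trans[OF _ sub], rule hull_minimal[of "{_, _}" _ convex, folded segment_convex_hull], simp add: hull_inc, simp)+
    note l = lin[OF seg(1)] lin[OF seg(2)] lin[OF seg(3)]
    have "J a b t + J b c t + J c a t = 0" if "t \<in> {0..1}" for t
    proof -
      have h: "G t holomorphic_on convex hull {a,b,c}" using hol[OF that] sub holomorphic_on_subset by blast
      have "(G t has_contour_integral 0) (linepath a b +++ linepath b c +++ linepath c a)"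
        by (rule Cauchy_theorem_triangle[OF h])
      moreover have "G t contour_integrable_on linepath x y" if "closed_segment x y \<subseteq> V" for x y
        using hol[OF \<open>t \<in> {0..1}\<close>] that
        by (meson contour_integrable_continuous_linepath continuous_on_subset holomorphic_on_imp_continuous_on)
      ultimately show ?thesis
        using seg by (auto simp: J_def add.assoc dest!: contour_integral_unique)
    qed
    then have "integral {0..1} (\<lambda>t. J a b t + J b c t + J c a t) = 0"
      by (intro integral_unique has_integral_is_0) auto
    moreover have "integral {0..1} (\<lambda>t. J a b t + J b c t + J c a t)
       = integral {0..1} (J a b) + integral {0..1} (J b c) + integral {0..1} (J c a)"
      using l by (simp add: integral_add integrable_continuous_interval continuous_on_add)
    ultimately show "contour_integral (linepath a b) ?I + contour_integral (linepath b c) ?I + contour_integral (linepath c a) ?I = 0"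
      using l by simp
  qed
  then show ?thesis by (rule analytic_imp_holomorphic)
qed

lemma holomorphic_vec_on_param_integral:
  fixes F :: "real \<Rightarrow> complex^'n \<Rightarrow> complex"
  assumes S: "open S" and cont: "continuous_on ({0..1} \<times> S) (\<lambda>(t, z). F t z)"
    and hol: "\<And>t. t \<in> {0..1} \<Longrightarrow> holomorphic_vec_on (F t) S"
  shows "holomorphic_vec_on (\<lambda>z. integral {0..1} (\<lambda>t. F t z)) S"
proof (rule holomorphic_vec_on_lines[OF S])
  have "continuous_on (S \<times> cbox 0 1) (\<lambda>(\<zeta>, t). F t \<zeta>)"
    unfolding split_beta
    by (rule continuous_on_compose2[OF cont, of _ "\<lambda>x. (snd x, fst x)", simplified split_beta fst_conv snd_conv])
       (auto intro!: continuous_intros)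
  from integral_continuous_on_param[OF this] show "continuous_on S (\<lambda>z. integral {0..1} (\<lambda>t. F t z))" by simp
  fix a w
  show "(\<lambda>\<zeta>. integral {0..1} (\<lambda>t. F t (a + \<zeta> *s w))) holomorphic_on {\<zeta>. a + \<zeta> *s w \<in> S}"
  proof (rule holomorphic_on_param_integral[OF open_line_vimage[OF S]])
    show "continuous_on ({0..1} \<times> {\<zeta>. a + \<zeta> *s w \<in> S}) (\<lambda>(t, \<zeta>). F t (a + \<zeta> *s w))"
      unfolding split_beta
      by (rule continuous_on_compose2[OF cont, of _ "\<lambda>x. (fst x, a + snd x *s w)", simplified split_beta fst_conv snd_conv])
         (auto intro!: continuous_intros)
  qed (rule holomorphic_vec_on_line[OF hol])
qed

lemma holomorphic_vec_on_uniform_sequence: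
  fixes f :: "nat \<Rightarrow> complex^'n \<Rightarrow> complex"
  assumes S: "open S" and hol: "\<And>n. holomorphic_vec_on (f n) S"
    and lim: "\<And>x. x \<in> S \<Longrightarrow> \<exists>d>0. cball x d \<subseteq> S \<and> uniform_limit (cball x d) f g sequentially"
  shows "holomorphic_vec_on g S"
proof (rule holomorphic_vec_on_lines[OF S])
  show "continuous_on S g"
  proof (rule continuous_at_imp_continuous_on, rule ballI)
    fix x assume "x \<in> S"
    from lim[OF this] obtain d where d: "d > 0" "cball x d \<subseteq> S" "uniform_limit (cball x d) f g sequentially" by blast
    have "continuous_on (cball x d) g"
      by (rule uniform_limit_theorem[OF _ d(3)])
         (auto intro!: always_eventually continuous_on_subset[OF holomorphic_vec_on_continuous[OF hol] d(2)])
    then show "isCont g x"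
      using d(1) by (intro continuous_on_interior) auto
  qed
  fix a w
  let ?V = "{\<zeta>. a + \<zeta> *s w \<in> S}"
  show "(\<lambda>\<zeta>. g (a + \<zeta> *s w)) holomorphic_on ?V"
  proof (rule holomorphic_uniform_sequence[OF open_line_vimage[OF S], of "\<lambda>n \<zeta>. f n (a + \<zeta> *s w)"])
    show "(\<lambda>\<zeta>. f n (a + \<zeta> *s w)) holomorphic_on ?V" for n by (rule holomorphic_vec_on_line[OF hol])
    fix \<zeta> assume "\<zeta> \<in> ?V"
    then obtain d where d: "d > 0" "cball (a + \<zeta> *s w) d \<subseteq> S" "uniform_limit (cball (a + \<zeta> *s w) d) f g sequentially"
      using lim by blast
    define e where "e = d / (norm w + 1)"
    have e: "e > 0" using d(1) by (auto simp: e_def intro!: divide_pos_pos add_nonneg_pos)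
    have "a + \<eta> *s w \<in> cball (a + \<zeta> *s w) d" if "\<eta> \<in> cball \<zeta> e" for \<eta>
    proof -
      have "a + \<zeta> *s w - (a + \<eta> *s w) = (\<zeta> - \<eta>) *s w" by (simp add: vec_eq_iff algebra_simps)
      then have "dist (a + \<zeta> *s w) (a + \<eta> *s w) = norm (\<zeta> - \<eta>) * norm w"
        by (metis dist_norm norm_vector_scalar_mult)
      also have "\<dots> \<le> e * (norm w + 1)" using that e by (intro mult_mono) (auto simp: dist_norm)
      also have "\<dots> = d" using add_nonneg_pos[of "norm w" 1] by (simp add: e_def)
      finally show ?thesis by simp
    qed
    note inb = this
    have "uniform_limit (cball \<zeta> e) (\<lambda>n \<zeta>. f n (a + \<zeta> *s w)) (\<lambda>\<zeta>. g (a + \<zeta> *s w)) sequentially"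
      unfolding uniform_limit_iff
    proof (intro allI impI)
      fix \<epsilon> :: real assume "\<epsilon> > 0"
      with d(3) have "\<forall>\<^sub>F n in sequentially. \<forall>x\<in>cball (a + \<zeta> *s w) d. dist (f n x) (g x) < \<epsilon>"
        unfolding uniform_limit_iff by blast
      then show "\<forall>\<^sub>F n in sequentially. \<forall>x\<in>cball \<zeta> e. dist (f n (a + x *s w)) (g (a + x *s w)) < \<epsilon>"
        by eventually_elim (use inb in blast)
    qed
    with e d(2) inb show "\<exists>d>0. cball \<zeta> d \<subseteq> ?V \<and> uniform_limit (cball \<zeta> d) (\<lambda>n \<zeta>. f n (a + \<zeta> *s w)) (\<lambda>\<zeta>. g (a + \<zeta> *s w)) sequentially"
      by (intro exI[of _ e]) blast
  qed
qed

lemma holomorphic_vec_on_radial: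
  assumes f: "holomorphic_vec_on f (ball p R)" and t: "t \<in> {0..1}"
  shows "holomorphic_vec_on (\<lambda>z. f (p + t *\<^sub>R (z - p))) (ball p R)"
  unfolding holomorphic_vec_on_def
proof
  fix z assume "z \<in> ball p R"
  then have "p + t *\<^sub>R (z - p) \<in> ball p R"
    using t mult_left_le_one_le[of "norm (z - p)" t] by (auto simp: dist_norm norm_minus_commute)
  then obtain f' where f': "(f has_derivative f') (at (p + t *\<^sub>R (z - p)))" "\<forall>c v. f' (c *s v) = c * f' v"
    using f unfolding holomorphic_vec_on_def by blast
  have "((\<lambda>z. p + t *\<^sub>R (z - p)) has_derivative (\<lambda>v. t *\<^sub>R v)) (at z)"
    by (auto intro!: derivative_eq_intros)
  from has_derivative_compose[OF this f'(1)] f'(2)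
  show "\<exists>f'. ((\<lambda>z. f (p + t *\<^sub>R (z - p))) has_derivative f') (at z) \<and> (\<forall>c v. f' (c *s v) = c * f' v)"
    by (intro exI[of _ "\<lambda>v. f' (t *\<^sub>R v)"]) (auto simp: scaleR_eq_vector_scalar_mult vector_smult_assoc mult.left_commute)
qed

section \<open>Radial linear differential equations\<close>

text \<open>The value on the tangent vector \<open>w\<close> at \<open>z\<close> of the matrix of one-forms
  \<open>\<Sum>j. \<theta>\<^sub>j dz\<^sub>j\<close>.\<close>

definition radial_coeff :: "('n \<Rightarrow> 'r \<Rightarrow> 'r \<Rightarrow> complex^'n \<Rightarrow> complex) \<Rightarrow> complex^'n \<Rightarrow> complex^'n \<Rightarrow> complex^'r^'r" where
  "radial_coeff \<theta> z w = (\<chi> \<alpha> \<beta>. \<Sum>j\<in>UNIV. w $ j * \<theta> j \<alpha> \<beta> z)"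

text \<open>Substituting \<open>s t\<close> for the variable turns \<open>\<phi> s\<close> into \<open>c +
  \<integral>\<^sub>0\<^sup>s g\<close>. The scaled form keeps the interval of integration fixed, which is
  how the integrals arise from radial paths.\<close>

lemma integral_scaled_has_vector_derivative:
  fixes g :: "real \<Rightarrow> complex"
  assumes g: "continuous_on {0..1} g" and s: "s \<in> {0..1}"
    and \<phi>: "\<And>s. s \<in> {0..1} \<Longrightarrow> \<phi> s = c + integral {0..1} (\<lambda>t. s *\<^sub>R g (s * t))"
  shows "(\<phi> has_vector_derivative g s) (at s within {0..1})"
proof -
  have eq: "\<phi> s = c + integral {0..s} g" if s: "s \<in> {0..1}" for s
  proof (cases "s = 0")
    case True
    then show ?thesis using \<phi>[of 0] by simp
  next
    case False
    have "(g has_integral integral {0..s} g) {0..s}"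
      using s by (intro integrable_integral integrable_continuous_interval continuous_on_subset[OF g]) auto
    from has_integral_stretch_real[OF this False]
    have "((\<lambda>t. g (s * t)) has_integral (1 / s) *\<^sub>R integral {0..s} g) {0..1}"
      using s False by (simp add: image_divide_atLeastAtMost)
    from has_integral_cmul[OF this, of s] False
    have "((\<lambda>t. s *\<^sub>R g (s * t)) has_integral integral {0..s} g) {0..1}" by simp
    then show ?thesis using \<phi>[OF s] integral_unique by metis
  qed
  have "((\<lambda>s. c + integral {0..s} g) has_vector_derivative g s) (at s within {0..1})"
    using integral_has_vector_derivative[OF g s] by (auto intro!: derivative_eq_intros)
  then show ?thesis
    by (rule has_vector_derivative_transform[OF s, rotated]) (use eq in auto)
qed

text \<open>Picard iteration for \<open>k(z) = c + \<integral>\<^sub>0\<^sup>1 \<theta>(p + t(z - p))(z - p) k(p +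
  t(z - p)) dt\<close>. Each iterate is holomorphic in \<open>z\<close>, as an integral over a fixed
  interval with a holomorphic integrand, and the series of iterates converges locally uniformly; so the
  solutions along all rays fit together to a holomorphic function.\<close>

theorem radial_ode_holomorphic_solution:
  fixes \<theta> :: "'n::finite \<Rightarrow> 'r::finite \<Rightarrow> 'r \<Rightarrow> complex^'n \<Rightarrow> complex" and c :: "complex^'r"
  assumes hol: "\<And>j \<alpha> \<beta>. holomorphic_vec_on (\<theta> j \<alpha> \<beta>) (ball p R)" and R: "R > 0"
  obtains k where "\<And>\<alpha>. holomorphic_vec_on (\<lambda>z. k z $ \<alpha>) (ball p R)" "k p = c"
    "\<And>v s \<alpha>. norm v < R \<Longrightarrow> s \<in> {0..1} \<Longrightarrow>
      ((\<lambda>s. k (p + s *\<^sub>R v) $ \<alpha>) has_vector_derivative (radial_coeff \<theta> (p + s *\<^sub>R v) v *v k (p + s *\<^sub>R v)) $ \<alpha>) (at s within {0..1})"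
proof -
  let ?B = "ball p R"
  define \<rho> where "\<rho> t z = p + t *\<^sub>R (z - p)" for t :: real and z
  have \<rho>B: "\<rho> t z \<in> ?B" if "t \<in> {0..1}" "z \<in> ?B" for t z
    using that mult_left_le_one_le[of "norm (z - p)" t] by (auto simp: \<rho>_def dist_norm norm_minus_commute)
  define F where "F u \<alpha> t z = (radial_coeff \<theta> (\<rho> t z) (z - p) *v u (\<rho> t z)) $ \<alpha>" for u \<alpha> t z
  define T where "T u z = (\<chi> \<alpha>. integral {0..1} (\<lambda>t. F u \<alpha> t z))" for u z
  define hv where "hv u \<longleftrightarrow> (\<forall>\<alpha>. holomorphic_vec_on (\<lambda>z. u z $ \<alpha>) ?B)" for u :: "complex^'n \<Rightarrow> complex^'r"
  have F_eq: "F u \<alpha> t z = (\<Sum>\<beta>\<in>UNIV. (\<Sum>j\<in>UNIV. (z $ j - p $ j) * \<theta> j \<alpha> \<beta> (\<rho> t z)) * u (\<rho> t z) $ \<beta>)" for u \<alpha> t z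
    by (simp add: F_def radial_coeff_def matrix_vector_mult_def)
  have Fhol: "holomorphic_vec_on (F u \<alpha> t) ?B" if "hv u" "t \<in> {0..1}" for u \<alpha> t
  proof -
    have "holomorphic_vec_on (\<lambda>z. f (\<rho> t z)) ?B" if "holomorphic_vec_on f ?B" for f
      unfolding \<rho>_def by (rule holomorphic_vec_on_radial[OF that \<open>t \<in> {0..1}\<close>])
    then show ?thesis
      unfolding F_eq[abs_def] using that hol by (intro holomorphic_vec_on_intros) (auto simp: hv_def)
  qed
  have Fcont: "continuous_on ({0..1} \<times> ?B) (\<lambda>(t, z). F u \<alpha> t z)" if "hv u" for u \<alpha>
  proof -
    have *: "continuous_on ({0..1} \<times> ?B) (\<lambda>x. f (\<rho> (fst x) (snd x)))" if "holomorphic_vec_on f ?B" for f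
    proof (rule continuous_on_compose2[OF holomorphic_vec_on_continuous[OF that]])
      show "continuous_on ({0..1} \<times> ?B) (\<lambda>x. \<rho> (fst x) (snd x))" unfolding \<rho>_def by (intro continuous_intros)
    qed (use \<rho>B in auto)
    show ?thesis
      unfolding F_eq split_beta using that hol by (intro continuous_intros *) (auto simp: hv_def)
  qed
  have Thv: "hv (T u)" if "hv u" for u
    unfolding hv_def T_def using Fcont[OF that] Fhol[OF that]
    by (auto intro!: holomorphic_vec_on_param_integral)
  \<comment> \<open>the iterates are the terms of a Neumann series, with sum k\<close>
  define u where "u m = (T ^^ m) (\<lambda>z. c)" for m
  have uhv: "hv (u m)" for m
    by (induction m) (auto simp: u_def hv_def[of "\<lambda>z. c"] holomorphic_vec_on_const intro!: Thv)
  have u_Suc: "u (Suc m) = T (u m)" for m by (simp add: u_def)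
  define M where "M = norm c"
  have bound: "\<exists>C\<ge>0. \<forall>z\<in>cball p R'. \<forall>t\<in>{0..1}. \<forall>m \<alpha>.
      norm (F (u m) \<alpha> t z) \<le> C * M * C ^ m / fact m * t ^ m \<and> norm (u m z $ \<alpha>) \<le> M * C ^ m / fact m"
    if R': "0 \<le> R'" "R' < R" for R'
  proof -
    have sub: "cball p R' \<subseteq> ?B" using R' by auto
    have "\<exists>b. \<forall>z\<in>cball p R'. norm (\<theta> j \<alpha> \<beta> z) \<le> b" for j \<alpha> \<beta>
      using compact_imp_bounded[OF compact_continuous_image[OF continuous_on_subset[OF holomorphic_vec_on_continuous[OF hol] sub] compact_cball]]
      unfolding bounded_iff by blast
    then obtain b where b: "\<And>j \<alpha> \<beta> z. z \<in> cball p R' \<Longrightarrow> norm (\<theta> j \<alpha> \<beta> z) \<le> b j \<alpha> \<beta>" by metis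
    define b' where "b' = (\<Sum>j\<in>UNIV. \<Sum>\<alpha>\<in>UNIV. \<Sum>\<beta>\<in>UNIV. \<bar>b j \<alpha> \<beta>\<bar>)"
    have b'0: "b' \<ge> 0" by (auto simp: b'_def intro!: sum_nonneg)
    have b': "norm (\<theta> j \<alpha> \<beta> z) \<le> b'" if "z \<in> cball p R'" for j \<alpha> \<beta> z
    proof -
      have "\<bar>b j \<alpha> \<beta>\<bar> \<le> (\<Sum>\<beta>\<in>UNIV. \<bar>b j \<alpha> \<beta>\<bar>)" by (rule member_le_sum) auto
      also have "\<dots> \<le> (\<Sum>\<alpha>\<in>UNIV. \<Sum>\<beta>\<in>UNIV. \<bar>b j \<alpha> \<beta>\<bar>)"
        by (rule member_le_sum[of \<alpha> UNIV "\<lambda>\<alpha>. \<Sum>\<beta>\<in>UNIV. \<bar>b j \<alpha> \<beta>\<bar>"]) (auto intro: sum_nonneg)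
      also have "\<dots> \<le> b'" unfolding b'_def
        by (rule member_le_sum[of j UNIV "\<lambda>j. \<Sum>\<alpha>\<in>UNIV. \<Sum>\<beta>\<in>UNIV. \<bar>b j \<alpha> \<beta>\<bar>"]) (auto intro!: sum_nonneg)
      finally show ?thesis using b[OF that, of j \<alpha> \<beta>] by linarith
    qed
    define C where "C = real CARD('r) * (real CARD('n) * (R' * b'))"
    have C0: "C \<ge> 0" using R' b'0 by (simp add: C_def)
    have M0: "M \<ge> 0" by (simp add: M_def)
    have \<rho>c: "\<rho> t z \<in> cball p (t * norm (z - p))" "\<rho> t z \<in> cball p R'" if "t \<in> {0..1}" "z \<in> cball p R'" for t z
      using that mult_left_le_one_le[of "norm (z - p)" t] by (auto simp: \<rho>_def dist_norm norm_minus_commute)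
    \<comment> \<open>a bound by powers of C alone would give a geometric series, which need not converge on the
      whole ball; L scales with the distance from p, so that each integration contributes the
      factor 1 / (m + 1)\<close>
    define L where "L z = real CARD('r) * (real CARD('n) * (norm (z - p) * b'))" for z
    have L0: "0 \<le> L z" for z using b'0 by (simp add: L_def)
    have LC: "L z \<le> C" if "z \<in> cball p R'" for z
      unfolding L_def C_def using that b'0 by (intro mult_left_mono mult_right_mono) (auto simp: dist_norm norm_minus_commute)
    have L\<rho>: "L (\<rho> t z) = t * L z" if "t \<in> {0..1}" for t z
      using that by (simp add: L_def \<rho>_def)
    have Fb: "norm (F (u m) \<alpha> t z) \<le> L z * (M * (t * L z) ^ m / fact m)"
      if t: "t \<in> {0..1}" and z: "z \<in> cball p R'"
        and um: "\<And>z \<alpha>. z \<in> cball p R' \<Longrightarrow> norm (u m z $ \<alpha>) \<le> M * L z ^ m / fact m" for m \<alpha> t z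
    proof -
      have "norm (F (u m) \<alpha> t z) \<le> (\<Sum>\<beta>\<in>(UNIV::'r set). (\<Sum>j\<in>(UNIV::'n set). norm (z - p) * b') * (M * (t * L z) ^ m / fact m))"
        unfolding F_eq
      proof (rule sum_norm_le)
        fix \<beta>
        have "norm (\<Sum>j\<in>UNIV. (z $ j - p $ j) * \<theta> j \<alpha> \<beta> (\<rho> t z)) \<le> (\<Sum>j\<in>(UNIV::'n set). norm (z - p) * b')"
          using b'[OF \<rho>c(2)[OF t z]] b'0 Finite_Cartesian_Product.norm_nth_le[of "z - p"]
          by (intro sum_norm_le) (simp add: norm_mult mult_mono)
        moreover have "norm (u m (\<rho> t z) $ \<beta>) \<le> M * (t * L z) ^ m / fact m"
          using um[OF \<rho>c(2)[OF t z], of \<beta>] by (simp add: L\<rho>[OF t])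
        ultimately show "norm ((\<Sum>j\<in>UNIV. (z $ j - p $ j) * \<theta> j \<alpha> \<beta> (\<rho> t z)) * u m (\<rho> t z) $ \<beta>)
          \<le> (\<Sum>j\<in>(UNIV::'n set). norm (z - p) * b') * (M * (t * L z) ^ m / fact m)"
          unfolding norm_mult using b'0 by (intro mult_mono) (auto intro!: sum_nonneg)
      qed
      also have "\<dots> = L z * (M * (t * L z) ^ m / fact m)"
        by (simp add: L_def)
      finally show ?thesis .
    qed
    have ub: "norm (u m z $ \<alpha>) \<le> M * L z ^ m / fact m" if "z \<in> cball p R'" for m z \<alpha>
      using that
    proof (induction m arbitrary: z \<alpha>)
      case 0
      then show ?case by (simp add: u_def M_def Finite_Cartesian_Product.norm_nth_le)
    next
      case (Suc m)
      have zB: "z \<in> ?B" using Suc.prems sub by auto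
      have cF: "continuous_on {0..1} (\<lambda>t. F (u m) \<alpha> t z)"
        by (rule continuous_on_compose2[OF Fcont[OF uhv, of m \<alpha>], of _ "\<lambda>t. (t, z)", simplified])
           (use zB in \<open>auto intro!: continuous_intros\<close>)
      have I: "((\<lambda>t. L z * (M * (t * L z) ^ m / fact m)) has_integral M * L z ^ Suc m / fact (Suc m)) {0..1}"
      proof -
        have "((\<lambda>t. t ^ m) has_integral (1 ^ Suc m / real (Suc m) - 0 ^ Suc m / real (Suc m))) {0..1::real}"
          by (rule fundamental_theorem_of_calculus)
             (auto intro!: DERIV_cong[OF DERIV_cdivide[OF DERIV_pow]] simp: has_real_derivative_iff_has_vector_derivative[symmetric] simp del: of_nat_Suc power_Suc)
        from has_integral_mult_right[OF this, of "L z * M * L z ^ m / fact m"]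
        show ?thesis by (simp add: power_mult_distrib mult_ac)
      qed
      have "norm (u (Suc m) z $ \<alpha>) \<le> integral {0..1} (\<lambda>t. L z * (M * (t * L z) ^ m / fact m))"
        unfolding u_Suc T_def vec_lambda_beta
        using Fb[OF _ Suc.prems Suc.IH]
        by (intro integral_norm_bound_integral integrable_continuous_interval[OF cF] has_integral_integrable[OF I]) auto
      then show ?case unfolding integral_unique[OF I] .
    qed
    have "norm (F (u m) \<alpha> t z) \<le> C * M * C ^ m / fact m * t ^ m" if z: "z \<in> cball p R'" and t: "t \<in> {0..1}" for m \<alpha> t z
    proof -
      have "norm (F (u m) \<alpha> t z) \<le> L z * (M * (t * L z) ^ m / fact m)" using Fb[OF t z ub] .
      also have "\<dots> \<le> C * (M * (t * C) ^ m / fact m)"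
        using LC[OF z] L0[of z] C0 M0 t
        by (intro mult_mono divide_right_mono power_mono mult_left_mono) auto
      finally show ?thesis by (simp add: power_mult_distrib mult_ac)
    qed
    moreover have "norm (u m z $ \<alpha>) \<le> M * C ^ m / fact m" if z: "z \<in> cball p R'" for m \<alpha> z
    proof -
      have "M * L z ^ m / fact m \<le> M * C ^ m / fact m"
        using LC[OF z] L0[of z] M0 by (intro divide_right_mono mult_left_mono power_mono) auto
      then show ?thesis using ub[OF z, of m \<alpha>] by linarith
    qed
    ultimately show ?thesis using C0 by blast
  qed
  have summ: "summable (\<lambda>m. K * C ^ m / fact m)" for K C :: real
    using summable_mult[OF summable_exp[of C], of K] by (simp add: field_simps)
  define k where "k z = (\<chi> \<alpha>. \<Sum>m. u m z $ \<alpha>)" for z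
  have unif: "uniform_limit (cball p R') (\<lambda>n z. \<Sum>m<n. u m z $ \<alpha>) (\<lambda>z. k z $ \<alpha>) sequentially" if RR: "0 \<le> R'" "R' < R" for R' \<alpha>
  proof -
    obtain C where C: "C \<ge> 0" "\<And>z m \<alpha>. z \<in> cball p R' \<Longrightarrow> norm (u m z $ \<alpha>) \<le> M * C ^ m / fact m"
      using bound[OF RR] by (metis atLeastAtMost_iff order_refl zero_le_one)
    show ?thesis
      unfolding k_def vec_lambda_beta by (rule Weierstrass_m_test[OF _ summ]) (use C in auto)
  qed
  have khv: "hv k"
    unfolding hv_def
  proof
    fix \<alpha>
    show "holomorphic_vec_on (\<lambda>z. k z $ \<alpha>) ?B"
    proof (rule holomorphic_vec_on_uniform_sequence[of _ "\<lambda>n z. \<Sum>m<n. u m z $ \<alpha>"])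
      show "holomorphic_vec_on (\<lambda>z. \<Sum>m<n. u m z $ \<alpha>) ?B" for n
        using uhv by (intro holomorphic_vec_on_intros) (auto simp: hv_def)
      fix x assume x: "x \<in> ?B"
      define R' where "R' = (dist p x + R) / 2"
      have R': "0 \<le> R'" "R' < R" "dist p x < R'" using x R zero_le_dist[of p x] add_nonneg_nonneg[of "dist p x" R] by (auto simp: R'_def simp del: zero_le_dist)
      have sub: "cball x (R' - dist p x) \<subseteq> cball p R'"
      proof
        fix y assume "y \<in> cball x (R' - dist p x)"
        then show "y \<in> cball p R'" using dist_triangle[of p y x] by auto
      qed
      show "\<exists>d>0. cball x d \<subseteq> ?B \<and> uniform_limit (cball x d) (\<lambda>n z. \<Sum>m<n. u m z $ \<alpha>) (\<lambda>z. k z $ \<alpha>) sequentially"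
        using R' sub uniform_limit_on_subset[OF unif[OF R'(1,2)] sub]
        by (intro exI[of _ "R' - dist p x"]) auto
    qed simp
  qed
  have keq: "k z $ \<alpha> = c $ \<alpha> + integral {0..1} (\<lambda>t. F k \<alpha> t z)" if z: "z \<in> ?B" for z \<alpha>
  proof -
    define R' where "R' = dist p z"
    have R': "0 \<le> R'" "R' < R" "z \<in> cball p R'" using z by (auto simp: R'_def)
    obtain C where C: "C \<ge> 0" "\<And>z t m \<alpha>. z \<in> cball p R' \<Longrightarrow> t \<in> {0..1} \<Longrightarrow> norm (F (u m) \<alpha> t z) \<le> C * M * C ^ m / fact m * t ^ m"
      "\<And>z m \<alpha>. z \<in> cball p R' \<Longrightarrow> norm (u m z $ \<alpha>) \<le> M * C ^ m / fact m"
      using bound[OF R'(1,2)] by (metis atLeastAtMost_iff order_refl zero_le_one)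
    have su: "summable (\<lambda>m. u m y $ \<beta>)" if "y \<in> cball p R'" for y \<beta>
      using C(3)[OF that] by (intro summable_comparison_test'[OF summ[of M C]])
    have \<rho>R: "\<rho> t z \<in> cball p R'" if "t \<in> {0..1}" for t
      using that R' mult_left_le_one_le[of "norm (z - p)" t] by (auto simp: \<rho>_def R'_def dist_norm norm_minus_commute)
    have Fsum: "(\<Sum>m. F (u m) \<alpha> t z) = F k \<alpha> t z" if t: "t \<in> {0..1}" for t
      unfolding F_eq k_def vec_lambda_beta
      by (subst suminf_sum) (auto intro!: summable_mult su \<rho>R t sum.cong suminf_mult)
    have ul: "uniform_limit {0..1} (\<lambda>n t. \<Sum>m<n. F (u m) \<alpha> t z) (\<lambda>t. F k \<alpha> t z) sequentially"
    proof -
      have "uniform_limit {0..1} (\<lambda>n t. \<Sum>m<n. F (u m) \<alpha> t z) (\<lambda>t. \<Sum>m. F (u m) \<alpha> t z) sequentially"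
      proof (rule Weierstrass_m_test[OF _ summ[of "C * M" C]])
        fix m and t :: real assume t: "t \<in> {0..1}"
        have "C * M * C ^ m / fact m * t ^ m \<le> C * M * C ^ m / fact m * 1"
          using C(1) t by (intro mult_left_mono power_le_one) (auto simp: M_def)
        then show "norm (F (u m) \<alpha> t z) \<le> C * M * C ^ m / fact m" using C(2)[OF R'(3) t, of m \<alpha>] by simp
      qed
      then show ?thesis
        by (rule uniform_limit_cong'[THEN iffD1, rotated -1]) (use Fsum in auto)
    qed
    have cF: "continuous_on {0..1} (\<lambda>t. F (u m) \<alpha> t z)" for m
      by (rule continuous_on_compose2[OF Fcont[OF uhv, of m \<alpha>], of _ "\<lambda>t. (t, z)", simplified])
         (use z in \<open>auto intro!: continuous_intros\<close>)
    obtain I J where IJ: "\<And>n. ((\<lambda>t. \<Sum>m<n. F (u m) \<alpha> t z) has_integral I n) {0..1}"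
        "((\<lambda>t. F k \<alpha> t z) has_integral J) {0..1}" "I \<longlonglongrightarrow> J"
      by (rule uniform_limit_integral[OF ul]) (auto intro!: continuous_on_sum cF)
    have "I n = (\<Sum>m<n. u (Suc m) z $ \<alpha>)" for n
    proof -
      have "((\<lambda>t. \<Sum>m<n. F (u m) \<alpha> t z) has_integral (\<Sum>m<n. u (Suc m) z $ \<alpha>)) {0..1}"
        unfolding u_Suc T_def vec_lambda_beta
        by (intro has_integral_sum integrable_integral integrable_continuous_interval cF) auto
      with IJ(1) show ?thesis using has_integral_unique by blast
    qed
    then have "(\<lambda>n. \<Sum>m<n. u (Suc m) z $ \<alpha>) \<longlonglongrightarrow> J" using IJ(3) by presburger
    then have "(\<lambda>m. u (Suc m) z $ \<alpha>) sums J" by (simp add: sums_def)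
    then have "(\<lambda>m. u m z $ \<alpha>) sums (J + u 0 z $ \<alpha>)" by (rule sums_Suc)
    then have "k z $ \<alpha> = J + c $ \<alpha>" by (simp add: k_def sums_unique[symmetric] u_def)
    then show ?thesis using IJ(2) by (simp add: integral_unique)
  qed
  show ?thesis
  proof (rule that[of k])
    show "holomorphic_vec_on (\<lambda>z. k z $ \<alpha>) ?B" for \<alpha> using khv by (simp add: hv_def)
    show "k p = c"
      unfolding vec_eq_iff using R by (auto simp: keq F_eq)
    fix v :: "complex^'n" and s :: real and \<alpha> assume v: "norm v < R" and s: "s \<in> {0..1}"
    have inB: "p + t *\<^sub>R v \<in> ?B" if "t \<in> {0..1}" for t
      using that v mult_left_le_one_le[of "norm v" t] by (auto simp: dist_norm)
    let ?g = "\<lambda>t. (radial_coeff \<theta> (p + t *\<^sub>R v) v *v k (p + t *\<^sub>R v)) $ \<alpha>"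
    have g_eq: "?g t = F k \<alpha> t (p + v)" for t by (simp add: F_def \<rho>_def)
    have "p + v \<in> ?B" using inB[of 1] by simp
    then have cg: "continuous_on {0..1} ?g"
      unfolding g_eq
      by (intro continuous_on_compose2[OF Fcont[OF khv, of \<alpha>], of _ "\<lambda>t. (t, p + v)", simplified])
         (auto intro!: continuous_intros)
    show "((\<lambda>s. k (p + s *\<^sub>R v) $ \<alpha>) has_vector_derivative ?g s) (at s within {0..1})"
    proof (rule integral_scaled_has_vector_derivative[OF cg s, of _ "c $ \<alpha>"])
      fix s :: real assume s: "s \<in> {0..1}"
      have "F k \<alpha> t (p + s *\<^sub>R v) = s *\<^sub>R ?g (s * t)" for t
        by (simp add: F_def \<rho>_def radial_coeff_def matrix_vector_mult_def scaleR_sum_right sum_distrib_right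
             scaleR_conv_of_real[where 'a=complex] mult_ac sum_distrib_left)
      then show "k (p + s *\<^sub>R v) $ \<alpha> = c $ \<alpha> + integral {0..1} (\<lambda>t. s *\<^sub>R ?g (s * t))"
        using keq[OF inB[OF s], of \<alpha>] by simp
    qed
  qed
qed

text \<open>By the differential inequality, \<open>exp (- 2 C s) |y s|\<^sup>2\<close> is decreasing.\<close>

lemma linear_ode_unique_zero:
  fixes y :: "real \<Rightarrow> complex^'r"
  assumes y0: "y 0 = 0"
    and y: "\<And>s. s \<in> {0..1} \<Longrightarrow> (y has_vector_derivative y' s) (at s within {0..1})"
    and b: "\<And>s. s \<in> {0..1} \<Longrightarrow> norm (y' s) \<le> C * norm (y s)" and s: "s \<in> {0..1}"
  shows "y s = 0"
proof -
  let ?g = "\<lambda>s. exp (- 2 * C * s) * (y s \<bullet> y s)"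
  have cont: "continuous_on {0..1} y"
    using y by (meson continuous_on_eq_continuous_within has_vector_derivative_continuous)
  have "?g s \<le> ?g 0"
  proof (cases "s = 0")
    case False
    then have "0 \<le> s" using s by auto
    then show ?thesis
    proof (rule DERIV_nonpos_imp_decreasing_open)
      show "continuous_on {0..s} ?g"
        using s by (intro continuous_intros continuous_on_subset[OF cont]) auto
      fix x assume x: "0 < x" "x < s"
      then have x01: "x \<in> {0..1}" and at: "at x within {0..1} = at x"
        using s by (auto intro!: at_within_interior simp: interior_atLeastAtMost_real)
      have yx: "(y has_vector_derivative y' x) (at x)" using y[OF x01] by (simp add: at)
      have "((\<lambda>x. y x \<bullet> y x) has_derivative (\<lambda>h. y x \<bullet> (h *\<^sub>R y' x) + (h *\<^sub>R y' x) \<bullet> y x)) (at x)"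
        using yx unfolding has_vector_derivative_def by (intro has_derivative_inner)
      then have "((\<lambda>x. y x \<bullet> y x) has_real_derivative 2 * (y x \<bullet> y' x)) (at x)"
        unfolding has_field_derivative_def
        by (rule has_derivative_eq_rhs) (auto simp: inner_commute fun_eq_iff)
      then have d: "(?g has_real_derivative exp (- 2 * C * x) * (2 * (y x \<bullet> y' x) - 2 * C * (y x \<bullet> y x))) (at x)"
        by (auto intro!: derivative_eq_intros simp: algebra_simps)
      have "y x \<bullet> y' x \<le> norm (y x) * norm (y' x)" by (rule norm_cauchy_schwarz)
      also have "\<dots> \<le> norm (y x) * (C * norm (y x))" by (intro mult_left_mono b x01) auto
      finally have "2 * (y x \<bullet> y' x) - 2 * C * (y x \<bullet> y x) \<le> 0"
        by (simp add: power2_norm_eq_inner[symmetric] power2_eq_square mult_ac)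
      then have "exp (- 2 * C * x) * (2 * (y x \<bullet> y' x) - 2 * C * (y x \<bullet> y x)) \<le> 0"
        by (simp add: mult_nonneg_nonpos)
      with d show "\<exists>l. (?g has_real_derivative l) (at x) \<and> l \<le> 0" by blast
    qed
  qed simp
  then have "exp (- 2 * C * s) * (y s \<bullet> y s) \<le> 0" using y0 by simp
  then have "y s \<bullet> y s \<le> 0" by (simp add: mult_le_0_iff)
  then show ?thesis using inner_ge_zero[of "y s"] by (metis inner_eq_zero_iff order_antisym)
qed

section \<open>Entrywise calculus of matrix functions\<close>

text \<open>Derivatives are taken entry by entry, as this is how smoothness of a metric is given.\<close>

definition mderiv :: "('a::real_normed_vector \<Rightarrow> complex^'r^'r) \<Rightarrow> ('a \<Rightarrow> complex^'r^'r) \<Rightarrow> 'a \<Rightarrow> bool" where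
  "mderiv F F' z \<longleftrightarrow> (\<forall>\<alpha> \<beta>. ((\<lambda>z. F z $ \<alpha> $ \<beta>) has_derivative (\<lambda>v. F' v $ \<alpha> $ \<beta>)) (at z))"

lemma mderiv_unique: "mderiv F F' z \<Longrightarrow> mderiv F F'' z \<Longrightarrow> F' v = F'' v"
  unfolding mderiv_def vec_eq_iff using has_derivative_unique by metis

lemma mderiv_mult:
  assumes "mderiv F F' z" "mderiv G G' z"
  shows "mderiv (\<lambda>z. F z ** G z) (\<lambda>v. F z ** G' v + F' v ** G z) z"
  using assms unfolding mderiv_def matrix_matrix_mult_def
  by (auto intro!: derivative_eq_intros simp: sum.distrib[symmetric])

lemma mderiv_const: "mderiv (\<lambda>z. A) (\<lambda>v. 0) z"
  by (auto simp: mderiv_def)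

lemma mderiv_transform_open:
  assumes "mderiv F F' z" "open S" "z \<in> S" "\<And>w. w \<in> S \<Longrightarrow> F w = G w"
  shows "mderiv G F' z"
  using assms unfolding mderiv_def by (metis (no_types, lifting) has_derivative_transform_within_open)

lemma matrix_inv_props:
  assumes "invertible (A :: complex^'r^'r)"
  shows "A ** matrix_inv A = mat 1" "matrix_inv A ** A = mat 1"
  using assms unfolding invertible_def matrix_inv_def by (metis (mono_tags, lifting) someI_ex)+

lemma matrix_inv_cramer:
  assumes "invertible (A :: complex^'r^'r)"
  shows "matrix_inv A $ k $ j = det (\<chi> i l. if l = k then axis j 1 $ i else A $ i $ l) / det A"
proof -
  have d: "det A \<noteq> 0" using assms invertible_det_nz by blast
  have "A *v (matrix_inv A *v axis j 1) = axis j 1"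
    by (simp add: matrix_vector_mul_assoc matrix_inv_props[OF assms])
  then have "(matrix_inv A *v axis j 1) $ k = det (\<chi> i l. if l = k then axis j 1 $ i else A $ i $ l) / det A"
    by (simp add: cramer[OF d])
  moreover have "(matrix_inv A *v axis j 1) $ k = matrix_inv A $ k $ j"
    unfolding matrix_vector_mult_def vec_lambda_beta by (subst sum.remove[of _ j]) (auto simp: axis_def)
  ultimately show ?thesis by simp
qed

lemma differentiable_det:
  fixes F :: "'a::real_normed_vector \<Rightarrow> complex^'r^'r"
  assumes "\<And>\<alpha> \<beta>. (\<lambda>z. F z $ \<alpha> $ \<beta>) differentiable (at z)"
  shows "(\<lambda>z. det (F z)) differentiable (at z)"
proof -
  obtain D where D: "\<And>\<alpha> \<beta>. ((\<lambda>z. F z $ \<alpha> $ \<beta>) has_derivative D \<alpha> \<beta>) (at z)"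
    using assms unfolding differentiable_def by metis
  have "((\<lambda>z. det (F z)) has_derivative (\<lambda>v. \<Sum>p | p permutes UNIV. of_int (sign p) *
      (\<Sum>i\<in>UNIV. D i (p i) v * (\<Prod>j\<in>UNIV - {i}. F z $ j $ p j)))) (at z)"
    unfolding det_def
    by (rule has_derivative_sum, rule has_derivative_mult_right, rule has_derivative_prod, rule D)
  then show ?thesis using differentiable_def by blast
qed

text \<open>Cramer's rule shows that the inverse is differentiable; the value of the derivative then follows by
  differentiating \<open>F F\<^sup>-\<^sup>1 = 1\<close>.\<close>

lemma mderiv_inverse:
  fixes F :: "'a::real_normed_vector \<Rightarrow> complex^'r^'r"
  assumes F: "mderiv F F' z" and S: "open S" "z \<in> S" and inv: "\<And>w. w \<in> S \<Longrightarrow> invertible (F w)"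
  shows "mderiv (\<lambda>z. matrix_inv (F z)) (\<lambda>v. - (matrix_inv (F z) ** F' v ** matrix_inv (F z))) z"
proof -
  have diffF: "(\<lambda>z. F z $ \<alpha> $ \<beta>) differentiable (at z)" for \<alpha> \<beta>
    using F unfolding mderiv_def differentiable_def by blast
  have "(\<lambda>z. matrix_inv (F z) $ k $ j) differentiable (at z)" for k j
  proof -
    have "(\<lambda>z. det (\<chi> i l. if l = k then axis j 1 $ i else F z $ i $ l) / det (F z)) differentiable (at z)"
    proof (intro differentiable_divide differentiable_det)
      show "(\<lambda>z. (\<chi> i l. if l = k then axis j 1 $ i else F z $ i $ l) $ \<alpha> $ \<beta>) differentiable (at z)" for \<alpha> \<beta>
        using diffF[of \<alpha> \<beta>] by (cases "\<beta> = k") simp_all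
      show "det (F z) \<noteq> 0" using inv[OF S(2)] invertible_det_nz by blast
    qed (rule diffF)
    then obtain D where "((\<lambda>z. det (\<chi> i l. if l = k then axis j 1 $ i else F z $ i $ l) / det (F z)) has_derivative D) (at z)"
      unfolding differentiable_def by blast
    then have "((\<lambda>z. matrix_inv (F z) $ k $ j) has_derivative D) (at z)"
      by (rule has_derivative_transform_within_open[OF _ S]) (simp add: matrix_inv_cramer inv)
    then show ?thesis unfolding differentiable_def by blast
  qed
  then obtain D where D: "\<And>k j. ((\<lambda>z. matrix_inv (F z) $ k $ j) has_derivative D k j) (at z)"
    unfolding differentiable_def by metis
  define M' where "M' v = (\<chi> k j. D k j v)" for v
  have M': "mderiv (\<lambda>z. matrix_inv (F z)) M' z"
    using D by (simp add: mderiv_def M'_def)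
  let ?M = "matrix_inv (F z)"
  have "M' v = - (?M ** F' v ** ?M)" for v
  proof -
    have "mderiv (\<lambda>z. F z ** matrix_inv (F z)) (\<lambda>v. 0) z"
      by (rule mderiv_transform_open[OF mderiv_const S]) (simp add: matrix_inv_props inv)
    from mderiv_unique[OF mderiv_mult[OF F M'] this] have 0: "F z ** M' v + F' v ** ?M = 0" by simp
    have "?M ** (F z ** M' v + F' v ** ?M) = 0" unfolding 0 by (simp add: matrix_matrix_mult_def vec_eq_iff)
    then have "M' v + ?M ** F' v ** ?M = 0"
      by (simp add: matrix_add_ldistrib matrix_mul_assoc matrix_inv_props inv S)
    then show ?thesis by (simp add: eq_neg_iff_add_eq_0)
  qed
  then have "M' = (\<lambda>v. - (?M ** F' v ** ?M))" by auto
  with M' show ?thesis by simp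
qed

text \<open>Both sides are the complex-linear part of \<open>L\<close>: on the left through the standard basis, as
  in the Wirtinger derivatives, on the right without coordinates.\<close>

lemma real_linear_complexify:
  fixes L :: "complex^'n \<Rightarrow> complex"
  assumes "linear L"
  shows "(\<Sum>j\<in>UNIV. v $ j * ((L (axis j 1) - \<i> * L (axis j \<i>)) / 2)) = (L v - \<i> * L (\<i> *s v)) / 2"
proof -
  let ?f = "\<lambda>v. (L v - \<i> * L (\<i> *s v)) / 2"
  have "?f v = (\<Sum>j\<in>UNIV. v $ j * ?f (axis j 1))"
  proof (rule complex_linear_functional_sum)
    show "?f (x + y) = ?f x + ?f y" for x y
      using assms by (simp add: linear_add vector_add_ldistrib field_simps)
    show "?f (c *s x) = c * ?f x" for c x
    proof -
      have "c *s x = Re c *\<^sub>R x + Im c *\<^sub>R (\<i> *s x)"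
        by (simp add: vec_eq_iff complex_eq_iff)
      moreover have "\<i> *s (c *s x) = Re c *\<^sub>R (\<i> *s x) - Im c *\<^sub>R x"
        by (simp add: vec_eq_iff complex_eq_iff)
      ultimately have eqs: "L (c *s x) = of_real (Re c) * L x + of_real (Im c) * L (\<i> *s x)"
        "L (\<i> *s (c *s x)) = of_real (Re c) * L (\<i> *s x) - of_real (Im c) * L x"
        using assms by (simp_all add: linear_add linear_diff linear_scale scaleR_conv_of_real[where 'a=complex])
      have "L (c *s x) - \<i> * L (\<i> *s (c *s x)) = (of_real (Re c) + \<i> * of_real (Im c)) * (L x - \<i> * L (\<i> *s x))"
        unfolding eqs by (simp add: complex_eq_iff algebra_simps)
      then show ?thesis unfolding complex_eq[of c, symmetric] by (simp only: times_divide_eq_right)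
    qed
  qed
  moreover have "\<i> *s axis j 1 = axis j \<i>" for j :: 'n by (simp add: vec_eq_iff axis_def)
  ultimately show ?thesis by simp
qed

lemma complex_linear_from_axes:
  fixes L :: "complex^'n \<Rightarrow> complex"
  assumes L: "linear L" and ax: "\<And>k. L (axis k \<i>) = \<i> * L (axis k 1)"
  shows "L (c *s v) = c * L v"
proof -
  have "L v = (\<Sum>j\<in>UNIV. v $ j * L (axis j 1))" for v
  proof -
    have "v $ j *s axis j 1 = Re (v $ j) *\<^sub>R axis j 1 + Im (v $ j) *\<^sub>R axis j \<i>" for j
      by (simp add: vec_eq_iff axis_def complex_eq_iff)
    then have "L (v $ j *s axis j 1) = v $ j * L (axis j 1)" for j
      by (simp only: linear_add[OF L] linear_scale[OF L] ax) (simp add: complex_eq_iff)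
    moreover have "L v = L (\<Sum>j\<in>UNIV. v $ j *s axis j 1)"
      by (simp only: basis_expansion)
    ultimately show ?thesis by (simp only: linear_sum[OF L])
  qed
  from this[of "c *s v"] this[of v] show ?thesis
    by (simp add: sum_distrib_left mult.assoc)
qed

section \<open>The Gram matrix and the Chern connection\<close>

context hermitian_bundle
begin

definition gram_deriv :: "('e \<Rightarrow> complex^'r) \<Rightarrow> complex^'n \<Rightarrow> complex^'n \<Rightarrow> complex^'r^'r" where
  "gram_deriv \<phi> z v = (\<chi> \<alpha> \<beta>. frechet_derivative (\<lambda>z. gram E h \<phi> z $ \<alpha> $ \<beta>) (at z) v)"

lemma gram_mderiv:
  assumes "(U, \<phi>) \<in> atlas E" "z \<in> U"
  shows "mderiv (gram E h \<phi>) (gram_deriv \<phi> z) z"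
proof -
  have "(\<lambda>z. gram E h \<phi> z $ \<alpha> $ \<beta>) differentiable (at z)" for \<alpha> \<beta>
  proof -
    have "Ck_on (Suc 0) (\<lambda>z. gram E h \<phi> z $ \<alpha> $ \<beta>) U"
      using gram_smooth[OF assms(1)] unfolding smooth_on_def by blast
    with assms(2) show ?thesis by simp
  qed
  then show ?thesis
    unfolding mderiv_def gram_deriv_def using frechet_derivative_works by fastforce
qed

lemma gram_deriv_differentiable:
  assumes "(U, \<phi>) \<in> atlas E" "z \<in> U"
  shows "(\<lambda>z. gram_deriv \<phi> z v $ \<alpha> $ \<beta>) differentiable (at z)"
proof -
  have "Ck_on (Suc (Suc 0)) (\<lambda>z. gram E h \<phi> z $ \<alpha> $ \<beta>) U"
    using gram_smooth[OF assms(1)] unfolding smooth_on_def by blast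
  with assms(2) show ?thesis by (simp add: gram_deriv_def)
qed

lemma gram_deriv_linear:
  assumes "(U, \<phi>) \<in> atlas E" "z \<in> U"
  shows "linear (\<lambda>v. gram_deriv \<phi> z v $ \<alpha> $ \<beta>)"
  using gram_mderiv[OF assms] has_derivative_linear unfolding mderiv_def by blast

lemma gram_deriv_hermitian:
  assumes U: "(U, \<phi>) \<in> atlas E" "z \<in> U"
  shows "gram_deriv \<phi> z v $ \<beta> $ \<alpha> = cnj (gram_deriv \<phi> z v $ \<alpha> $ \<beta>)"
proof -
  have 1: "((\<lambda>z. gram E h \<phi> z $ \<alpha> $ \<beta>) has_derivative (\<lambda>v. gram_deriv \<phi> z v $ \<alpha> $ \<beta>)) (at z)" for \<alpha> \<beta>
    using gram_mderiv[OF U] unfolding mderiv_def by blast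
  have "((\<lambda>z. cnj (gram E h \<phi> z $ \<alpha> $ \<beta>)) has_derivative (\<lambda>v. cnj (gram_deriv \<phi> z v $ \<alpha> $ \<beta>))) (at z)"
    by (rule bounded_linear.has_derivative[OF bounded_linear_cnj 1])
  then have "((\<lambda>z. gram E h \<phi> z $ \<beta> $ \<alpha>) has_derivative (\<lambda>v. cnj (gram_deriv \<phi> z v $ \<alpha> $ \<beta>))) (at z)"
    by (rule has_derivative_transform_within_open[OF _ chart_open[OF U(1)] U(2)])
       (rule gram_hermitian[symmetric, OF U(1)])
  from has_derivative_unique[OF 1 this] show ?thesis by meson
qed

lemma gram_invertible:
  assumes U: "(U, \<phi>) \<in> atlas E" "z \<in> U"
  shows "invertible (gram E h \<phi> z)"
proof -
  have "x = 0" if x: "gram E h \<phi> z *v x = 0" for x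
  proof (rule ccontr)
    assume "x \<noteq> 0"
    then have "(\<chi> i. cnj (x $ i)) \<noteq> 0" by (auto simp: vec_eq_iff)
    from hform_gram_pos[OF U this]
    have "0 < Re (\<Sum>\<alpha>\<in>UNIV. cnj (x $ \<alpha>) * (gram E h \<phi> z *v x) $ \<alpha>)"
      by (simp add: hform_def matrix_vector_mult_def sum_distrib_left mult_ac)
    with x show False by simp
  qed
  then show ?thesis
    using matrix_left_invertible_ker invertible_left_inverse by blast
qed

text \<open>The \<open>(1,0)\<close>-part \<open>\<partial>H\<close> of the derivative of the Gram matrix, evaluated
  on \<open>v\<close>.\<close>

definition gram_p :: "('e \<Rightarrow> complex^'r) \<Rightarrow> complex^'n \<Rightarrow> complex^'n \<Rightarrow> complex^'r^'r" where
  "gram_p \<phi> z v = (\<chi> \<alpha> \<beta>. (gram_deriv \<phi> z v $ \<alpha> $ \<beta> - \<i> * gram_deriv \<phi> z (\<i> *s v) $ \<alpha> $ \<beta>) / 2)"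

text \<open>As \<open>H\<close> is Hermitian, \<open>\<partial>bar H\<close> is the conjugate transpose of
  \<open>\<partial>H\<close>.\<close>

lemma gram_deriv_split:
  assumes U: "(U, \<phi>) \<in> atlas E" "z \<in> U"
  shows "gram_deriv \<phi> z v $ \<alpha> $ \<beta> = gram_p \<phi> z v $ \<alpha> $ \<beta> + cnj (gram_p \<phi> z v $ \<beta> $ \<alpha>)"
  using gram_deriv_hermitian[OF U, of v \<alpha> \<beta>] gram_deriv_hermitian[OF U, of "\<i> *s v" \<alpha> \<beta>]
  by (simp add: gram_p_def field_simps)

lemma gram_p_axis:
  assumes U: "(U, \<phi>) \<in> atlas E" "z \<in> U"
  shows "gram_p \<phi> z v = (\<chi> \<alpha> \<beta>. \<Sum>j\<in>UNIV. v $ j * wirtinger j (\<lambda>w. gram E h \<phi> w $ \<alpha> $ \<beta>) z)"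
  unfolding gram_p_def wirtinger_def real_linear_complexify[OF gram_deriv_linear[OF U], symmetric]
  by (simp add: gram_deriv_def)

lemma chern_connection_gram:
  assumes U: "(U, \<phi>) \<in> atlas E" "z \<in> U"
  shows "chern_connection E h \<phi> j z ** gram E h \<phi> z = (\<chi> \<alpha> \<beta>. wirtinger j (\<lambda>w. gram E h \<phi> w $ \<alpha> $ \<beta>) z)"
  unfolding chern_connection_def
  by (simp add: matrix_mul_assoc[symmetric] matrix_inv_props gram_invertible[OF U])

lemma gram_p_connection:
  assumes U: "(U, \<phi>) \<in> atlas E" "z \<in> U"
  shows "gram_p \<phi> z v = radial_coeff (\<lambda>j \<alpha> \<beta> z. chern_connection E h \<phi> j z $ \<alpha> $ \<beta>) z v ** gram E h \<phi> z"
proof -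
  have "(radial_coeff (\<lambda>j \<alpha> \<beta> z. chern_connection E h \<phi> j z $ \<alpha> $ \<beta>) z v ** gram E h \<phi> z) $ \<alpha> $ \<beta>
     = (\<Sum>j\<in>UNIV. v $ j * (chern_connection E h \<phi> j z ** gram E h \<phi> z) $ \<alpha> $ \<beta>)" for \<alpha> \<beta>
    by (simp add: radial_coeff_def matrix_matrix_mult_def sum_distrib_left sum_distrib_right mult.assoc)
       (rule sum.swap)
  then show ?thesis
    by (simp add: vec_eq_iff gram_p_axis[OF U] chern_connection_gram[OF U])
qed

lemma chern_connection_differentiable:
  assumes U: "(U, \<phi>) \<in> atlas E" "z \<in> U"
  shows "(\<lambda>z. chern_connection E h \<phi> j z $ \<alpha> $ \<beta>) differentiable (at z)"
proof -
  have 1: "(\<lambda>w. matrix_inv (gram E h \<phi> w) $ \<gamma> $ \<beta>) differentiable (at z)" for \<gamma> \<beta>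
    using mderiv_inverse[OF gram_mderiv[OF U] chart_open[OF U(1)] U(2) gram_invertible[OF U(1)]]
    unfolding mderiv_def differentiable_def by blast
  have 2: "(\<lambda>z. wirtinger j (\<lambda>w. gram E h \<phi> w $ \<alpha> $ \<gamma>) z) differentiable (at z)" for \<gamma>
  proof -
    have "(\<lambda>z. (gram_deriv \<phi> z (axis j 1) $ \<alpha> $ \<gamma> - \<i> * gram_deriv \<phi> z (axis j \<i>) $ \<alpha> $ \<gamma>) / 2) differentiable (at z)"
      by (intro differentiable_divide differentiable_diff differentiable_mult gram_deriv_differentiable[OF U]) auto
    then show ?thesis by (simp add: wirtinger_def gram_deriv_def)
  qed
  show ?thesis
    unfolding chern_connection_def matrix_matrix_mult_def vec_lambda_beta
    by (intro differentiable_sum ballI differentiable_mult 1 2) auto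
qed

text \<open>The curvature is \<open>\<partial>bar \<theta>\<close>, so in the flat case the Cauchy-Riemann equations
  hold for the entries of \<open>\<theta>\<close>.\<close>

lemma flat_connection_holomorphic:
  assumes flat: "i_chern_curvature_zero E h" and U: "(U, \<phi>) \<in> atlas E"
  shows "holomorphic_vec_on (\<lambda>z. chern_connection E h \<phi> j z $ \<alpha> $ \<beta>) U"
  unfolding holomorphic_vec_on_def
proof
  fix z assume z: "z \<in> U"
  let ?f = "\<lambda>z. chern_connection E h \<phi> j z $ \<alpha> $ \<beta>"
  let ?D = "frechet_derivative ?f (at z)"
  have D: "(?f has_derivative ?D) (at z)"
    using chern_connection_differentiable[OF U z] frechet_derivative_works by blast
  have lin: "linear ?D" using D has_derivative_linear by blast
  have cancel: "b = \<i> * a" if "a + \<i> * b = 0" for a b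
    using that by (simp add: complex_eq_iff)
  have "wirtinger_bar k ?f z = 0" for k
    using flat U z unfolding i_chern_curvature_zero_def chern_curvature_def by fastforce
  then have "(?D (axis k 1) + \<i> * ?D (axis k \<i>)) / 2 = 0" for k
    unfolding wirtinger_bar_def .
  then have ax': "?D (axis k 1) + \<i> * ?D (axis k \<i>) = 0" for k
    using divide_eq_0_iff zero_neq_numeral by metis
  have ax: "?D (axis k \<i>) = \<i> * ?D (axis k 1)" for k
    by (rule cancel[OF ax'])
  have "?D (c *s v) = c * ?D v" for c v
    by (rule complex_linear_from_axes[OF lin ax])
  with D show "\<exists>f'. (?f has_derivative f') (at z) \<and> (\<forall>c v. f' (c *s v) = c * f' v)" by blast
qed

section \<open>Local parallel sections of a flat bundle\<close>

text \<open>Passing to another frame multiplies the pairings with the frame sections by the holomorphic transition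
  matrix.\<close>

lemma parallel_in_frame:
  assumes U: "(U, \<phi>) \<in> atlas E" and S: "S \<subseteq> U" "open S" and \<tau>: "holomorphic_section E S \<tau>"
    and hol: "\<And>\<beta>. holomorphic_vec_on (\<lambda>z. h (triv_inv E \<phi> z (axis \<beta> 1)) (\<tau> z)) S"
  shows "parallel_section S \<tau>"
proof -
  have "holomorphic_vec_on (\<lambda>z. h (triv_inv E \<psi> z (axis \<beta> 1)) (\<tau> z)) (S \<inter> V)"
    if V: "(V, \<psi>) \<in> atlas E" for V \<psi> \<beta>
  proof -
    have "holomorphic_vec_on (\<lambda>z. \<Sum>\<gamma>\<in>UNIV. \<phi> (triv_inv E \<psi> z (axis \<beta> 1)) $ \<gamma> * h (triv_inv E \<phi> z (axis \<gamma> 1)) (\<tau> z)) (S \<inter> V)"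
      using S by (intro holomorphic_vec_on_intros holomorphic_vec_on_subset[OF hol]
          holomorphic_vec_on_subset[OF transition_holomorphic[OF V U]]) auto
    then show ?thesis
    proof (rule holomorphic_vec_on_cong_open)
      show "open (S \<inter> V)" using S chart_open[OF V] by auto
      show "(\<Sum>\<gamma>\<in>UNIV. \<phi> (triv_inv E \<psi> z (axis \<beta> 1)) $ \<gamma> * h (triv_inv E \<phi> z (axis \<gamma> 1)) (\<tau> z))
          = h (triv_inv E \<psi> z (axis \<beta> 1)) (\<tau> z)" if "z \<in> S \<inter> V" for z
        using that S by (intro frame_expansion[symmetric, OF U]) (auto intro: triv_inv_fibre[OF V] holomorphic_sectionD(1)[OF \<tau>])
    qed
  qed
  with \<tau> show ?thesis unfolding parallel_section_def by blast
qed

text \<open>For \<open>\<tau> = \<Sum>\<alpha>. f\<^sub>\<alpha> e\<^sub>\<alpha>\<close>, the condition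
  \<open>D\<tau> = 0\<close> reads \<open>df = - \<theta>\<^sup>T f\<close>. Imposing it only along the
  rays from \<open>p\<close> determines a holomorphic \<open>f\<close>. The pairings with the frame are
  \<open>Y = H cnj f\<close>. From \<open>dH = \<theta> H + H \<theta>\<^sup>*\<close> one gets \<open>dY
  = \<theta> Y\<close> along the rays, as the terms with \<open>\<theta>\<^sup>*\<close> cancel; so
  \<open>Y\<close> agrees with the holomorphic solution \<open>k\<close> of the same equation.\<close>

lemma local_parallel_section:
  assumes flat: "i_chern_curvature_zero E h" and U: "(U, \<phi>) \<in> atlas E"
    and R: "R > 0" "ball p R \<subseteq> U" and \<xi>: "\<xi> \<in> fibre E p"
  shows "\<exists>\<tau>. parallel_section (ball p R) \<tau> \<and> \<tau> p = \<xi>"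
proof -
  let ?H = "gram E h \<phi>"
  let ?\<theta> = "\<lambda>j \<alpha> \<beta> z. chern_connection E h \<phi> j z $ \<alpha> $ \<beta>"
  let ?\<theta>' = "\<lambda>j \<alpha> \<beta> z. - ?\<theta> j \<beta> \<alpha> z"
  have pU: "p \<in> U" using R by auto
  have hol: "holomorphic_vec_on (?\<theta> j \<alpha> \<beta>) (ball p R)" for j \<alpha> \<beta>
    by (rule holomorphic_vec_on_subset[OF flat_connection_holomorphic[OF flat U] R(2)])
  have hol': "holomorphic_vec_on (?\<theta>' j \<alpha> \<beta>) (ball p R)" for j \<alpha> \<beta>
    using holomorphic_vec_on_mult[OF holomorphic_vec_on_const[of "-1"] hol] by simp
  obtain f where f: "\<And>\<alpha>. holomorphic_vec_on (\<lambda>z. f z $ \<alpha>) (ball p R)" "f p = \<phi> \<xi>"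
    "\<And>v s \<alpha>. norm v < R \<Longrightarrow> s \<in> {0..1} \<Longrightarrow>
      ((\<lambda>s. f (p + s *\<^sub>R v) $ \<alpha>) has_vector_derivative (radial_coeff ?\<theta>' (p + s *\<^sub>R v) v *v f (p + s *\<^sub>R v)) $ \<alpha>) (at s within {0..1})"
    by (rule radial_ode_holomorphic_solution[of ?\<theta>' p R "\<phi> \<xi>", OF hol' R(1)]) (rule that, assumption+)
  define Y where "Y z = ?H z *v (\<chi> \<gamma>. cnj (f z $ \<gamma>))" for z
  obtain k where k: "\<And>\<alpha>. holomorphic_vec_on (\<lambda>z. k z $ \<alpha>) (ball p R)" "k p = Y p"
    "\<And>v s \<alpha>. norm v < R \<Longrightarrow> s \<in> {0..1} \<Longrightarrow>
      ((\<lambda>s. k (p + s *\<^sub>R v) $ \<alpha>) has_vector_derivative (radial_coeff ?\<theta> (p + s *\<^sub>R v) v *v k (p + s *\<^sub>R v)) $ \<alpha>) (at s within {0..1})"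
    by (rule radial_ode_holomorphic_solution[of ?\<theta> p R "Y p", OF hol R(1)]) (rule that, assumption+)
  have kY: "k z = Y z" if z: "z \<in> ball p R" for z
  proof -
    define v where "v = z - p"
    have v: "norm v < R" using z by (simp add: v_def dist_norm norm_minus_commute)
    let ?z = "\<lambda>s::real. p + s *\<^sub>R v"
    have inU: "?z s \<in> U" "?z s \<in> ball p R" if "s \<in> {0..1}" for s
      using that v R mult_left_le_one_le[of "norm v" s] by (auto simp: dist_norm subset_iff)
    let ?A = "\<lambda>s. radial_coeff ?\<theta> (?z s) v"
    have Yd: "((\<lambda>s. Y (?z s) $ \<beta>) has_vector_derivative (?A s *v Y (?z s)) $ \<beta>) (at s within {0..1})" if s: "s \<in> {0..1}" for s \<beta>
    proof -
      have dH: "((\<lambda>s. ?H (?z s) $ \<beta> $ \<gamma>) has_vector_derivative gram_deriv \<phi> (?z s) v $ \<beta> $ \<gamma>) (at s within {0..1})" for \<gamma>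
      proof -
        have "((\<lambda>z. ?H z $ \<beta> $ \<gamma>) has_derivative (\<lambda>v. gram_deriv \<phi> (?z s) v $ \<beta> $ \<gamma>)) (at (?z s))"
          using gram_mderiv[OF U inU(1)[OF s]] unfolding mderiv_def by blast
        moreover have "(?z has_derivative (\<lambda>t. t *\<^sub>R v)) (at s within {0..1})"
          by (auto intro!: derivative_eq_intros)
        ultimately have "((\<lambda>s. ?H (?z s) $ \<beta> $ \<gamma>) has_derivative (\<lambda>t. gram_deriv \<phi> (?z s) (t *\<^sub>R v) $ \<beta> $ \<gamma>)) (at s within {0..1})"
          by (rule has_derivative_compose[rotated])
        then show ?thesis
          unfolding has_vector_derivative_def using linear_scale[OF gram_deriv_linear[OF U inU(1)[OF s]]] by simp
      qed
      have df: "((\<lambda>s. cnj (f (?z s) $ \<gamma>)) has_vector_derivative cnj ((radial_coeff ?\<theta>' (?z s) v *v f (?z s)) $ \<gamma>)) (at s within {0..1})" for \<gamma>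
        by (rule bounded_linear.has_vector_derivative[OF bounded_linear_cnj f(3)[OF v s]])
      have "((\<lambda>s. Y (?z s) $ \<beta>) has_vector_derivative
         (\<Sum>\<gamma>\<in>UNIV. ?H (?z s) $ \<beta> $ \<gamma> * cnj ((radial_coeff ?\<theta>' (?z s) v *v f (?z s)) $ \<gamma>)
             + gram_deriv \<phi> (?z s) v $ \<beta> $ \<gamma> * cnj (f (?z s) $ \<gamma>))) (at s within {0..1})"
        unfolding Y_def matrix_vector_mult_def[of "?H _"] vec_lambda_beta
        by (intro has_vector_derivative_sum has_vector_derivative_mult dH df)
      moreover have "(\<Sum>\<gamma>\<in>UNIV. ?H (?z s) $ \<beta> $ \<gamma> * cnj ((radial_coeff ?\<theta>' (?z s) v *v f (?z s)) $ \<gamma>)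
             + gram_deriv \<phi> (?z s) v $ \<beta> $ \<gamma> * cnj (f (?z s) $ \<gamma>)) = (?A s *v Y (?z s)) $ \<beta>"
      proof -
        let ?B = "?A s" and ?X = "?H (?z s)"
        let ?g = "\<lambda>\<gamma>. cnj (f (?z s) $ \<gamma>)"
        have A': "radial_coeff ?\<theta>' (?z s) v $ \<gamma> $ \<delta> = - ?B $ \<delta> $ \<gamma>" for \<gamma> \<delta>
          by (simp add: radial_coeff_def sum_negf)
        have "cnj ((radial_coeff ?\<theta>' (?z s) v *v f (?z s)) $ \<gamma>) = - (\<Sum>\<delta>\<in>UNIV. cnj (?B $ \<delta> $ \<gamma>) * ?g \<delta>)" for \<gamma>
          by (simp add: matrix_vector_mult_def A' sum_negf)
        then have 1: "(\<Sum>\<gamma>\<in>UNIV. ?X $ \<beta> $ \<gamma> * cnj ((radial_coeff ?\<theta>' (?z s) v *v f (?z s)) $ \<gamma>))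
            = - (\<Sum>\<gamma>\<in>UNIV. \<Sum>\<delta>\<in>UNIV. ?X $ \<beta> $ \<gamma> * cnj (?B $ \<delta> $ \<gamma>) * ?g \<delta>)"
          by (simp add: sum_negf sum_distrib_left mult.assoc)
        have G: "gram_deriv \<phi> (?z s) v $ \<beta> $ \<gamma> = (\<Sum>\<delta>\<in>UNIV. ?B $ \<beta> $ \<delta> * ?X $ \<delta> $ \<gamma>) + (\<Sum>\<delta>\<in>UNIV. cnj (?B $ \<gamma> $ \<delta>) * ?X $ \<beta> $ \<delta>)" for \<gamma>
          unfolding gram_deriv_split[OF U inU(1)[OF s]] gram_p_connection[OF U inU(1)[OF s]]
          by (simp add: matrix_matrix_mult_def gram_hermitian[OF U inU(1)[OF s], of \<beta>])
        have "(\<Sum>\<gamma>\<in>UNIV. gram_deriv \<phi> (?z s) v $ \<beta> $ \<gamma> * ?g \<gamma>)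
          = (\<Sum>\<gamma>\<in>UNIV. \<Sum>\<delta>\<in>UNIV. ?B $ \<beta> $ \<delta> * ?X $ \<delta> $ \<gamma> * ?g \<gamma>) + (\<Sum>\<gamma>\<in>UNIV. \<Sum>\<delta>\<in>UNIV. ?X $ \<beta> $ \<delta> * cnj (?B $ \<gamma> $ \<delta>) * ?g \<gamma>)"
          unfolding G by (simp only: distrib_right sum_distrib_right sum.distrib) (simp add: mult_ac)
        also have "(\<Sum>\<gamma>\<in>UNIV. \<Sum>\<delta>\<in>UNIV. ?B $ \<beta> $ \<delta> * ?X $ \<delta> $ \<gamma> * ?g \<gamma>) = (?B *v Y (?z s)) $ \<beta>"
          by (subst sum.swap) (simp add: Y_def matrix_vector_mult_def sum_distrib_left mult.assoc)
        also have "(\<Sum>\<gamma>\<in>UNIV. \<Sum>\<delta>\<in>UNIV. ?X $ \<beta> $ \<delta> * cnj (?B $ \<gamma> $ \<delta>) * ?g \<gamma>)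
            = (\<Sum>\<gamma>\<in>UNIV. \<Sum>\<delta>\<in>UNIV. ?X $ \<beta> $ \<gamma> * cnj (?B $ \<delta> $ \<gamma>) * ?g \<delta>)"
          by (rule sum.swap)
        finally show ?thesis unfolding sum.distrib 1 by simp
      qed
      ultimately show ?thesis by simp
    qed
    define y where "y s = (\<chi> \<beta>. k (?z s) $ \<beta> - Y (?z s) $ \<beta>)" for s
    have yd: "(y has_vector_derivative (?A s *v y s)) (at s within {0..1})" if s: "s \<in> {0..1}" for s
    proof -
      have "((\<lambda>s. y s $ \<beta>) has_vector_derivative (?A s *v y s) $ \<beta>) (at s within {0..1})" for \<beta>
      proof -
        have "((\<lambda>s. y s $ \<beta>) has_vector_derivative (?A s *v k (?z s)) $ \<beta> - (?A s *v Y (?z s)) $ \<beta>) (at s within {0..1})"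
          unfolding y_def vec_lambda_beta by (intro has_vector_derivative_diff k(3)[OF v s] Yd[OF s])
        moreover have "(?A s *v k (?z s)) $ \<beta> - (?A s *v Y (?z s)) $ \<beta> = (?A s *v y s) $ \<beta>"
          by (simp add: y_def matrix_vector_mult_def sum_subtractf right_diff_distrib)
        ultimately show ?thesis by simp
      qed
      note yc = this
      show ?thesis
        unfolding has_vector_derivative_def
      proof (subst has_derivative_componentwise_within, rule ballI)
        fix b :: "complex^'r" assume "b \<in> Basis"
        then obtain i u where b: "b = axis i u" by (auto simp: Basis_vec_def)
        show "((\<lambda>s. y s \<bullet> b) has_derivative (\<lambda>t. (t *\<^sub>R (?A s *v y s)) \<bullet> b)) (at s within {0..1})"
          unfolding b inner_axis vector_scaleR_component
          by (rule has_derivative_inner_left) (use yc[of i] in \<open>simp add: has_vector_derivative_def\<close>)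
      qed
    qed
    \<comment> \<open>the coefficients are bounded on the segment, so the difference y obeys a linear differential
      inequality\<close>
    obtain C where C: "\<And>s. s \<in> {0..1} \<Longrightarrow> norm (?A s *v y s) \<le> C * norm (y s)"
    proof -
      have "\<exists>b. \<forall>s\<in>{0..1}. norm (?A s $ \<alpha> $ \<beta>) \<le> b" for \<alpha> \<beta>
      proof -
        have "continuous_on {0..1} (\<lambda>s. ?\<theta> j \<alpha> \<beta> (?z s))" for j
          by (rule continuous_on_compose2[OF holomorphic_vec_on_continuous[OF hol[of j \<alpha> \<beta>]]])
             (use inU(2) in \<open>auto intro!: continuous_intros\<close>)
        note c\<theta> = this
        have "continuous_on {0..1} (\<lambda>s. ?A s $ \<alpha> $ \<beta>)"
          unfolding radial_coeff_def vec_lambda_beta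
          by (intro continuous_on_sum continuous_on_mult continuous_on_const c\<theta>)
        from compact_imp_bounded[OF compact_continuous_image[OF this]] show ?thesis
          unfolding bounded_iff by auto
      qed
      then obtain b where b: "\<And>\<alpha> \<beta> s. s \<in> {0..1} \<Longrightarrow> norm (?A s $ \<alpha> $ \<beta>) \<le> b \<alpha> \<beta>" by metis
      have "norm (?A s *v x) \<le> (\<Sum>\<alpha>\<in>UNIV. \<Sum>\<beta>\<in>UNIV. b \<alpha> \<beta>) * norm x" if s: "s \<in> {0..1}" for s x
      proof -
        have "norm (?A s *v x) \<le> (\<Sum>\<alpha>\<in>UNIV. norm ((?A s *v x) $ \<alpha>))"
          by (simp add: norm_vec_def L2_set_le_sum)
        also have "\<dots> \<le> (\<Sum>\<alpha>\<in>UNIV. \<Sum>\<beta>\<in>UNIV. b \<alpha> \<beta> * norm x)"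
          unfolding matrix_vector_mult_def vec_lambda_beta
        proof (intro sum_mono sum_norm_le)
          fix \<alpha> \<beta>
          have "0 \<le> b \<alpha> \<beta>" using b[OF s] norm_ge_zero order_trans by blast
          then show "norm (?A s $ \<alpha> $ \<beta> * x $ \<beta>) \<le> b \<alpha> \<beta> * norm x"
            unfolding norm_mult by (intro mult_mono b[OF s] Finite_Cartesian_Product.norm_nth_le) auto
        qed
        finally show ?thesis by (simp add: sum_distrib_right)
      qed
      then show ?thesis using that by blast
    qed
    have "y 1 = 0"
      by (rule linear_ode_unique_zero[OF _ yd C]) (auto simp: y_def vec_eq_iff k(2))
    then show ?thesis by (simp add: y_def vec_eq_iff v_def)
  qed
  let ?\<tau> = "\<lambda>z. triv_inv E \<phi> z (f z)"
  have "holomorphic_section E (ball p R) ?\<tau>"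
    by (rule frame_section_holomorphic[OF U R(2) open_ball f(1)])
  moreover have "holomorphic_vec_on (\<lambda>z. h (triv_inv E \<phi> z (axis \<beta> 1)) (?\<tau> z)) (ball p R)" for \<beta>
  proof (rule holomorphic_vec_on_cong_open[OF k(1)[of \<beta>] open_ball])
    fix z assume z: "z \<in> ball p R"
    then have "z \<in> U" using R by auto
    then show "k z $ \<beta> = h (triv_inv E \<phi> z (axis \<beta> 1)) (?\<tau> z)"
      unfolding gram_component[OF U \<open>z \<in> U\<close>] kY[OF z] Y_def
      by (simp add: matrix_vector_mult_def mult.commute)
  qed
  ultimately have "parallel_section (ball p R) ?\<tau>"
    by (rule parallel_in_frame[OF U R(2) open_ball])
  moreover have "?\<tau> p = \<xi>" using f(2) U pU \<xi> by simp
  ultimately show ?thesis by (intro exI[of _ ?\<tau>]) simp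
qed

end

section \<open>Parallel sections over convex domains\<close>

context hermitian_bundle
begin

lemma parallel_section_cong:
  assumes "parallel_section S \<tau>" "open S" "\<And>z. z \<in> S \<Longrightarrow> \<tau> z = \<sigma> z"
  shows "parallel_section S \<sigma>"
proof -
  note p = parallel_sectionD[OF assms(1)]
  have 1: "\<sigma> z \<in> fibre E z" if "z \<in> S" for z using p(2) assms(3) that by metis
  have 2: "holomorphic_vec_on (\<lambda>z. \<phi> (\<sigma> z) $ i) (S \<inter> U)"
    "holomorphic_vec_on (\<lambda>z. h (triv_inv E \<phi> z (axis \<beta> 1)) (\<sigma> z)) (S \<inter> U)" if U: "(U, \<phi>) \<in> atlas E" for U \<phi> i \<beta>
    using assms(2,3) chart_open[OF U]
    by (auto intro: holomorphic_vec_on_cong_open[OF p(3)[OF U]] holomorphic_vec_on_cong_open[OF p(4)[OF U]])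
  show ?thesis
    unfolding parallel_section_def holomorphic_section_def using 1 2 by auto
qed

lemma parallel_section_local:
  assumes "\<And>z. z \<in> S \<Longrightarrow> \<exists>V. open V \<and> z \<in> V \<and> parallel_section V \<sigma>"
  shows "parallel_section S \<sigma>"
proof -
  have 1: "\<sigma> z \<in> fibre E z" if "z \<in> S" for z using assms[OF that] parallel_sectionD(2) by blast
  have 2: "holomorphic_vec_on (\<lambda>z. \<phi> (\<sigma> z) $ i) (S \<inter> U)"
    "holomorphic_vec_on (\<lambda>z. h (triv_inv E \<phi> z (axis \<beta> 1)) (\<sigma> z)) (S \<inter> U)" if U: "(U, \<phi>) \<in> atlas E" for U \<phi> i \<beta>
  proof -
    have V: "\<exists>V. open V \<and> z \<in> V \<and> parallel_section V \<sigma>" if "z \<in> S \<inter> U" for z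
      using assms that by simp
    show "holomorphic_vec_on (\<lambda>z. \<phi> (\<sigma> z) $ i) (S \<inter> U)"
    proof (rule holomorphic_vec_on_open_cover)
      fix z assume "z \<in> S \<inter> U"
      then obtain V where V: "open V" "z \<in> V" "parallel_section V \<sigma>" using V by metis
      have "holomorphic_vec_on (\<lambda>z. \<phi> (\<sigma> z) $ i) (S \<inter> U \<inter> V)"
        by (rule holomorphic_vec_on_subset[OF parallel_sectionD(3)[OF V(3) U]]) blast
      with V(1,2) show "\<exists>V. open V \<and> z \<in> V \<and> holomorphic_vec_on (\<lambda>z. \<phi> (\<sigma> z) $ i) (S \<inter> U \<inter> V)"
        by (intro exI conjI)
    qed
    show "holomorphic_vec_on (\<lambda>z. h (triv_inv E \<phi> z (axis \<beta> 1)) (\<sigma> z)) (S \<inter> U)"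
    proof (rule holomorphic_vec_on_open_cover)
      fix z assume "z \<in> S \<inter> U"
      then obtain V where V: "open V" "z \<in> V" "parallel_section V \<sigma>" using V by metis
      have "holomorphic_vec_on (\<lambda>z. h (triv_inv E \<phi> z (axis \<beta> 1)) (\<sigma> z)) (S \<inter> U \<inter> V)"
        by (rule holomorphic_vec_on_subset[OF parallel_sectionD(4)[OF V(3) U]]) blast
      with V(1,2) show "\<exists>V. open V \<and> z \<in> V \<and> holomorphic_vec_on (\<lambda>z. h (triv_inv E \<phi> z (axis \<beta> 1)) (\<sigma> z)) (S \<inter> U \<inter> V)"
        by (intro exI conjI)
    qed
  qed
  show ?thesis
    unfolding parallel_section_def holomorphic_section_def using 1 2 by auto
qed

text \<open>The square of the norm of \<open>\<tau>1 - \<tau>2\<close> is a sum of pairings of parallel sections; so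
  it is holomorphic and real, hence constant, and it vanishes at \<open>p\<close>.\<close>

lemma parallel_section_unique:
  assumes \<tau>1: "parallel_section S \<tau>1" and \<tau>2: "parallel_section S \<tau>2"
    and S: "open S" "convex S" "S \<subseteq> \<Omega>" and p: "p \<in> S" "\<tau>1 p = \<tau>2 p" and z: "z \<in> S"
  shows "\<tau>1 z = \<tau>2 z"
proof -
  note t1 = parallel_sectionD[OF \<tau>1] and t2 = parallel_sectionD[OF \<tau>2]
  let ?N = "\<lambda>z. h (\<tau>1 z) (\<tau>1 z) - h (\<tau>1 z) (\<tau>2 z) - h (\<tau>2 z) (\<tau>1 z) + h (\<tau>2 z) (\<tau>2 z)"
  have "?N z = ?N p"
  proof (rule holomorphic_vec_on_real_valued_constant[OF _ S(1,2) _ z p(1)])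
    show "holomorphic_vec_on ?N S"
      by (intro holomorphic_vec_on_intros parallel_pairing_holomorphic \<tau>1 \<tau>2 t1(1) t2(1) S(1,3))
    show "Im (?N w) = 0" if w: "w \<in> S" for w
    proof -
      have wO: "w \<in> \<Omega>" using w S(3) by blast
      have a: "Im (h (\<tau>1 w) (\<tau>1 w)) = 0" by (subst metric_real[OF wO t1(2)[OF w]]) simp
      have b: "Im (h (\<tau>2 w) (\<tau>2 w)) = 0" by (subst metric_real[OF wO t2(2)[OF w]]) simp
      show ?thesis using a b metric_sym[OF wO t1(2)[OF w] t2(2)[OF w]] by simp
    qed
  qed
  then have N0: "?N z = 0" using p by simp
  have zO: "z \<in> \<Omega>" using z S by blast
  obtain U \<phi> where U: "(U, \<phi>) \<in> atlas E" "z \<in> U" using chart_exists[OF zO] by blast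
  let ?m = "fscale E (- 1) (\<tau>2 z)"
  let ?d = "fadd E (\<tau>1 z) ?m"
  have f: "\<tau>1 z \<in> fibre E z" "\<tau>2 z \<in> fibre E z" "?m \<in> fibre E z" "?d \<in> fibre E z"
    using t1(2)[OF z] t2(2)[OF z] fibre_ops(2,3)[OF zO] by auto
  have "h ?d ?d = ?N z"
    by (simp add: metric_add[OF zO] metric_add_right[OF zO] metric_scale[OF zO] metric_scale_right[OF zO] f)
  then have "?d = fzero E z" using metric_pos[OF zO f(4)] N0 by fastforce
  then have "\<phi> (\<tau>1 z) + (- 1) *s \<phi> (\<tau>2 z) = 0"
    using chart_props(2,3,4)[OF U] f by metis
  then have "\<phi> (\<tau>1 z) = \<phi> (\<tau>2 z)"
    by (simp add: vec_eq_iff)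
  then show ?thesis using chart_inj[OF U f(1,2)] by blast
qed

text \<open>Let \<open>\<epsilon>\<close> be a Lebesgue number for the cover of the segment by charts. The section
  is continued over tubes of radius \<open>\<rho> = \<epsilon>/2\<close> about longer and longer parts of
  the segment, by local sections on balls of radius \<open>\<epsilon>\<close> about equally spaced points.
  The tubes are convex, so the overlap of a tube and a ball is convex and uniqueness applies there; half
  the Lebesgue number leaves room for the next tube to fit into the union of the previous tube and one
  ball.\<close>

lemma parallel_section_along_segment:
  assumes flat: "i_chern_curvature_zero E h" and D: "open D" "convex D" "D \<subseteq> \<Omega>"
    and a: "a \<in> D" "\<xi> \<in> fibre E a" and z: "z \<in> D"
  shows "\<exists>N \<tau>. open N \<and> convex N \<and> a \<in> N \<and> z \<in> N \<and> N \<subseteq> \<Omega> \<and> parallel_section N \<tau> \<and> \<tau> a = \<xi>"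
proof -
  let ?\<G> = "(\<lambda>(U, \<phi>). U) ` atlas E"
  have seg: "closed_segment a z \<subseteq> \<Omega>"
    using D a z closed_segment_subset by blast
  have cov: "closed_segment a z \<subseteq> \<Union>?\<G>" using seg chart_exists by fastforce
  obtain \<epsilon> where \<epsilon>: "\<epsilon> > 0" "\<And>x. x \<in> closed_segment a z \<Longrightarrow> \<exists>G\<in>?\<G>. ball x \<epsilon> \<subseteq> G"
    by (rule Heine_Borel_lemma[OF compact_segment cov]) (use chart_open in auto)
  define \<rho> where "\<rho> = \<epsilon> / 2"
  have \<rho>: "\<rho> > 0" "2 * \<rho> = \<epsilon>" using \<epsilon> by (auto simp: \<rho>_def)
  obtain m :: nat where m: "norm (z - a) / \<rho> < real m" using reals_Archimedean2 by blast
  have m0: "m > 0" using m \<rho>(1) by (cases m) (auto simp: divide_less_0_iff not_less)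
  define p where "p i = a + (real i / real m) *\<^sub>R (z - a)" for i
  have pseg: "p i \<in> closed_segment a z" if "i \<le> m" for i
    using that m0 by (auto simp: p_def in_segment algebra_simps intro!: exI[of _ "real i / real m"])
  have step: "dist (p i) (p (Suc i)) \<le> \<rho>" for i
  proof -
    have "p (Suc i) - p i = (1 / real m) *\<^sub>R (z - a)"
      using m0 by (simp add: p_def add_divide_distrib algebra_simps)
    then have "dist (p i) (p (Suc i)) = norm (z - a) / real m"
      by (simp add: dist_norm norm_minus_commute[of "p i"])
    moreover have "norm (z - a) / real m \<le> \<rho>" using m m0 \<rho>(1) by (simp add: field_simps)
    ultimately show ?thesis by simp
  qed
  define N where "N i = (\<Union>x\<in>closed_segment a (p i). ball x \<rho>)" for i
  have Nop: "open (N i)" for i unfolding N_def by (intro open_UN ballI open_ball)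
  have Nconv: "convex (N i)" for i
  proof -
    have "N i = (\<Union>x\<in>closed_segment a (p i). \<Union>y\<in>ball 0 \<rho>. {x + y})"
    proof (intro equalityI subsetI)
      fix y assume "y \<in> N i"
      then obtain x where x: "x \<in> closed_segment a (p i)" "y \<in> ball x \<rho>" by (auto simp: N_def)
      then have "y = x + (y - x)" "y - x \<in> ball 0 \<rho>" by (auto simp: dist_norm norm_minus_commute)
      with x(1) show "y \<in> (\<Union>x\<in>closed_segment a (p i). \<Union>y\<in>ball 0 \<rho>. {x + y})" by blast
    next
      fix y assume "y \<in> (\<Union>x\<in>closed_segment a (p i). \<Union>y\<in>ball 0 \<rho>. {x + y})"
      then obtain x w where x: "x \<in> closed_segment a (p i)" "norm w < \<rho>" "y = x + w" by auto
      then have "y \<in> ball x \<rho>" by (simp add: dist_norm)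
      with x(1) show "y \<in> N i" unfolding N_def by blast
    qed
    then show ?thesis using convex_sums[of "closed_segment a (p i)" "ball 0 \<rho>"] by simp
  qed
  have sub: "closed_segment a (p i) \<subseteq> closed_segment a z" if "i \<le> m" for i
    using pseg[OF that] by (simp add: closed_segment_subset)
  have NO: "N i \<subseteq> \<Omega>" if im: "i \<le> m" for i
  proof
    fix x assume "x \<in> N i"
    then obtain u where u: "u \<in> closed_segment a (p i)" "x \<in> ball u \<rho>" unfolding N_def by blast
    have "u \<in> closed_segment a z" using u(1) sub[OF im] by (rule subsetD[rotated])
    from \<epsilon>(2)[OF this] obtain G where G: "G \<in> ?\<G>" "ball u \<epsilon> \<subseteq> G" by (elim bexE)
    have "x \<in> G" using u(2) \<rho> G(2) by (auto simp: subset_iff)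
    moreover have "G \<subseteq> \<Omega>" using G(1) chart_subset by auto
    ultimately show "x \<in> \<Omega>" by (rule subsetD[rotated])
  qed
  have aN: "a \<in> N i" for i
    unfolding N_def by (rule UN_I[of a]) (simp_all add: \<rho>)
  have pN: "p i \<in> N i" for i
    unfolding N_def by (rule UN_I[of "p i"]) (simp_all add: \<rho>)
  have loc: "\<exists>\<tau>. parallel_section (ball (p i) \<epsilon>) \<tau> \<and> \<tau> (p i) = \<eta>" if im: "i \<le> m" and \<eta>: "\<eta> \<in> fibre E (p i)" for i \<eta>
  proof -
    obtain U \<phi> where U: "(U, \<phi>) \<in> atlas E" "ball (p i) \<epsilon> \<subseteq> U" using \<epsilon>(2)[OF pseg[OF im]] by auto
    show ?thesis by (rule local_parallel_section[OF flat U(1) \<epsilon>(1) U(2) \<eta>])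
  qed
  have p0: "p 0 = a" and pm: "p m = z" using m0 by (simp_all add: p_def)
  have "i \<le> m \<Longrightarrow> \<exists>\<tau>. parallel_section (N i) \<tau> \<and> \<tau> a = \<xi>" for i
  proof (induction i)
    case 0
    from loc[of 0 \<xi>, unfolded p0, OF le0 a(2)]
    obtain \<tau> where \<tau>: "parallel_section (ball a \<epsilon>) \<tau>" "\<tau> a = \<xi>" by metis
    have "N 0 \<subseteq> ball a \<epsilon>" using \<rho> \<epsilon>(1) by (auto simp: N_def p0)
    with \<tau> show ?case by (intro exI[of _ \<tau>] conjI parallel_section_subset[OF \<tau>(1)])
  next
    case (Suc i)
    have im: "i \<le> m" using Suc.prems by simp
    from Suc.IH[OF im] obtain \<tau> where \<tau>: "parallel_section (N i) \<tau>" "\<tau> a = \<xi>" by metis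
    from loc[OF im parallel_sectionD(2)[OF \<tau>(1) pN]]
    obtain \<tau>' where \<tau>': "parallel_section (ball (p i) \<epsilon>) \<tau>'" "\<tau>' (p i) = \<tau> (p i)" by metis
    define \<sigma> where "\<sigma> x = (if x \<in> N i then \<tau> x else \<tau>' x)" for x
    have eq: "\<tau> x = \<tau>' x" if "x \<in> N i" "x \<in> ball (p i) \<epsilon>" for x
    proof (rule parallel_section_unique[of "N i \<inter> ball (p i) \<epsilon>" \<tau> \<tau>' "p i"])
      show "parallel_section (N i \<inter> ball (p i) \<epsilon>) \<tau>" "parallel_section (N i \<inter> ball (p i) \<epsilon>) \<tau>'"
        by (rule parallel_section_subset[OF \<tau>(1)], simp) (rule parallel_section_subset[OF \<tau>'(1)], simp)
    qed (use that Nop Nconv NO[OF im] pN \<tau>'(2) \<epsilon>(1) in \<open>auto intro: convex_Int\<close>)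
    have s1: "parallel_section (N i) \<sigma>"
      by (rule parallel_section_cong[OF \<tau>(1) Nop]) (simp add: \<sigma>_def)
    have s2: "parallel_section (ball (p i) \<epsilon>) \<sigma>"
      by (rule parallel_section_cong[OF \<tau>'(1) open_ball]) (use eq in \<open>simp add: \<sigma>_def\<close>)
    have "N (Suc i) \<subseteq> N i \<union> ball (p i) \<epsilon>"
    proof
      fix x assume "x \<in> N (Suc i)"
      then obtain u where u: "u \<in> closed_segment a (p (Suc i))" "dist u x < \<rho>" by (auto simp: N_def)
      have "p i \<in> closed_segment a (p (Suc i))"
      proof -
        have "p i = (1 - real i / real (Suc i)) *\<^sub>R a + (real i / real (Suc i)) *\<^sub>R p (Suc i)"
        proof -
          have "(real i / real (Suc i)) *\<^sub>R p (Suc i) = (real i / real (Suc i)) *\<^sub>R a + (real i / real m) *\<^sub>R (z - a)"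
            by (simp add: p_def scaleR_add_right del: of_nat_Suc)
          then show ?thesis by (simp add: p_def scaleR_left_diff_distrib del: of_nat_Suc)
        qed
        then show ?thesis unfolding in_segment by (intro exI[of _ "real i / real (Suc i)"]) auto
      qed
      then have "closed_segment a (p (Suc i)) = closed_segment a (p i) \<union> closed_segment (p i) (p (Suc i))"
        by (rule Un_closed_segment[symmetric])
      with u(1) consider "u \<in> closed_segment a (p i)" | "u \<in> closed_segment (p i) (p (Suc i))" by blast
      then show "x \<in> N i \<union> ball (p i) \<epsilon>"
      proof cases
        case 1
        then show ?thesis using u(2) by (auto simp: N_def)
      next
        case 2
        then have "dist (p i) u \<le> \<rho>"
          using segment_bound(1)[OF 2] step[of i] by (simp add: dist_norm norm_minus_commute)
        then show ?thesis using u(2) dist_triangle[of "p i" x u] \<rho>(2) by simp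
      qed
    qed
    moreover have "parallel_section (N i \<union> ball (p i) \<epsilon>) \<sigma>"
    proof (rule parallel_section_local)
      fix x assume "x \<in> N i \<union> ball (p i) \<epsilon>"
      then show "\<exists>V. open V \<and> x \<in> V \<and> parallel_section V \<sigma>"
        using s1 s2 Nop[of i] open_ball[of "p i" \<epsilon>] by (metis Un_iff)
    qed
    ultimately have "parallel_section (N (Suc i)) \<sigma>" by (rule parallel_section_subset[rotated])
    moreover have "\<sigma> a = \<xi>" using aN \<tau>(2) by (simp add: \<sigma>_def)
    ultimately show ?case by (intro exI[of _ \<sigma>] conjI)
  qed
  from this[OF order_refl] obtain \<tau> where "parallel_section (N m) \<tau>" "\<tau> a = \<xi>" by metis
  moreover have "z \<in> N m" using pN[of m] pm by simp
  ultimately show ?thesis using Nop[of m] Nconv[of m] NO[of m] aN[of m]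
    by (intro exI[of _ "N m"] exI[of _ \<tau>] conjI) auto
qed

text \<open>At each point \<open>x\<close> take the value of the continuation \<open>\<tau> x\<close> along the
  segment from \<open>a\<close> to \<open>x\<close>. Near \<open>z\<close> this agrees with the single
  section \<open>\<tau> z\<close>: the intersection of two of the convex neighbourhoods contains
  \<open>a\<close>, where all continuations have the value \<open>\<xi>\<close>.\<close>

theorem parallel_section_convex:
  assumes flat: "i_chern_curvature_zero E h" and D: "open D" "convex D" "D \<subseteq> \<Omega>"
    and a: "a \<in> D" "\<xi> \<in> fibre E a"
  shows "\<exists>\<tau>. parallel_section D \<tau> \<and> \<tau> a = \<xi>"
proof -
  have "\<forall>z\<in>D. \<exists>N \<tau>. open N \<and> convex N \<and> a \<in> N \<and> z \<in> N \<and> N \<subseteq> \<Omega> \<and> parallel_section N \<tau> \<and> \<tau> a = \<xi>"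
    by (rule ballI, rule parallel_section_along_segment[OF flat D a])
  from bchoice[OF this] obtain N where
    "\<forall>z\<in>D. \<exists>\<tau>. open (N z) \<and> convex (N z) \<and> a \<in> N z \<and> z \<in> N z \<and> N z \<subseteq> \<Omega> \<and>
      parallel_section (N z) \<tau> \<and> \<tau> a = \<xi>" by (rule exE)
  from bchoice[OF this] obtain \<tau> where
    N': "\<forall>z\<in>D. open (N z) \<and> convex (N z) \<and> a \<in> N z \<and> z \<in> N z \<and> N z \<subseteq> \<Omega> \<and>
      parallel_section (N z) (\<tau> z) \<and> \<tau> z a = \<xi>" by (rule exE)
  have N: "open (N z)" "convex (N z)" "a \<in> N z" "z \<in> N z" "N z \<subseteq> \<Omega>"
    "parallel_section (N z) (\<tau> z)" "\<tau> z a = \<xi>" if "z \<in> D" for z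
    using bspec[OF N' that] by simp_all
  have eq: "\<tau> z x = \<tau> x x" if z: "z \<in> D" "x \<in> D" "x \<in> N z" for z x
  proof (rule parallel_section_unique[of "N z \<inter> N x" "\<tau> z" "\<tau> x" a])
    show "parallel_section (N z \<inter> N x) (\<tau> z)"
      by (rule parallel_section_subset[OF N(6)[OF z(1)]]) simp
    show "parallel_section (N z \<inter> N x) (\<tau> x)"
      by (rule parallel_section_subset[OF N(6)[OF z(2)]]) simp
    show "open (N z \<inter> N x)" "convex (N z \<inter> N x)"
      by (intro open_Int convex_Int N z)+
    show "N z \<inter> N x \<subseteq> \<Omega>" using N(5)[OF z(1)] by blast
    show "a \<in> N z \<inter> N x" "x \<in> N z \<inter> N x" using N(3,4) z by simp_all
    show "\<tau> z a = \<tau> x a" by (simp only: N(7) z)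
  qed
  have "parallel_section D (\<lambda>x. \<tau> x x)"
  proof (rule parallel_section_local)
    fix z assume z: "z \<in> D"
    have "parallel_section (N z \<inter> D) (\<tau> z)"
      by (rule parallel_section_subset[OF N(6)[OF z]]) simp
    then have "parallel_section (N z \<inter> D) (\<lambda>x. \<tau> x x)"
    proof (rule parallel_section_cong)
      show "open (N z \<inter> D)" by (intro open_Int N(1)[OF z] D(1))
      show "\<tau> z x = \<tau> x x" if "x \<in> N z \<inter> D" for x using eq[OF z] that by simp
    qed
    then show "\<exists>V. open V \<and> z \<in> V \<and> parallel_section V (\<lambda>x. \<tau> x x)"
      using N(1,4)[OF z] D(1) z by (intro exI[of _ "N z \<inter> D"]) (simp add: open_Int)
  qed
  moreover have "\<tau> a a = \<xi>" using N[OF a(1)] by simp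
  ultimately show ?thesis by (intro exI[of _ "\<lambda>x. \<tau> x x"] conjI)
qed

end

context hermitian_bundle_ordered
begin

theorem extension_index_eq_1_of_flat:
  assumes flat: "i_chern_curvature_zero E h"
    and rs: "0 < r" "0 < s" and A: "unitary A" and P: "(+) a ` polyball q r s A \<subseteq> \<Omega>"
    and \<xi>: "\<xi> \<in> fibre E a" "\<xi> \<noteq> fzero E a"
  shows "extension_index E h q a r s A \<xi> = 1"
proof -
  note Pp = translated_polyball[OF rs A, of a q]
  from parallel_section_convex[OF flat Pp(1,2) P Pp(3) \<xi>(1)]
  obtain \<tau> where "parallel_section ((+) a ` polyball q r s A) \<tau>" "\<tau> a = \<xi>" by metis
  then show ?thesis by (rule extension_index_eq_1_of_parallel[OF rs A P _ _ \<xi>(2)])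
qed

end

section \<open>Second moments of the polyball\<close>

lemma integrable_avg_continuous:
  fixes f :: "complex^('n::{finite,linorder}) \<Rightarrow> 'b::{banach, second_countable_topology}"
  assumes f: "continuous_on UNIV f"
  shows "integrable (avg q) f"
proof -
  interpret finite_measure "avg q :: (complex,'n) vec measure" by (rule finite_measure_avg)
  have "compact (closure (unit_polyball q :: (complex,'n) vec set))"
    using unit_polyball_bounded by (simp add: compact_closure)
  then have "bounded (f ` closure (unit_polyball q))"
    by (intro compact_imp_bounded compact_continuous_image continuous_on_subset[OF f]) auto
  then obtain B where B: "\<And>x. x \<in> closure (unit_polyball q) \<Longrightarrow> norm (f x) \<le> B"
    unfolding bounded_iff by auto
  show ?thesis
  proof (rule integrable_const_bound[where B=B])
    show "AE x in avg q. norm (f x) \<le> B"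
      using AE_avg[of q] by eventually_elim (use B closure_subset in blast)
    show "f \<in> borel_measurable (avg q)"
      using f by (simp add: borel_measurable_continuous_onI measurable_cong_sets[OF sets_avg refl])
  qed
qed

lemma integral_avg_invariant:
  fixes f :: "complex^('n::{finite,linorder}) \<Rightarrow> 'b::{banach, second_countable_topology}"
    and T :: "complex^('n::{finite,linorder}) \<Rightarrow> complex^('n::{finite,linorder})"
  assumes f: "continuous_on UNIV f" and T: "linear T" "bij T" "T ` unit_polyball q = unit_polyball q"
  shows "integral\<^sup>L (avg q) (\<lambda>w. f (T w)) = integral\<^sup>L (avg q) f"
proof -
  have fm: "f \<in> borel_measurable borel" using f by (rule borel_measurable_continuous_onI)
  have "T \<in> borel_measurable borel"
    using T(1) by (intro borel_measurable_continuous_onI linear_continuous_on) (simp add: linear_conv_bounded_linear)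
  then have "T \<in> avg q \<rightarrow>\<^sub>M borel"
    by (subst measurable_cong_sets[OF sets_avg refl])
  from integral_distr[OF this fm] show ?thesis
    unfolding avg_invariant[OF T] by (rule sym)
qed

lemma integral_avg_rotation:
  fixes f :: "complex^('n::{finite,linorder}) \<Rightarrow> 'b::{banach, second_countable_topology}"
  assumes f: "continuous_on UNIV f" and c: "norm c = 1"
  shows "integral\<^sup>L (avg q) (\<lambda>w. f (c *s w)) = integral\<^sup>L (avg q) f"
proof (rule integral_avg_invariant[OF f linear_vector_scalar_mult])
  show "bij ((*s) c :: (complex,'n) vec \<Rightarrow> _)" by (rule bij_vector_scalar_mult) (use c in auto)
qed (rule unit_polyball_rotation_image[OF c])

text \<open>Changing the sign of one coordinate preserves the polyball and negates the integrand.\<close>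

lemma off_diagonal_moment:
  fixes l m :: "'n::{finite,linorder}"
  assumes "l \<noteq> m"
  shows "integral\<^sup>L (avg q) (\<lambda>w. w $ l * cnj (w $ m)) = 0"
proof -
  define F :: "(complex,'n) vec \<Rightarrow> (complex,'n) vec" where "F w = (\<chi> i. if i = l then - w $ i else w $ i)" for w
  have FF: "F (F w) = w" for w by (simp add: F_def vec_eq_iff)
  have F: "linear F" by (rule linearI) (auto simp: F_def vec_eq_iff)
  have b: "bij F" by (rule o_bij[of F]) (auto simp: FF fun_eq_iff)
  have sub: "F ` unit_polyball q \<subseteq> unit_polyball q"
  proof (rule image_subsetI)
    fix w :: "(complex,'n) vec" assume "w \<in> unit_polyball q"
    then show "F w \<in> unit_polyball q" by (rule unit_polyball_cong) (simp add: F_def)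
  qed
  have img: "F ` unit_polyball q = unit_polyball q"
  proof (rule antisym[OF sub], rule subsetI)
    fix w :: "(complex,'n) vec" assume "w \<in> unit_polyball q"
    then have "F w \<in> unit_polyball q" by (rule subsetD[OF sub, OF imageI])
    then show "w \<in> F ` unit_polyball q" by (rule image_eqI[where x="F w", rotated]) (simp add: FF)
  qed
  have "continuous_on UNIV (\<lambda>w::(complex,'n) vec. w $ l * cnj (w $ m))"
    by (intro continuous_intros)
  from integral_avg_invariant[OF this F b img]
  have "integral\<^sup>L (avg q) (\<lambda>w. - (w $ l * cnj (w $ m))) = integral\<^sup>L (avg q) (\<lambda>w. w $ l * cnj (w $ m))"
    using assms by (simp add: F_def)
  then have "- integral\<^sup>L (avg q) (\<lambda>w. w $ l * cnj (w $ m)) = integral\<^sup>L (avg q) (\<lambda>w. w $ l * cnj (w $ m))"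
    by (simp only: Bochner_Integration.integral_minus)
  moreover have "x = 0" if "- x = x" for x :: complex
    using that by (simp add: complex_eq_iff)
  ultimately show ?thesis by blast
qed

definition moment :: "nat \<Rightarrow> 'n::{finite,linorder} \<Rightarrow> real" where
  "moment q l = integral\<^sup>L (avg q) (\<lambda>w. (norm (w $ l))\<^sup>2)"

text \<open>Otherwise the coordinate would vanish almost everywhere on the polyball, but the set where it does not
  is open and contains \<open>e\<^sub>l/2\<close>.\<close>

lemma moment_pos: "0 < moment q (l :: 'n::{finite,linorder})"
proof -
  let ?f = "\<lambda>w :: (complex,'n) vec. (norm (w $ l))\<^sup>2"
  have int: "integrable (avg q) ?f"
    by (rule integrable_avg_continuous) (intro continuous_intros)
  have "moment q l \<noteq> 0"
  proof
    assume "moment q l = 0"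
    then have "AE w in avg q. ?f w = 0"
      unfolding moment_def using integral_nonneg_eq_0_iff_AE[OF int] by simp
    then have AE0: "AE w in avg q. w $ l = 0" by simp
    let ?V = "unit_polyball q \<inter> {w :: (complex,'n) vec. w $ l \<noteq> 0}"
    have op: "open ?V"
      by (intro open_Int unit_polyball_open open_Collect_neq continuous_intros)
    have "(1/2) *s axis l 1 \<in> ?V"
    proof -
      have "L2_set (\<lambda>i. norm (((1/2) *s axis l 1 :: (complex,'n) vec) $ i)) X \<le> 1/2" for X
      proof -
        have "L2_set (\<lambda>i. norm (((1/2) *s axis l 1 :: (complex,'n) vec) $ i)) X
            \<le> (\<Sum>i\<in>X. norm (((1/2) *s axis l 1 :: (complex,'n) vec) $ i))" by (rule L2_set_le_sum) simp
        also have "\<dots> \<le> (\<Sum>i\<in>UNIV. norm (((1/2) *s axis l 1 :: (complex,'n) vec) $ i))"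
          by (rule sum_mono2) auto
        also have "\<dots> = 1/2" by (subst sum.remove[of _ l]) (auto simp: axis_def)
        finally show ?thesis .
      qed
      from this[of "first_coords q"] this[of "- first_coords q"] show ?thesis
        by (auto simp: unit_polyball_def axis_def)
    qed
    then have ne: "?V \<noteq> {}" by blast
    have bd: "bounded ?V" using unit_polyball_bounded by (rule bounded_subset) auto
    have P: "emeasure lborel (unit_polyball q :: (complex,'n) vec set) \<noteq> 0" "emeasure lborel (unit_polyball q :: (complex,'n) vec set) \<noteq> \<infinity>"
      using zero_in_unit_polyball by (intro emeasure_open_bounded unit_polyball_open unit_polyball_bounded; blast)+
    have "emeasure (avg q) ?V = 0"
    proof -
      have "AE w in avg q. w \<notin> ?V" using AE0 by eventually_elim auto
      from emeasure_eq_0_AE[OF this] show ?thesis by (simp add: avg_def Int_def)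
    qed
    then have "emeasure lborel ?V / emeasure lborel (unit_polyball q :: (complex,'n) vec set) = 0"
      using op by (simp add: avg_def borel_open unit_polyball_open)
    then show False
      using emeasure_open_bounded(1)[OF op bd ne] P by simp
  qed
  moreover have "0 \<le> moment q l" unfolding moment_def by (rule integral_nonneg_AE) simp
  ultimately show ?thesis by simp
qed

definition sesquilinear :: "(complex^'n \<Rightarrow> complex^'n \<Rightarrow> complex) \<Rightarrow> bool" where
  "sesquilinear b \<longleftrightarrow> (\<forall>x y w. b (x + y) w = b x w + b y w) \<and> (\<forall>c x w. b (c *s x) w = c * b x w) \<and>
     (\<forall>x y w. b w (x + y) = b w x + b w y) \<and> (\<forall>c x w. b w (c *s x) = cnj c * b w x)"

lemma sesquilinear_expansion:
  assumes "sesquilinear b"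
  shows "b x y = (\<Sum>l\<in>UNIV. \<Sum>m\<in>UNIV. x $ l * cnj (y $ m) * b (axis l 1) (axis m 1))"
proof -
  have 1: "b x y = (\<Sum>l\<in>UNIV. x $ l * b (axis l 1) y)" for x y
    by (rule complex_linear_functional_sum) (use assms in \<open>auto simp: sesquilinear_def\<close>)
  have 2: "b x y = (\<Sum>m\<in>UNIV. cnj (y $ m) * b x (axis m 1))" for x y
  proof -
    have "cnj (b x y) = (\<Sum>m\<in>UNIV. y $ m * cnj (b x (axis m 1)))"
      by (rule complex_linear_functional_sum) (use assms in \<open>auto simp: sesquilinear_def\<close>)
    from arg_cong[OF this, of cnj] show ?thesis by simp
  qed
  have "b x y = (\<Sum>l\<in>UNIV. x $ l * (\<Sum>m\<in>UNIV. cnj (y $ m) * b (axis l 1) (axis m 1)))"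
    unfolding 1[of x y] by (intro sum.cong refl arg_cong2[of _ _ _ _ "(*)"] 2)
  then show ?thesis by (simp add: sum_distrib_left mult.assoc)
qed

text \<open>Only the diagonal second moments survive, so the mean of a sesquilinear form over a polyball is a
  weighted trace.\<close>

lemma integral_sesquilinear_avg:
  fixes b :: "complex^('n::{finite,linorder}) \<Rightarrow> complex^('n::{finite,linorder}) \<Rightarrow> complex"
  assumes "sesquilinear b"
  shows "integral\<^sup>L (avg q) (\<lambda>w. b w w) = (\<Sum>l\<in>UNIV. of_real (moment q l) * b (axis l 1) (axis l 1))"
proof -
  have int: "integrable (avg q) (\<lambda>w::(complex,'n) vec. w $ l * cnj (w $ m))" for l m
    by (rule integrable_avg_continuous) (intro continuous_intros)
  have diag: "integral\<^sup>L (avg q) (\<lambda>w::(complex,'n) vec. w $ l * cnj (w $ l)) = of_real (moment q l)" for l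
    unfolding moment_def by (simp only: complex_norm_square[symmetric] integral_complex_of_real)
  have "integral\<^sup>L (avg q) (\<lambda>w. b w w)
     = integral\<^sup>L (avg q) (\<lambda>w. \<Sum>l\<in>UNIV. \<Sum>m\<in>UNIV. w $ l * cnj (w $ m) * b (axis l 1) (axis m 1))"
    by (subst sesquilinear_expansion[OF assms]) (rule refl)
  also have "\<dots> = (\<Sum>l\<in>UNIV. \<Sum>m\<in>UNIV. integral\<^sup>L (avg q) (\<lambda>w. w $ l * cnj (w $ m)) * b (axis l 1) (axis m 1))"
    using int by (subst Bochner_Integration.integral_sum; (intro integrable_sum)?; simp?)+
  also have "\<dots> = (\<Sum>l\<in>UNIV. \<Sum>m\<in>UNIV. if m = l then of_real (moment q l) * b (axis l 1) (axis l 1) else 0)"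
    by (intro sum.cong refl) (auto simp: diag off_diagonal_moment)
  finally show ?thesis by simp
qed

section \<open>Unitary averages determine a sesquilinear form\<close>

definition frame_matrix :: "('n \<Rightarrow> complex^'n) \<Rightarrow> complex^'n^'n" where
  "frame_matrix e = (\<chi> i l. e l $ i)"

definition orthonormal_frame :: "('n::finite \<Rightarrow> complex^'n) \<Rightarrow> bool" where
  "orthonormal_frame e \<longleftrightarrow> (\<forall>l m. (\<Sum>i\<in>UNIV. e l $ i * cnj (e m $ i)) = (if l = m then 1 else 0))"

lemma frame_matrix_axis: "frame_matrix e *v axis l 1 = e l"
  unfolding frame_matrix_def matrix_vector_mult_def vec_eq_iff vec_lambda_beta
  by (auto simp: axis_def if_distrib[of "\<lambda>x. _ * x"] cong: if_cong)

lemma frame_matrix_unitary: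
  assumes "orthonormal_frame e" shows "unitary (frame_matrix e)"
proof -
  have "map_matrix cnj (transpose (frame_matrix e)) ** frame_matrix e = mat 1"
    using assms
    by (auto simp: vec_eq_iff matrix_matrix_mult_def frame_matrix_def transpose_def mat_def orthonormal_frame_def
        map_matrix_def mult.commute[of "cnj _"])
  then show ?thesis unfolding unitary_def using matrix_left_right_inverse by blast
qed

text \<open>For a unitary frame \<open>e\<close>, the mean is \<open>r\<^sup>2 X + s\<^sup>2 Y\<close>, where
  \<open>X\<close> and \<open>Y\<close> are the weighted traces over the two groups of frame vectors;
  being zero for all \<open>r, s\<close>, it forces \<open>X = Y = 0\<close>. Exchanging one vector of the
  first group with one of the second changes \<open>X\<close> in a single term, so \<open>b\<close> takes
  the same value on these two vectors, hence, both groups being non-empty, on all vectors of the frame;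
  this common value is 0 because the weights are positive. Polarisation with the vectors \<open>(e\<^sub>j
  \<plusminus> \<omega> e\<^sub>k)/\<surd>2\<close> removes the off-diagonal values.\<close>

lemma unitary_averages_zero:
  fixes b :: "complex^('n::{finite,linorder}) \<Rightarrow> complex^('n::{finite,linorder}) \<Rightarrow> complex"
  assumes b: "sesquilinear b" and q: "1 \<le> q" "q \<le> CARD('n) - 1" "CARD('n) \<ge> 2"
    and zero: "\<And>r s A. 0 < r \<Longrightarrow> 0 < s \<Longrightarrow> unitary A \<Longrightarrow>
        integral\<^sup>L (avg q) (\<lambda>w. b (polyball_map q r s A w) (polyball_map q r s A w)) = 0"
  shows "b x y = 0"
proof -
  let ?F = "first_coords q :: 'n set"
  define c where "c l = complex_of_real (moment q l)" for l :: 'n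
  have c: "c l \<noteq> 0" for l using moment_pos[of q l] by (simp add: c_def)
  have wsum: "(\<Sum>l\<in>UNIV. of_real ((if l \<in> ?F then r else s)\<^sup>2) * (c l * b (e l) (e l))) = 0"
    if e: "orthonormal_frame e" and rs: "0 < r" "0 < s" for e r s
  proof -
    let ?T = "polyball_map q r s (frame_matrix e)"
    have T: "?T (axis l 1) = of_real (if l \<in> ?F then r else s) *s e l" for l
    proof -
      have "(\<chi> i. of_real (if i \<in> ?F then r else s) * axis l (1::complex) $ i) = of_real (if l \<in> ?F then r else s) *s axis l 1"
        by (auto simp: vec_eq_iff axis_def)
      then show ?thesis by (simp add: polyball_map_def vector_scalar_commute frame_matrix_axis)
    qed
    have "sesquilinear (\<lambda>x y. b (?T x) (?T y))"
      using b unfolding sesquilinear_def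
      by (simp add: linear_add[OF polyball_map_linear] polyball_map_scale)
    from integral_sesquilinear_avg[OF this] zero[OF rs frame_matrix_unitary[OF e]]
    have "(\<Sum>l\<in>UNIV. c l * b (?T (axis l 1)) (?T (axis l 1))) = 0" by (simp add: c_def)
    moreover have "c l * b (?T (axis l 1)) (?T (axis l 1)) = of_real ((if l \<in> ?F then r else s)\<^sup>2) * (c l * b (e l) (e l))" for l
      using b unfolding T sesquilinear_def by (simp add: power2_eq_square)
    ultimately show ?thesis by simp
  qed
  have sums: "(\<Sum>l\<in>?F. c l * b (e l) (e l)) = 0 \<and> (\<Sum>l\<in>-?F. c l * b (e l) (e l)) = 0" if e: "orthonormal_frame e" for e
  proof -
    let ?X = "\<Sum>l\<in>?F. c l * b (e l) (e l)" and ?Y = "\<Sum>l\<in>-?F. c l * b (e l) (e l)"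
    have split: "of_real (r\<^sup>2) * ?X + of_real (s\<^sup>2) * ?Y = 0" if rs: "0 < r" "0 < s" for r s
    proof -
      have "(\<Sum>l\<in>UNIV. of_real ((if l \<in> ?F then r else s)\<^sup>2) * (c l * b (e l) (e l)))
        = (\<Sum>l\<in>?F. of_real ((if l \<in> ?F then r else s)\<^sup>2) * (c l * b (e l) (e l)))
          + (\<Sum>l\<in>-?F. of_real ((if l \<in> ?F then r else s)\<^sup>2) * (c l * b (e l) (e l)))"
        by (subst sum.union_disjoint[symmetric]) (auto simp: Compl_partition)
      then show ?thesis using wsum[OF e rs] by (simp add: sum_distrib_left)
    qed
    have arith: "x = 0 \<and> y = 0" if "x + y = 0" "4 * x + y = 0" for x y :: complex
      using that by (simp add: complex_eq_iff)
    show ?thesis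
      by (rule arith) (use split[of 1 1] split[of 2 1] in \<open>simp_all add: power2_eq_square\<close>)
  qed
  \<comment> \<open>one index in each group: here the bounds on q are used\<close>
  define l0 where "l0 = Min (UNIV :: 'n set)"
  have l0: "l0 \<in> ?F"
  proof -
    have "l0 \<le> j" for j unfolding l0_def by (rule Min_le) auto
    then have "{j. j < l0} = {}" by (simp add: not_less)
    then show ?thesis using q(1) by (simp add: first_coords_def)
  qed
  define m0 where "m0 = Max (UNIV :: 'n set)"
  have m0: "m0 \<notin> ?F"
  proof -
    have "{j. j < m0} = UNIV - {m0}"
      using Max_ge[of "UNIV :: 'n set"] unfolding m0_def by (auto simp: less_le)
    then have "card {j. j < m0} = CARD('n) - 1" by simp
    then show ?thesis using q(2) by (simp add: first_coords_def)
  qed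
  have swap: "orthonormal_frame (\<lambda>l. e (transpose_ij l))" if "orthonormal_frame e" "inj transpose_ij" for e :: "'n \<Rightarrow> complex^('n::{finite,linorder})" and transpose_ij
    using that unfolding orthonormal_frame_def by (auto simp: inj_eq)
  have eqlm: "b (e l) (e l) = b (e m) (e m)" if e: "orthonormal_frame e" and l: "l \<in> ?F" and m: "m \<notin> ?F" for e l m
  proof -
    define e' where "e' = e \<circ> (id(l := m, m := l))"
    have lm: "l \<noteq> m" using l m by auto
    have "inj (id(l := m, m := l))" using lm by (auto simp: inj_def)
    then have e': "orthonormal_frame e'" unfolding e'_def o_def by (rule swap[OF e])
    have "(\<Sum>k\<in>?F. c k * b (e k) (e k)) = c l * b (e l) (e l) + (\<Sum>k\<in>?F - {l}. c k * b (e k) (e k))"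
      by (rule sum.remove) (use l in auto)
    moreover have "(\<Sum>k\<in>?F. c k * b (e' k) (e' k)) = c l * b (e m) (e m) + (\<Sum>k\<in>?F - {l}. c k * b (e' k) (e' k))"
      by (subst sum.remove[of _ l]) (use l lm in \<open>auto simp: e'_def\<close>)
    moreover have "(\<Sum>k\<in>?F - {l}. c k * b (e' k) (e' k)) = (\<Sum>k\<in>?F - {l}. c k * b (e k) (e k))"
      by (intro sum.cong refl) (use m in \<open>auto simp: e'_def\<close>)
    ultimately have "c l * b (e l) (e l) = c l * b (e m) (e m)"
      using sums[OF e] sums[OF e'] by (metis add_right_cancel)
    then show ?thesis using c by simp
  qed
  have diag: "b (e l) (e l) = 0" if e: "orthonormal_frame e" for e l
  proof -
    have F: "b (e k) (e k) = b (e m0) (e m0)" if "k \<in> ?F" for k using eqlm[OF e that m0] .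
    have nF: "b (e k) (e k) = b (e m0) (e m0)" if "k \<notin> ?F" for k using eqlm[OF e l0 that] eqlm[OF e l0 m0] by simp
    have "(\<Sum>k\<in>?F. c k * b (e k) (e k)) = (\<Sum>k\<in>?F. c k) * b (e m0) (e m0)"
      by (simp add: F sum_distrib_right)
    moreover have "(\<Sum>k\<in>?F. c k) \<noteq> 0"
    proof -
      have "(\<Sum>k\<in>?F. c k) = of_real (\<Sum>k\<in>?F. moment q k)" unfolding c_def by (simp only: of_real_sum)
      moreover have "(\<Sum>k\<in>?F. moment q k) > 0" by (rule sum_pos) (use l0 moment_pos in auto)
      ultimately show ?thesis by (simp del: of_real_sum)
    qed
    ultimately have "b (e m0) (e m0) = 0" using sums[OF e] by simp
    then show ?thesis using F nF by (cases "l \<in> ?F") auto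
  qed
  have on: "orthonormal_frame (\<lambda>l. axis l 1 :: complex^('n::{finite,linorder}))"
    unfolding orthonormal_frame_def
  proof (intro allI)
    fix l m :: 'n
    have "axis l (1::complex) $ i * cnj (axis m 1 $ i) = (if i = l then (if l = m then 1 else 0) else 0)" for i
      by (auto simp: axis_def)
    then show "(\<Sum>i\<in>UNIV. axis l (1::complex) $ i * cnj (axis m 1 $ i)) = (if l = m then 1 else 0)" by simp
  qed
  have jj: "b (axis j 1) (axis j 1) = 0" for j using diag[OF on] .
  have jk: "b (axis j 1) (axis k 1) = 0" for j k
  proof (cases "j = k")
    case False
    have rot: "cnj \<omega> * b (axis j 1) (axis k 1) + \<omega> * b (axis k 1) (axis j 1) = 0" if \<omega>: "norm \<omega> = 1" for \<omega>
    proof -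
      define t where "t = complex_of_real (1 / sqrt 2)"
      have tt: "t * cnj t = 1/2" by (simp add: t_def flip: of_real_mult)
      have ww: "\<omega> * cnj \<omega> = 1" using \<omega> by (simp add: complex_norm_square[symmetric])
      \<comment> \<open>the standard frame with e_j, e_k rotated by 45 degrees and a phase\<close>
      define e where "e l = (if l = j then t *s (axis j 1 + \<omega> *s axis k 1) else if l = k then t *s (axis j 1 - \<omega> *s axis k 1) else axis l 1)" for l
      have val: "e l $ i = (if l = j then (if i = j then t else if i = k then t * \<omega> else 0)
          else if l = k then (if i = j then t else if i = k then - t * \<omega> else 0) else if i = l then 1 else 0)" for l i
        using False by (auto simp: e_def axis_def)
      have vj: "e l $ j = (if l = j \<or> l = k then t else 0)" for l unfolding val using False by simp
      have vk: "e l $ k = (if l = j then t * \<omega> else if l = k then - (t * \<omega>) else 0)" for l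
        unfolding val using False by simp
      have "t * \<omega> * (cnj t * cnj \<omega>) = (t * cnj t) * (\<omega> * cnj \<omega>)" by (simp only: mult_ac)
      then have tw: "t * \<omega> * (cnj t * cnj \<omega>) = 1/2" by (simp only: tt ww mult_1_right)
      have "orthonormal_frame e"
        unfolding orthonormal_frame_def
      proof (intro allI)
        fix l m
        have "(\<Sum>i\<in>UNIV. e l $ i * cnj (e m $ i)) = e l $ j * cnj (e m $ j) + e l $ k * cnj (e m $ k) + (\<Sum>i\<in>UNIV - {j} - {k}. e l $ i * cnj (e m $ i))"
          using False by (subst sum.remove[of _ j], simp, simp, subst sum.remove[of _ k]) auto
        also have "(\<Sum>i\<in>UNIV - {j} - {k}. e l $ i * cnj (e m $ i)) = (if l = m \<and> l \<noteq> j \<and> l \<noteq> k then 1 else 0)"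
        proof (cases "l = m \<and> l \<noteq> j \<and> l \<noteq> k")
          case True
          then show ?thesis by (subst sum.remove[of _ l]) (auto simp: val)
        next
          case F: False
          have "e l $ i * cnj (e m $ i) = 0" if "i \<in> UNIV - {j} - {k}" for i
          proof -
            have v: "e l $ i = (if l \<noteq> j \<and> l \<noteq> k \<and> i = l then 1 else 0)" for l
              unfolding val using that by auto
            show ?thesis unfolding v using F by simp blast
          qed
          then have "(\<Sum>i\<in>UNIV - {j} - {k}. e l $ i * cnj (e m $ i)) = 0" by (intro sum.neutral) blast
          then show ?thesis using F by auto
        qed
        finally show "(\<Sum>i\<in>UNIV. e l $ i * cnj (e m $ i)) = (if l = m then 1 else 0)"
          using False by (cases "l = j"; cases "l = k"; cases "m = j"; cases "m = k") (simp_all add: vj vk tt tw)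
      qed
      from diag[OF this, of j] have "b (t *s (axis j 1 + \<omega> *s axis k 1)) (t *s (axis j 1 + \<omega> *s axis k 1)) = 0"
        by (simp add: e_def)
      then have "t * cnj t * b (axis j 1 + \<omega> *s axis k 1) (axis j 1 + \<omega> *s axis k 1) = 0"
        using b unfolding sesquilinear_def by (metis mult.assoc)
      then have "b (axis j 1 + \<omega> *s axis k 1) (axis j 1 + \<omega> *s axis k 1) = 0" by (simp add: tt)
      then show ?thesis
        using b jj unfolding sesquilinear_def by (simp add: algebra_simps)
    qed
    have "b (axis j 1) (axis k 1) + b (axis k 1) (axis j 1) = 0" using rot[of 1] by simp
    moreover have "- \<i> * b (axis j 1) (axis k 1) + \<i> * b (axis k 1) (axis j 1) = 0" using rot[of \<i>] by simp
    ultimately show ?thesis by (simp add: complex_eq_iff)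
  qed (use jj in simp)
  show ?thesis by (subst sesquilinear_expansion[OF b]) (simp add: jk)
qed

section \<open>Second order Taylor expansion\<close>

text \<open>Schwarz's theorem under differentiability of the first derivative at the single point \<open>a\<close>.
  The second difference \<open>f(a + tv + tw) - f(a + tv) - f(a + tw) + f(a)\<close>, which is symmetric
  in \<open>v\<close> and \<open>w\<close>, equals \<open>t\<^sup>2 f'' v w\<close> up to
  \<open>o(t\<^sup>2)\<close>, by the mean value theorem in the direction \<open>v\<close>.\<close>

lemma second_derivative_symmetric:
  fixes f :: "'a::real_normed_vector \<Rightarrow> 'b::real_normed_vector"
  assumes U: "open U" "a \<in> U" and f': "\<And>z. z \<in> U \<Longrightarrow> (f has_derivative f' z) (at z)"
    and f'': "\<And>v. ((\<lambda>z. f' z v) has_derivative f'' v) (at a)"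
  shows "f'' v w = f'' w v"
proof -
  have main: "\<exists>t0>0. \<forall>t. 0 < t \<and> t < t0 \<longrightarrow>
      norm (f (a + t *\<^sub>R v + t *\<^sub>R w) - f (a + t *\<^sub>R v) - f (a + t *\<^sub>R w) + f a - t\<^sup>2 *\<^sub>R f'' v w) \<le> e * t\<^sup>2"
    if e: "e > 0" for v w e
  proof -
    define L where "L = norm v + norm w + 1"
    have L: "L > 0" by (auto simp: L_def intro: add_nonneg_pos)
    obtain R where R: "R > 0" "ball a R \<subseteq> U" using U open_contains_ball by blast
    have "e / (2 * L) > 0" using e L by simp
    with f''[of v] obtain d where d: "d > 0" "\<And>y. norm (y - a) < d \<Longrightarrow>
        norm (f' y v - f' a v - f'' v (y - a)) \<le> e / (2 * L) * norm (y - a)"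
      unfolding has_derivative_at_alt by blast
    have lin: "linear (f'' v)" using f''[of v] has_derivative_linear by blast
    define t0 where "t0 = min d R / L"
    show ?thesis
    proof (intro exI[of _ t0] conjI allI impI)
      show "t0 > 0" using d R L by (simp add: t0_def)
      fix t assume t: "0 < t \<and> t < t0"
      have tL: "t * L < d" "t * L < R" using t L by (auto simp: t0_def pos_less_divide_eq)
      have small: "norm (x *\<^sub>R v + y *\<^sub>R w) \<le> t * L" if "0 \<le> x" "x \<le> t" "0 \<le> y" "y \<le> t" for x y
      proof -
        have "norm (x *\<^sub>R v + y *\<^sub>R w) \<le> x * norm v + y * norm w"
          using norm_triangle_ineq[of "x *\<^sub>R v" "y *\<^sub>R w"] that by simp
        also have "\<dots> \<le> t * norm v + t * norm w" using that by (intro add_mono mult_right_mono) auto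
        also have "\<dots> \<le> t * L" using t by (simp add: L_def algebra_simps)
        finally show ?thesis .
      qed
      have inU: "a + x *\<^sub>R v + y *\<^sub>R w \<in> U" if "0 \<le> x" "x \<le> t" "0 \<le> y" "y \<le> t" for x y
        using small[OF that] tL(2) R(2) by (auto simp: subset_iff dist_norm add.assoc norm_minus_commute)
      have est: "norm (f' (a + x *\<^sub>R v + y *\<^sub>R w) v - f' a v - f'' v (x *\<^sub>R v + y *\<^sub>R w)) \<le> e / (2 * L) * (t * L)"
        if "0 \<le> x" "x \<le> t" "0 \<le> y" "y \<le> t" for x y
      proof -
        have "norm (f' (a + x *\<^sub>R v + y *\<^sub>R w) v - f' a v - f'' v (x *\<^sub>R v + y *\<^sub>R w)) \<le> e / (2 * L) * norm (x *\<^sub>R v + y *\<^sub>R w)"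
          using d(2)[of "a + x *\<^sub>R v + y *\<^sub>R w"] small[OF that] tL(1) by (simp add: add.assoc)
        also have "\<dots> \<le> e / (2 * L) * (t * L)" using e L small[OF that] by (intro mult_left_mono) auto
        finally show ?thesis .
      qed
      let ?\<psi> = "\<lambda>x. f (a + x *\<^sub>R v + t *\<^sub>R w) - f (a + x *\<^sub>R v + 0 *\<^sub>R w) - x *\<^sub>R (t *\<^sub>R f'' v w)"
      let ?\<psi>' = "\<lambda>x h. h *\<^sub>R (f' (a + x *\<^sub>R v + t *\<^sub>R w) v - f' (a + x *\<^sub>R v + 0 *\<^sub>R w) v - t *\<^sub>R f'' v w)"
      have der: "(?\<psi> has_derivative ?\<psi>' x) (at x within {0..t})" if x: "x \<in> {0..t}" for x
      proof -
        have c: "((\<lambda>x. f (a + x *\<^sub>R v + y *\<^sub>R w)) has_derivative (\<lambda>h. h *\<^sub>R f' (a + x *\<^sub>R v + y *\<^sub>R w) v)) (at x within {0..t})"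
          if y: "0 \<le> y" "y \<le> t" for y
        proof -
          have "((\<lambda>x. a + x *\<^sub>R v + y *\<^sub>R w) has_derivative (\<lambda>h. h *\<^sub>R v)) (at x within {0..t})"
            by (auto intro!: derivative_eq_intros)
          moreover have fd: "(f has_derivative f' (a + x *\<^sub>R v + y *\<^sub>R w)) (at (a + x *\<^sub>R v + y *\<^sub>R w))"
            using x y by (intro f' inU) auto
          ultimately have "((\<lambda>x. f (a + x *\<^sub>R v + y *\<^sub>R w)) has_derivative (\<lambda>h. f' (a + x *\<^sub>R v + y *\<^sub>R w) (h *\<^sub>R v))) (at x within {0..t})"
            by (rule has_derivative_compose)
          then show ?thesis using linear_scale[OF has_derivative_linear[OF fd]] by simp
        qed
        have "(?\<psi> has_derivative (\<lambda>h. h *\<^sub>R f' (a + x *\<^sub>R v + t *\<^sub>R w) v - h *\<^sub>R f' (a + x *\<^sub>R v + 0 *\<^sub>R w) v - h *\<^sub>R (t *\<^sub>R f'' v w))) (at x within {0..t})"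
          using t by (intro has_derivative_diff c) (auto intro!: derivative_eq_intros)
        then show ?thesis by (simp add: scaleR_diff_right)
      qed
      have bnd: "onorm (?\<psi>' x) \<le> e * t" if x: "x \<in> {0..t}" for x
      proof (rule onorm_bound)
        fix h :: real
        let ?y1 = "f' (a + x *\<^sub>R v + t *\<^sub>R w) v - f' a v - f'' v (x *\<^sub>R v + t *\<^sub>R w)"
        let ?y2 = "f' (a + x *\<^sub>R v + 0 *\<^sub>R w) v - f' a v - f'' v (x *\<^sub>R v + 0 *\<^sub>R w)"
        have "f' (a + x *\<^sub>R v + t *\<^sub>R w) v - f' (a + x *\<^sub>R v + 0 *\<^sub>R w) v - t *\<^sub>R f'' v w = ?y1 - ?y2"
          by (simp add: linear_add[OF lin] linear_scale[OF lin])
        also have "norm (?y1 - ?y2) \<le> e / (2 * L) * (t * L) + e / (2 * L) * (t * L)"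
          using x t by (intro order_trans[OF norm_triangle_ineq4] add_mono est) auto
        also have "\<dots> = e * t" using L by (simp add: field_simps)
        finally show "norm (?\<psi>' x h) \<le> e * t * norm h"
          by (simp add: mult.commute[of "e * t"] mult_left_mono)
      qed (use e t in auto)
      have "norm (?\<psi> t - ?\<psi> 0) \<le> e * t * norm (t - 0)"
        by (rule differentiable_bound[OF _ der bnd]) (use t in auto)
      then show "norm (f (a + t *\<^sub>R v + t *\<^sub>R w) - f (a + t *\<^sub>R v) - f (a + t *\<^sub>R w) + f a - t\<^sup>2 *\<^sub>R f'' v w) \<le> e * t\<^sup>2"
        using t by (simp add: power2_eq_square algebra_simps)
    qed
  qed
  have "norm (f'' v w - f'' w v) \<le> 0 + e" if "e > 0" for e
  proof -
    have e2: "e / 2 > 0" using that by simp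
    obtain t1 where t1: "t1 > 0" "\<And>t. 0 < t \<Longrightarrow> t < t1 \<Longrightarrow>
      norm (f (a + t *\<^sub>R v + t *\<^sub>R w) - f (a + t *\<^sub>R v) - f (a + t *\<^sub>R w) + f a - t\<^sup>2 *\<^sub>R f'' v w) \<le> e / 2 * t\<^sup>2"
      using main[OF e2, of v w] by blast
    obtain t2 where t2: "t2 > 0" "\<And>t. 0 < t \<Longrightarrow> t < t2 \<Longrightarrow>
      norm (f (a + t *\<^sub>R w + t *\<^sub>R v) - f (a + t *\<^sub>R w) - f (a + t *\<^sub>R v) + f a - t\<^sup>2 *\<^sub>R f'' w v) \<le> e / 2 * t\<^sup>2"
      using main[OF e2, of w v] by blast
    define t where "t = min t1 t2 / 2"
    have t: "0 < t" "t < t1" "t < t2" using t1(1) t2(1) by (auto simp: t_def min_def)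
    let ?A = "f (a + t *\<^sub>R v + t *\<^sub>R w) - f (a + t *\<^sub>R v) - f (a + t *\<^sub>R w) + f a"
    have A2: "f (a + t *\<^sub>R w + t *\<^sub>R v) - f (a + t *\<^sub>R w) - f (a + t *\<^sub>R v) + f a = ?A" by (simp add: algebra_simps)
    have t2': "norm (?A - t\<^sup>2 *\<^sub>R f'' w v) \<le> e / 2 * t\<^sup>2" using t2(2)[OF t(1,3)] unfolding A2 .
    have "t\<^sup>2 *\<^sub>R (f'' v w - f'' w v) = (?A - t\<^sup>2 *\<^sub>R f'' w v) - (?A - t\<^sup>2 *\<^sub>R f'' v w)" by (simp add: scaleR_diff_right)
    also have "norm \<dots> \<le> e / 2 * t\<^sup>2 + e / 2 * t\<^sup>2"
      by (rule order_trans[OF norm_triangle_ineq4 add_mono[OF t2' t1(2)[OF t(1,2)]]])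
    finally have "norm (t\<^sup>2 *\<^sub>R (f'' v w - f'' w v)) \<le> e / 2 * t\<^sup>2 + e / 2 * t\<^sup>2" .
    then have "t\<^sup>2 * norm (f'' v w - f'' w v) \<le> t\<^sup>2 * e" unfolding norm_scaleR by (simp add: mult.commute)
    then show ?thesis using t(1) by simp
  qed
  then have "norm (f'' v w - f'' w v) \<le> 0" by (rule field_le_epsilon)
  then show ?thesis by simp
qed

lemma directional_derivative_bilinear:
  fixes G :: "'a::euclidean_space \<Rightarrow> 'b::real_normed_vector"
  assumes U: "open U" "a \<in> U" and G': "\<And>z. z \<in> U \<Longrightarrow> (G has_derivative G' z) (at z)"
    and G'': "\<And>v. ((\<lambda>z. G' z v) has_derivative G'' v) (at a)"
  shows "bilinear G''"
proof -
  have lin: "linear (G' z)" if "z \<in> U" for z using has_derivative_linear[OF G'[OF that]] .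
  have "linear (G'' v)" for v using has_derivative_linear[OF G''] .
  moreover have "linear (\<lambda>v. G'' v w)" for w
  proof (rule linearI)
    fix x y
    have "((\<lambda>z. G' z x + G' z y) has_derivative (\<lambda>w. G'' x w + G'' y w)) (at a)"
      by (intro has_derivative_add G'')
    then have "((\<lambda>z. G' z (x + y)) has_derivative (\<lambda>w. G'' x w + G'' y w)) (at a)"
      by (rule has_derivative_transform_within_open[OF _ U]) (simp add: linear_add[OF lin])
    from has_derivative_unique[OF G'' this] show "G'' (x + y) w = G'' x w + G'' y w" by (rule fun_cong)
  next
    fix c x
    have "((\<lambda>z. c *\<^sub>R G' z x) has_derivative (\<lambda>w. c *\<^sub>R G'' x w)) (at a)"
      by (intro has_derivative_scaleR_right G'')
    then have "((\<lambda>z. G' z (c *\<^sub>R x)) has_derivative (\<lambda>w. c *\<^sub>R G'' x w)) (at a)"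
      by (rule has_derivative_transform_within_open[OF _ U]) (simp add: linear_scale[OF lin])
    from has_derivative_unique[OF G'' this] show "G'' (c *\<^sub>R x) w = c *\<^sub>R G'' x w" by (rule fun_cong)
  qed
  ultimately show ?thesis by (simp add: bilinear_def)
qed

text \<open>The mean value theorem on the segment from \<open>a\<close> to \<open>a + z\<close> needs the first
  derivative to be approximated to first order uniformly in all directions; finitely many basis directions
  suffice, at the cost of the factor \<open>DIM('a)\<close>.\<close>

lemma second_order_taylor:
  fixes G :: "'a::euclidean_space \<Rightarrow> real"
  assumes U: "open U" "a \<in> U" and G': "\<And>z. z \<in> U \<Longrightarrow> (G has_derivative G' z) (at z)"
    and G'': "\<And>v. ((\<lambda>z. G' z v) has_derivative G'' v) (at a)" and e: "e > 0"
  shows "\<exists>d>0. \<forall>z. norm z < d \<longrightarrow> a + z \<in> U \<and> \<bar>G (a + z) - G a - G' a z - G'' z z / 2\<bar> \<le> e * (norm z)\<^sup>2"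
proof -
  have bil: "bilinear G''" by (rule directional_derivative_bilinear[OF U G' G''])
  have lin: "linear (G' z)" if "z \<in> U" for z using has_derivative_linear[OF G'[OF that]] .
  define e' where "e' = e / real DIM('a)"
  have e': "e' > 0" using e by (simp add: e'_def)
  have "\<exists>d>0. \<forall>y. norm (y - a) < d \<longrightarrow> norm (G' y b - G' a b - G'' b (y - a)) \<le> e' * norm (y - a)" for b
    using G''[of b] e' unfolding has_derivative_at_alt by blast
  then obtain d where d: "\<And>b. d b > 0" "\<And>b y. norm (y - a) < d b \<Longrightarrow> norm (G' y b - G' a b - G'' b (y - a)) \<le> e' * norm (y - a)"
    by metis
  obtain R where R: "R > 0" "ball a R \<subseteq> U" using U open_contains_ball by blast
  define \<delta> where "\<delta> = min R (Min (d ` Basis))"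
  have \<delta>: "\<delta> > 0" using R d by (auto simp: \<delta>_def)
  have \<delta>b: "\<delta> \<le> d b" if "b \<in> Basis" for b using that by (auto simp: \<delta>_def min_le_iff_disj)
  have est: "\<bar>G' (a + x) v - G' a v - G'' v x\<bar> \<le> e * norm v * norm x" if x: "norm x < \<delta>" for x v
  proof -
    have ax: "a + x \<in> U" using x R by (auto simp: \<delta>_def dist_norm subset_iff)
    have rep: "L v = (\<Sum>b\<in>Basis. (v \<bullet> b) * L b)" if "linear L" for L :: "'a \<Rightarrow> real"
      using that by (subst euclidean_representation[of v, symmetric]) (simp add: linear_sum linear_scale del: euclidean_representation)
    have l2: "linear (\<lambda>v. G'' v x)" using bil by (simp add: bilinear_def)
    have "G' (a + x) v - G' a v - G'' v x = (\<Sum>b\<in>Basis. (v \<bullet> b) * (G' (a + x) b - G' a b - G'' b x))"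
      unfolding rep[OF lin[OF ax]] rep[OF lin[OF U(2)]] rep[OF l2]
      by (simp add: sum_subtractf right_diff_distrib)
    also have "\<bar>\<dots>\<bar> \<le> (\<Sum>b\<in>(Basis::'a set). norm v * (e' * norm x))"
    proof (rule order_trans[OF sum_abs sum_mono])
      fix b :: 'a assume b: "b \<in> Basis"
      have "norm (G' (a + x) b - G' a b - G'' b x) \<le> e' * norm x"
        using d(2)[of "a + x" b] x \<delta>b[OF b] by simp
      then show "\<bar>v \<bullet> b * (G' (a + x) b - G' a b - G'' b x)\<bar> \<le> norm v * (e' * norm x)"
        unfolding abs_mult using Basis_le_norm[OF b, of v] by (intro mult_mono) auto
    qed
    also have "\<dots> = e * norm v * norm x" by (simp add: e'_def)
    finally show ?thesis .
  qed
  show ?thesis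
  proof (intro exI[of _ \<delta>] conjI allI impI \<delta>)
    fix z :: 'a assume z: "norm z < \<delta>"
    show "a + z \<in> U" using z R by (auto simp: \<delta>_def dist_norm subset_iff)
    let ?\<psi> = "\<lambda>t. G (a + t *\<^sub>R z) - t * G' a z - t\<^sup>2 * (G'' z z / 2)"
    let ?\<psi>' = "\<lambda>t h. h * (G' (a + t *\<^sub>R z) z - G' a z - G'' z (t *\<^sub>R z))"
    have small: "norm (t *\<^sub>R z) < \<delta>" if "t \<in> {0..1}" for t
      using that z mult_left_le_one_le[of "norm z" t] by auto
    have inU: "a + t *\<^sub>R z \<in> U" if "t \<in> {0..1}" for t
      using small[OF that] R by (auto simp: \<delta>_def dist_norm subset_iff)
    have l2: "linear (G'' z)" using bil by (simp add: bilinear_def)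
    have der: "(?\<psi> has_derivative ?\<psi>' t) (at t within {0..1})" if t: "t \<in> {0..1}" for t
    proof -
      have "((\<lambda>t. a + t *\<^sub>R z) has_derivative (\<lambda>h. h *\<^sub>R z)) (at t within {0..1})"
        by (auto intro!: derivative_eq_intros)
      from has_derivative_compose[OF this G'[OF inU[OF t]]]
      have "((\<lambda>t. G (a + t *\<^sub>R z)) has_derivative (\<lambda>h. h * G' (a + t *\<^sub>R z) z)) (at t within {0..1})"
        by (simp add: linear_scale[OF lin[OF inU[OF t]]])
      then have "(?\<psi> has_derivative (\<lambda>h. h * G' (a + t *\<^sub>R z) z - h * G' a z - (2 * t * h) * (G'' z z / 2))) (at t within {0..1})"
        by (auto intro!: derivative_eq_intros)
      then show ?thesis
        by (rule has_derivative_eq_rhs) (auto simp: linear_scale[OF l2] fun_eq_iff algebra_simps)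
    qed
    have bnd: "onorm (?\<psi>' t) \<le> e * (norm z)\<^sup>2" if t: "t \<in> {0..1}" for t
    proof (rule onorm_bound)
      fix h :: real
      have "\<bar>G' (a + t *\<^sub>R z) z - G' a z - G'' z (t *\<^sub>R z)\<bar> \<le> e * norm z * norm (t *\<^sub>R z)"
        by (rule est[OF small[OF t]])
      also have "\<dots> \<le> e * norm z * norm z" using t e mult_left_le_one_le[of "norm z" t] by (intro mult_left_mono) auto
      finally show "norm (?\<psi>' t h) \<le> e * (norm z)\<^sup>2 * norm h"
        by (simp add: abs_mult power2_eq_square mult.commute[of _ "\<bar>h\<bar>"] mult_left_mono mult.assoc)
    qed (use e in auto)
    have "norm (?\<psi> 1 - ?\<psi> 0) \<le> e * (norm z)\<^sup>2 * norm (1 - 0 :: real)"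
      by (rule differentiable_bound[OF _ der bnd]) auto
    then show "\<bar>G (a + z) - G a - G' a z - G'' z z / 2\<bar> \<le> e * (norm z)\<^sup>2" by simp
  qed
qed

text \<open>Averaging the Taylor expansion over the polyball of size \<open>\<delta>\<close> kills the linear term,
  by the symmetry \<open>w \<mapsto> - w\<close>, and leaves \<open>\<delta>\<^sup>2/2\<close> times the
  mean \<open>I\<close> of the quadratic term up to \<open>o(\<delta>\<^sup>2)\<close>; so \<open>I \<ge>
  0\<close>. The rotation \<open>w \<mapsto> \<i> w\<close> leaves the mean unchanged, hence the
  symmetrised quadratic form, which contains only the mixed derivatives \<open>\<partial>\<partial>bar
  G\<close>, has mean \<open>2 I\<close>.\<close>

lemma second_order_mean_nonneg:
  fixes G :: "complex^('n::{finite,linorder}) \<Rightarrow> real"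
    and T :: "complex^('n::{finite,linorder}) \<Rightarrow> complex^('n::{finite,linorder})"
  assumes U: "open U" "a \<in> U" and G': "\<And>z. z \<in> U \<Longrightarrow> (G has_derivative G' z) (at z)"
    and G'': "\<And>v. ((\<lambda>z. G' z v) has_derivative G'' v) (at a)"
    and nonneg: "\<And>z. z \<in> U \<Longrightarrow> 0 \<le> G z" and pos: "0 < G a"
    and T: "linear T" "\<And>c w. T (c *s w) = c *s T w"
    and sub: "\<exists>\<delta>0>0. \<forall>\<delta>. 0 < \<delta> \<and> \<delta> < \<delta>0 \<longrightarrow> ennreal (G a) \<le> (\<integral>\<^sup>+w. ennreal (G (a + \<delta> *\<^sub>R T w)) \<partial>avg q)"
  shows "0 \<le> integral\<^sup>L (avg q) (\<lambda>w. G'' (T w) (T w) + G'' (\<i> *s T w) (\<i> *s T w))"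
proof -
  have bil: "bilinear G''" by (rule directional_derivative_bilinear[OF U G' G''])
  have contT: "continuous_on UNIV T" using T(1) by (intro linear_continuous_on) (simp add: linear_conv_bounded_linear)
  have contQ: "continuous_on UNIV (\<lambda>w. G'' (T w) (T w))"
    using bil bounded_bilinear.continuous_on[OF _ contT contT] by (simp add: bilinear_conv_bounded_bilinear)
  have lin: "linear (G' a)" using has_derivative_linear[OF G'[OF U(2)]] .
  have contL: "continuous_on UNIV (\<lambda>w. G' a (T w))"
    using linear_compose[OF T(1) lin] by (intro linear_continuous_on) (simp add: linear_conv_bounded_linear o_def)
  define I where "I = integral\<^sup>L (avg q) (\<lambda>w. G'' (T w) (T w))"
  have intL: "integral\<^sup>L (avg q) (\<lambda>w. G' a (T w)) = 0"
  proof -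
    have "integral\<^sup>L (avg q) (\<lambda>w. G' a (T ((- 1) *s w))) = integral\<^sup>L (avg q) (\<lambda>w. G' a (T w))"
      by (rule integral_avg_rotation[OF contL]) simp
    moreover have "G' a (T ((- 1) *s w)) = - G' a (T w)" for w
    proof -
      have "T ((- 1) *s w) = - T w" unfolding T(2) by (simp add: vec_eq_iff)
      then show ?thesis by (simp add: linear_neg[OF lin])
    qed
    ultimately have "integral\<^sup>L (avg q) (\<lambda>w. - G' a (T w)) = integral\<^sup>L (avg q) (\<lambda>w. G' a (T w))" by simp
    then show ?thesis by simp
  qed
  have "0 \<le> I"
  proof (rule ccontr)
    assume "\<not> 0 \<le> I"
    then have I: "I < 0" by simp
    have "bounded (T ` unit_polyball q)"
      using T(1) by (intro bounded_linear_image unit_polyball_bounded) (simp add: linear_conv_bounded_linear)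
    then obtain K where K: "K > 0" "\<And>w. w \<in> unit_polyball q \<Longrightarrow> norm (T w) \<le> K"
      unfolding bounded_pos by auto
    \<comment> \<open>so that the error e (\<delta> K)^2 is half of the loss \<delta>^2 |I| / 2\<close>
    define e where "e = - I / (4 * K\<^sup>2)"
    have e: "e > 0" "e * K\<^sup>2 = - I / 4" using I K(1) by (auto simp: e_def field_simps)
    obtain d where d: "d > 0" "\<And>z. norm z < d \<Longrightarrow> a + z \<in> U \<and> \<bar>G (a + z) - G a - G' a z - G'' z z / 2\<bar> \<le> e * (norm z)\<^sup>2"
      using second_order_taylor[OF U G' G'' e(1)] by blast
    obtain \<delta>0 where \<delta>0: "\<delta>0 > 0" "\<And>\<delta>. 0 < \<delta> \<Longrightarrow> \<delta> < \<delta>0 \<Longrightarrow> ennreal (G a) \<le> (\<integral>\<^sup>+w. ennreal (G (a + \<delta> *\<^sub>R T w)) \<partial>avg q)"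
      using sub by blast
    define \<delta> where "\<delta> = min \<delta>0 (d / K) / 2"
    have \<delta>: "0 < \<delta>" "\<delta> < \<delta>0" "\<delta> * K < d" using \<delta>0(1) d(1) K(1) by (auto simp: \<delta>_def min_def field_simps)
    define f where "f w = G a + \<delta> * G' a (T w) + \<delta>\<^sup>2 / 2 * G'' (T w) (T w) + e * \<delta>\<^sup>2 * K\<^sup>2" for w
    have Gf: "G (a + \<delta> *\<^sub>R T w) \<le> f w \<and> 0 \<le> G (a + \<delta> *\<^sub>R T w)" if w: "w \<in> unit_polyball q" for w
    proof -
      have n: "norm (\<delta> *\<^sub>R T w) \<le> \<delta> * K" using K(2)[OF w] \<delta>(1) by simp
      then have "norm (\<delta> *\<^sub>R T w) < d" using \<delta>(3) by linarith
      from d(2)[OF this] have z: "a + \<delta> *\<^sub>R T w \<in> U" and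
        b: "G (a + \<delta> *\<^sub>R T w) \<le> G a + G' a (\<delta> *\<^sub>R T w) + G'' (\<delta> *\<^sub>R T w) (\<delta> *\<^sub>R T w) / 2 + e * (norm (\<delta> *\<^sub>R T w))\<^sup>2" by auto
      have "e * (norm (\<delta> *\<^sub>R T w))\<^sup>2 \<le> e * (\<delta> * K)\<^sup>2" using n e by (intro mult_left_mono power_mono) auto
      moreover have "G' a (\<delta> *\<^sub>R T w) = \<delta> * G' a (T w)" by (simp add: linear_scale[OF lin])
      moreover have "G'' (\<delta> *\<^sub>R T w) (\<delta> *\<^sub>R T w) = \<delta>\<^sup>2 * G'' (T w) (T w)"
        using bil by (simp add: bilinear_lmul bilinear_rmul power2_eq_square)
      ultimately show ?thesis using b nonneg[OF z] by (simp add: f_def power_mult_distrib)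
    qed
    have intf: "integrable (avg q) f" unfolding f_def
      by (intro integrable_avg_continuous continuous_intros contL contQ)
    have prob: "measure (avg q) (space (avg q :: (complex,'n) vec measure)) = 1"
      using emeasure_avg_UNIV[of q, where 'n='n] by (simp add: measure_def avg_def)
    have "integral\<^sup>L (avg q) f = G a + \<delta> * 0 + \<delta>\<^sup>2 / 2 * I + e * \<delta>\<^sup>2 * K\<^sup>2"
    proof -
      have i: "integrable (avg q) (\<lambda>w. G' a (T w))" "integrable (avg q) (\<lambda>w. G'' (T w) (T w))"
          "integrable (avg q) (\<lambda>w :: (complex,'n) vec. c)" for c :: real
        by (intro integrable_avg_continuous contL contQ continuous_on_const)+
      have c: "integral\<^sup>L (avg q) (\<lambda>w :: (complex,'n) vec. c) = c" for c :: real using prob by simp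
      show ?thesis unfolding f_def using i
        by (simp add: intL I_def, simp only: prob mult_1)
    qed
    also have "e * \<delta>\<^sup>2 * K\<^sup>2 = \<delta>\<^sup>2 * (e * K\<^sup>2)" by (simp only: mult_ac)
    also have "G a + \<delta> * 0 + \<delta>\<^sup>2 / 2 * I + \<delta>\<^sup>2 * (e * K\<^sup>2) = G a + \<delta>\<^sup>2 * I / 4"
      unfolding e(2) by (simp add: field_simps)
    finally have If: "integral\<^sup>L (avg q) f = G a + \<delta>\<^sup>2 * I / 4" .
    have AEf: "AE w in avg q. 0 \<le> f w" using AE_avg[of q] by eventually_elim (use Gf in force)
    have "ennreal (G a) \<le> (\<integral>\<^sup>+w. ennreal (G (a + \<delta> *\<^sub>R T w)) \<partial>avg q)" by (rule \<delta>0(2)[OF \<delta>(1,2)])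
    also have "\<dots> \<le> (\<integral>\<^sup>+w. ennreal (f w) \<partial>avg q)"
      by (rule nn_integral_mono_AE, rule AE_mp[OF AE_avg], rule AE_I2) (use Gf ennreal_leI in blast)
    also have "\<dots> = ennreal (G a + \<delta>\<^sup>2 * I / 4)"
      using nn_integral_eq_integral[OF intf AEf] If by simp
    finally have "G a \<le> G a + \<delta>\<^sup>2 * I / 4" using pos by (simp add: ennreal_le_iff2)
    moreover have "\<delta>\<^sup>2 * I < 0" using I \<delta>(1) by (simp add: mult_pos_neg)
    ultimately show False by simp
  qed
  moreover have "integral\<^sup>L (avg q) (\<lambda>w. G'' (\<i> *s T w) (\<i> *s T w)) = I"
    using integral_avg_rotation[OF contQ, of \<i>] by (simp add: T(2) I_def)
  moreover have "integral\<^sup>L (avg q) (\<lambda>w. G'' (T w) (T w) + G'' (\<i> *s T w) (\<i> *s T w))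
      = I + integral\<^sup>L (avg q) (\<lambda>w. G'' (\<i> *s T w) (\<i> *s T w))"
  proof -
    have ci: "continuous_on UNIV (\<lambda>w. G'' (T (\<i> *s w)) (T (\<i> *s w)))"
      by (rule continuous_on_compose2[OF contQ, of UNIV "\<lambda>w. \<i> *s w"]) (auto intro!: continuous_intros)
    show ?thesis unfolding I_def
      by (rule Bochner_Integration.integral_add)
         (use integrable_avg_continuous[OF contQ] integrable_avg_continuous[OF ci] in \<open>simp_all add: T(2)\<close>)
  qed
  ultimately show ?thesis by simp
qed

section \<open>Matrix algebra of Hermitian two-jets\<close>

text \<open>Complex multiples of a matrix are written \<open>cm c A\<close>, since \<open>*s\<close> does not apply
  to matrices with complex scalars.\<close>

definition adj :: "complex^'r^'r \<Rightarrow> complex^'r^'r" where "adj A = (\<chi> i j. cnj (A $ j $ i))"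
definition conjm :: "complex^'r^'r \<Rightarrow> complex^'r^'r" where "conjm A = (\<chi> i j. cnj (A $ i $ j))"
definition cm :: "complex \<Rightarrow> complex^'r^'r \<Rightarrow> complex^'r^'r" where "cm c A = (\<chi> i j. c * A $ i $ j)"
definition cvec :: "complex^'r \<Rightarrow> complex^'r" where "cvec x = (\<chi> i. cnj (x $ i))"

lemma adj_nth [simp]: "adj A $ i $ j = cnj (A $ j $ i)" by (simp add: adj_def)
lemma conjm_nth [simp]: "conjm A $ i $ j = cnj (A $ i $ j)" by (simp add: conjm_def)
lemma cm_nth [simp]: "cm c A $ i $ j = c * A $ i $ j" by (simp add: cm_def)
lemma cvec_nth [simp]: "cvec x $ i = cnj (x $ i)" by (simp add: cvec_def)

lemma mat_eqI: "(\<And>i j. A $ i $ j = B $ i $ j) \<Longrightarrow> A = (B :: complex^'r^'r)" by (simp add: vec_eq_iff)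

lemma mm_nth: "(A ** B) $ i $ j = (\<Sum>k\<in>UNIV. A $ i $ k * B $ k $ j)" by (simp add: matrix_matrix_mult_def)

lemma matrix_ring_simps:
  fixes A B C :: "complex^'r^'r"
  shows "A ** (B + C) = A ** B + A ** C" "(A + B) ** C = A ** C + B ** C"
    "A ** (B - C) = A ** B - A ** C" "(A - B) ** C = A ** C - B ** C"
    "A ** (- B) = - (A ** B)" "(- A) ** B = - (A ** B)"
    "cm c A ** B = cm c (A ** B)" "A ** cm c B = cm c (A ** B)" "A ** 0 = 0" "0 ** A = 0"
  by (auto intro!: mat_eqI simp: mm_nth algebra_simps sum.distrib sum_subtractf sum_negf sum_distrib_left)

lemma cm_simps:
  "cm c (A + B) = cm c A + cm c B" "cm c (A - B) = cm c A - cm c B" "cm c (- A) = - cm c A"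
  "cm c (cm d A) = cm (c * d) A" "cm 1 A = A"
  by (auto intro!: mat_eqI simp: algebra_simps)

lemma adj_simps:
  "adj (A + B) = adj A + adj B" "adj (A - B) = adj A - adj B" "adj (- A) = - adj A"
  "adj (cm c A) = cm (cnj c) (adj A)" "adj (adj A) = A" "adj (mat 1) = mat 1"
  "adj (A ** B) = adj B ** adj A"
  by (auto intro!: mat_eqI simp: mm_nth mat_def mult.commute)

lemma conjm_simps:
  "conjm (A + B) = conjm A + conjm B" "conjm (A - B) = conjm A - conjm B" "conjm (- A) = - conjm A"
  "conjm (cm c A) = cm (cnj c) (conjm A)" "conjm (mat 1) = mat 1" "conjm (A ** B) = conjm A ** conjm B"
  "adj (conjm A) = conjm (adj A)"
  by (auto intro!: mat_eqI simp: mm_nth mat_def)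

lemma mderiv_add: "mderiv F F' z \<Longrightarrow> mderiv G G' z \<Longrightarrow> mderiv (\<lambda>z. F z + G z) (\<lambda>v. F' v + G' v) z"
  by (auto simp: mderiv_def intro!: has_derivative_add)

lemma mderiv_diff: "mderiv F F' z \<Longrightarrow> mderiv G G' z \<Longrightarrow> mderiv (\<lambda>z. F z - G z) (\<lambda>v. F' v - G' v) z"
  by (auto simp: mderiv_def intro!: has_derivative_diff)

lemma mderiv_neg: "mderiv F F' z \<Longrightarrow> mderiv (\<lambda>z. - F z) (\<lambda>v. - F' v) z"
  by (auto simp: mderiv_def intro!: has_derivative_minus)

lemma mderiv_conjm: "mderiv F F' z \<Longrightarrow> mderiv (\<lambda>z. conjm (F z)) (\<lambda>v. conjm (F' v)) z"
  by (auto simp: mderiv_def intro!: bounded_linear.has_derivative[OF bounded_linear_cnj])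

lemma mderiv_adj: "mderiv F F' z \<Longrightarrow> mderiv (\<lambda>z. adj (F z)) (\<lambda>v. adj (F' v)) z"
  by (auto simp: mderiv_def intro!: bounded_linear.has_derivative[OF bounded_linear_cnj])

lemma mderiv_linear:
  fixes L :: "complex^'n \<Rightarrow> complex^'r^'r"
  assumes "\<And>i j. linear (\<lambda>v. L v $ i $ j)"
  shows "mderiv (\<lambda>z. L (z - a)) L z"
  unfolding mderiv_def
proof (intro allI)
  fix i j
  have bl: "bounded_linear (\<lambda>v. L v $ i $ j)" using assms by (simp add: linear_conv_bounded_linear)
  have "((\<lambda>z. z - a) has_derivative (\<lambda>v. v)) (at z)" by (auto intro!: derivative_eq_intros)
  from bounded_linear.has_derivative[OF bl this]
  show "((\<lambda>z. L (z - a) $ i $ j) has_derivative (\<lambda>v. L v $ i $ j)) (at z)" .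
qed

lemma hform_alt: "hform X x y = (\<Sum>\<alpha>\<in>UNIV. x $ \<alpha> * (X *v cvec y) $ \<alpha>)"
  by (simp add: hform_def matrix_vector_mult_def sum_distrib_left mult_ac)

lemma hform_congruence: "hform (N ** (K ** adj N)) x y = hform K (transpose N *v x) (transpose N *v y)"
proof -
  have "adj N *v cvec y = cvec (transpose N *v y)"
    by (simp add: vec_eq_iff matrix_vector_mult_def transpose_def)
  moreover have "(\<Sum>\<alpha>\<in>UNIV. x $ \<alpha> * (N *v c) $ \<alpha>) = (\<Sum>\<beta>\<in>UNIV. (transpose N *v x) $ \<beta> * c $ \<beta>)" for c
  proof -
    have "(\<Sum>\<alpha>\<in>UNIV. x $ \<alpha> * (N *v c) $ \<alpha>) = (\<Sum>\<alpha>\<in>UNIV. \<Sum>\<beta>\<in>UNIV. x $ \<alpha> * N $ \<alpha> $ \<beta> * c $ \<beta>)"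
      by (simp add: matrix_vector_mult_def sum_distrib_left mult.assoc)
    also have "\<dots> = (\<Sum>\<beta>\<in>UNIV. \<Sum>\<alpha>\<in>UNIV. x $ \<alpha> * N $ \<alpha> $ \<beta> * c $ \<beta>)" by (rule sum.swap)
    finally show ?thesis by (simp add: matrix_vector_mult_def transpose_def sum_distrib_right mult.commute[of "x $ _"])
  qed
  ultimately show ?thesis
    by (simp add: hform_alt matrix_vector_mul_assoc[symmetric])
qed

lemma hform_linear:
  "hform (A + B) x y = hform A x y + hform B x y" "hform (A - B) x y = hform A x y - hform B x y"
  "hform (- A) x y = - hform A x y" "hform (cm c A) x y = c * hform A x y"
  by (simp_all add: hform_def sum.distrib sum_subtractf sum_negf sum_distrib_left algebra_simps)

lemma hform_conjm: "hform (conjm A) x y = cnj (hform A (cvec x) (cvec y))"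
  by (simp add: hform_def)

lemma hform_adj: "hform (adj A) x x = cnj (hform A x x)"
  unfolding hform_def by (simp, subst sum.swap) (simp add: mult_ac)

lemma hform_has_derivative:
  assumes "mderiv F F' z"
  shows "((\<lambda>z. Re (hform (F z) x y)) has_derivative (\<lambda>v. Re (hform (F' v) x y))) (at z)"
  unfolding hform_def
  by (intro has_derivative_Re has_derivative_sum has_derivative_mult_right) (use assms in \<open>simp add: mderiv_def\<close>)

text \<open>Polarisation: the values on \<open>e\<^sub>i\<close>, \<open>e\<^sub>i + e\<^sub>j\<close> and
  \<open>e\<^sub>i + \<i> e\<^sub>j\<close> determine the entries.\<close>

lemma hform_zero:
  assumes "\<And>x. hform X x x = 0" shows "X = 0"
proof (rule mat_eqI)
  fix i j
  have s: "sesquilinear (\<lambda>x y. hform X x y)"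
    unfolding sesquilinear_def hform_def
    by (simp add: algebra_simps sum.distrib sum_distrib_left)
  have ax: "hform X (axis i 1) (axis j 1) = X $ i $ j" for i j
    unfolding hform_def by (subst sum.remove[of _ i], simp, simp, subst sum.remove[of _ j]) (auto simp: axis_def)
  have "cnj \<omega> * X $ i $ j + \<omega> * X $ j $ i = 0" for \<omega>
  proof -
    have "hform X (axis i 1 + \<omega> *s axis j 1) (axis i 1 + \<omega> *s axis j 1)
      = X $ i $ i + cnj \<omega> * X $ i $ j + (\<omega> * X $ j $ i + \<omega> * cnj \<omega> * X $ j $ j)"
      using s unfolding sesquilinear_def by (simp add: ax algebra_simps)
    moreover have "X $ i $ i = 0" "X $ j $ j = 0" using assms[of "axis i 1"] assms[of "axis j 1"] by (simp_all add: ax)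
    ultimately show ?thesis using assms by simp
  qed
  from this[of 1] this[of \<i>] show "X $ i $ j = (0 :: complex^'a^'a) $ i $ j" by (simp add: complex_eq_iff)
qed

text \<open>The \<open>(1,0)\<close>-part of the first derivative.\<close>

definition jet_p :: "(complex^'n \<Rightarrow> complex^'r^'r) \<Rightarrow> complex^'n \<Rightarrow> complex^'r^'r" where
  "jet_p K1 v = cm (1/2) (K1 v - cm \<i> (K1 (\<i> *s v)))"

text \<open>With \<open>M = K\<^sup>-\<^sup>1\<close> at the point, this is \<open>4 (\<partial>\<partial>bar K -
  \<partial>K K\<^sup>-\<^sup>1 \<partial>bar K)(v, v)\<close>, that is, \<open>-4 \<Theta>(v, v)
  K\<close> for the Chern curvature \<open>\<Theta>\<close> of the metric \<open>K\<close>.\<close>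

definition levi :: "complex^'r^'r \<Rightarrow> (complex^'n \<Rightarrow> complex^'r^'r) \<Rightarrow> (complex^'n \<Rightarrow> complex^'n \<Rightarrow> complex^'r^'r)
    \<Rightarrow> complex^'n \<Rightarrow> complex^'r^'r" where
  "levi M K1 K2 v = K2 v v + K2 (\<i> *s v) (\<i> *s v) - cm 4 (jet_p K1 v ** (M ** adj (jet_p K1 v)))"

lemma cm_ii: "cm \<i> (cm \<i> A) = - A" "cm (- 1) A = - A" "cm 0 A = 0"
  by (auto intro!: mat_eqI)

lemma jet_p_sum:
  assumes "\<And>i j. linear (\<lambda>v. K1 v $ i $ j)"
  shows "jet_p K1 v $ \<alpha> $ \<beta> = (\<Sum>j\<in>UNIV. v $ j * ((K1 (axis j 1) $ \<alpha> $ \<beta> - \<i> * K1 (axis j \<i>) $ \<alpha> $ \<beta>) / 2))"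
  unfolding real_linear_complexify[OF assms] by (simp add: jet_p_def)

lemma jet_p_linear:
  assumes "\<And>i j. linear (\<lambda>v. K1 v $ i $ j)"
  shows "jet_p K1 (v + w) = jet_p K1 v + jet_p K1 w" "jet_p K1 (c *s v) = cm c (jet_p K1 v)"
  by (auto intro!: mat_eqI simp: jet_p_sum[OF assms] sum.distrib distrib_right sum_distrib_left mult.assoc add_divide_distrib)

lemma complex_linear_holomorphic:
  fixes L :: "complex^'n \<Rightarrow> complex"
  assumes "\<And>v w. L (v + w) = L v + L w" "\<And>c v. L (c *s v) = c * L v"
  shows "holomorphic_vec_on (\<lambda>z. L (z - a)) S"
  unfolding holomorphic_vec_on_def
proof
  fix z
  have "linear L" using assms by (intro linearI) (auto simp: scaleR_eq_vector_scalar_mult scaleR_conv_of_real)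
  then have bl: "bounded_linear L" by (simp add: linear_conv_bounded_linear)
  have "((\<lambda>z. z - a) has_derivative (\<lambda>v. v)) (at z)" by (auto intro!: derivative_eq_intros)
  from bounded_linear.has_derivative[OF bl this] have "((\<lambda>z. L (z - a)) has_derivative L) (at z)" .
  with assms(2) show "\<exists>f'. ((\<lambda>z. L (z - a)) has_derivative f') (at z) \<and> (\<forall>c v. f' (c *s v) = c * f' v)"
    by (intro exI[of _ L]) simp
qed

section \<open>Curvature of Hermitian two-jets\<close>

text \<open>The argument uses a metric only through a positive definite matrix function \<open>K\<close>, its first
  derivative \<open>K1\<close> and its second derivative \<open>K2\<close> at the point \<open>a\<close>.
  In this form it applies to the metric and to the dual metric alike.\<close>

locale hermitian_jet =
  fixes K :: "(complex^('n::{finite,linorder})) \<Rightarrow> complex^'r^'r"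
    and K1 :: "(complex^('n::{finite,linorder})) \<Rightarrow> (complex^('n::{finite,linorder})) \<Rightarrow> complex^'r^'r"
    and K2 :: "(complex^('n::{finite,linorder})) \<Rightarrow> (complex^('n::{finite,linorder})) \<Rightarrow> complex^'r^'r"
    and U :: "(complex^('n::{finite,linorder})) set" and a :: "complex^('n::{finite,linorder})"
  assumes U: "open U" "a \<in> U"
    and dK: "\<And>z. z \<in> U \<Longrightarrow> mderiv K (K1 z) z"
    and ddK: "\<And>v. mderiv (\<lambda>z. K1 z v) (K2 v) a"
    and herm: "\<And>z. z \<in> U \<Longrightarrow> adj (K z) = K z"
    and inv: "\<And>z. z \<in> U \<Longrightarrow> invertible (K z)"
    and pos: "\<And>z x. z \<in> U \<Longrightarrow> x \<noteq> 0 \<Longrightarrow> 0 < Re (hform (K z) x x)"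
begin

definition M where "M = matrix_inv (K a)"
definition P where "P v = jet_p (K1 a) v"

lemma entry_deriv: "z \<in> U \<Longrightarrow> ((\<lambda>z. K z $ i $ j) has_derivative (\<lambda>v. K1 z v $ i $ j)) (at z)"
  using dK[of z] unfolding mderiv_def by simp

lemma entry_deriv2: "((\<lambda>z. K1 z v $ i $ j) has_derivative (\<lambda>w. K2 v w $ i $ j)) (at a)"
  using ddK[of v] unfolding mderiv_def by simp

lemma K1_linear: "z \<in> U \<Longrightarrow> linear (\<lambda>v. K1 z v $ i $ j)"
  using has_derivative_linear[OF entry_deriv] .

lemma K2_bilinear: "bilinear (\<lambda>v w. K2 v w $ i $ j)"
  by (rule directional_derivative_bilinear[OF U entry_deriv entry_deriv2])

lemma K2_symmetric: "K2 v w = K2 w v"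
  by (intro mat_eqI second_derivative_symmetric[OF U entry_deriv entry_deriv2])

lemma K1_herm: assumes z: "z \<in> U" shows "adj (K1 z v) = K1 z v"
proof -
  have "mderiv K (\<lambda>v. adj (K1 z v)) z"
    by (rule mderiv_transform_open[OF mderiv_adj[OF dK[OF z]] U(1) z]) (rule herm)
  from mderiv_unique[OF this dK[OF z]] show ?thesis .
qed

lemma K2_herm: "adj (K2 v w) = K2 v w"
proof -
  have "mderiv (\<lambda>z. K1 z v) (\<lambda>w. adj (K2 v w)) a"
    by (rule mderiv_transform_open[OF mderiv_adj[OF ddK] U]) (rule K1_herm)
  from mderiv_unique[OF this ddK] show ?thesis .
qed

lemma MK: "M ** K a = mat 1" "K a ** M = mat 1"
  unfolding M_def by (rule matrix_inv_props[OF inv[OF U(2)]])+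

lemma M_herm: "adj M = M"
proof -
  have "adj (M ** K a) = mat 1" by (simp add: MK adj_simps)
  then have "K a ** adj M = mat 1" by (simp add: adj_simps herm U)
  then have "M ** (K a ** adj M) = M" by simp
  then show ?thesis by (simp add: matrix_mul_assoc MK)
qed

lemma P_add: "P (v + w) = P v + P w" and P_scale: "P (c *s v) = cm c (P v)"
  unfolding P_def by (rule jet_p_linear[OF K1_linear[OF U(2)]])+

lemma adj_P: "adj (P v) = cm (1/2) (K1 a v + cm \<i> (K1 a (\<i> *s v)))"
  unfolding P_def jet_p_def by (simp add: adj_simps K1_herm[OF U(2)] cm_simps) (auto intro!: mat_eqI)

lemma K1_split: "K1 a v = P v + adj (P v)"
  unfolding adj_P unfolding P_def jet_p_def by (auto intro!: mat_eqI simp: field_simps)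

lemma K1_split_i: "K1 a (\<i> *s v) = cm \<i> (P v) - cm \<i> (adj (P v))"
  unfolding adj_P unfolding P_def jet_p_def by (auto intro!: mat_eqI simp: field_simps)

definition L where "L v = levi M (K1 a) K2 v"

lemma L_alt: "L v = K2 v v + K2 (\<i> *s v) (\<i> *s v) - cm 4 (P v ** (M ** adj (P v)))"
  by (simp add: L_def levi_def P_def)

text \<open>The connection matrix at \<open>a\<close>.\<close>

definition \<theta> where "\<theta> v = P v ** M"

lemma \<theta>_add: "\<theta> (v + w) = \<theta> v + \<theta> w" and \<theta>_scale: "\<theta> (c *s v) = cm c (\<theta> v)"
  by (simp_all add: \<theta>_def P_add P_scale matrix_ring_simps)

lemma \<theta>_linear: "linear (\<lambda>v. \<theta> v $ i $ j)"
  by (rule linearI) (auto simp: \<theta>_add \<theta>_scale scaleR_eq_vector_scalar_mult scaleR_conv_of_real[where 'a=complex])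

text \<open>The test section \<open>u(z) = (1 - \<theta>(z - a))\<^sup>T \<xi>\<close> is parallel to first order at
  \<open>a\<close>. For it, \<open>K(u,u)\<close> is the form of \<open>X = N K N\<^sup>*\<close> at
  \<open>\<xi>\<close> with \<open>N = 1 - \<theta>(z - a)\<close>, and the second derivative of
  \<open>X\<close> at \<open>a\<close>, symmetrised under \<open>v \<mapsto> \<i> v\<close>, is exactly
  the curvature term \<open>L\<close>. Without the correction by \<open>\<theta>\<close>, the term
  \<open>\<partial>K K\<^sup>-\<^sup>1 \<partial>bar K\<close> would be missing, and the resulting
  inequality would not determine the sign of the curvature.\<close>

lemma levi_mean_nonneg:
  fixes T :: "(complex,'n) vec \<Rightarrow> (complex,'n) vec"
  assumes T: "linear T" "\<And>c w. T (c *s w) = c *s T w" and \<xi>: "\<xi> \<noteq> 0"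
    and sub: "\<And>u. (\<And>i. holomorphic_vec_on (\<lambda>z. u z $ i) UNIV) \<Longrightarrow> u a \<noteq> 0 \<Longrightarrow>
      \<exists>\<delta>0>0. \<forall>\<delta>. 0 < \<delta> \<and> \<delta> < \<delta>0 \<longrightarrow> ennreal (Re (hform (K a) (u a) (u a))) \<le>
        (\<integral>\<^sup>+w. ennreal (Re (hform (K (a + \<delta> *\<^sub>R T w)) (u (a + \<delta> *\<^sub>R T w)) (u (a + \<delta> *\<^sub>R T w)))) \<partial>avg q)"
  shows "0 \<le> integral\<^sup>L (avg q) (\<lambda>w. Re (hform (L (T w)) \<xi> \<xi>))"
proof -
  define N where "N z = mat 1 - \<theta> (z - a)" for z
  define X where "X z = N z ** (K z ** adj (N z))" for z
  \<comment> \<open>X1, X2 are the first and second derivatives of X, Y2 that of the factor next to N in X1\<close>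
  define X1 where "X1 z v = N z ** (K z ** (- adj (\<theta> v)) + K1 z v ** adj (N z)) + (- \<theta> v) ** (K z ** adj (N z))" for z v
  define Y2 where "Y2 v w = K1 a w ** (- adj (\<theta> v)) + (K1 a v ** (- adj (\<theta> w)) + K2 v w)" for v w
  define X2 where "X2 v w = Y2 v w + (- \<theta> w) ** (K a ** (- adj (\<theta> v)) + K1 a v)
      + (- \<theta> v) ** (K a ** (- adj (\<theta> w)) + K1 a w)" for v w
  define u where "u z = transpose (N z) *v \<xi>" for z
  let ?G = "\<lambda>z. Re (hform (X z) \<xi> \<xi>)"
  have \<theta>0: "\<theta> 0 = 0" using \<theta>_scale[of 0 0] by (simp add: cm_ii)
  have Na: "N a = mat 1" by (simp add: N_def \<theta>0)
  have Nd: "mderiv N (\<lambda>v. - \<theta> v) z" for z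
    using mderiv_diff[OF mderiv_const mderiv_linear[OF \<theta>_linear]] unfolding N_def by simp
  have Nad: "mderiv (\<lambda>z. adj (N z)) (\<lambda>v. - adj (\<theta> v)) z" for z
    using mderiv_adj[OF Nd] by (simp add: adj_simps)
  have Xd: "mderiv X (X1 z) z" if z: "z \<in> U" for z
    unfolding X_def X1_def by (rule mderiv_mult[OF Nd mderiv_mult[OF dK[OF z] Nad]])
  have Xdd: "mderiv (\<lambda>z. X1 z v) (X2 v) a" for v
  proof -
    have Y: "mderiv (\<lambda>z. K z ** (- adj (\<theta> v)) + K1 z v ** adj (N z)) (Y2 v) a"
      using mderiv_add[OF mderiv_mult[OF dK[OF U(2)] mderiv_const[of "- adj (\<theta> v)"]] mderiv_mult[OF ddK[of v] Nad]]
      by (simp add: Y2_def[abs_def] Na adj_simps matrix_ring_simps)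
    have Z: "mderiv (\<lambda>z. (- \<theta> v) ** (K z ** adj (N z))) (\<lambda>w. (- \<theta> v) ** (K a ** (- adj (\<theta> w)) + K1 a w)) a"
      using mderiv_mult[OF mderiv_const[of "- \<theta> v"] mderiv_mult[OF dK[OF U(2)] Nad]]
      by (simp add: Na adj_simps matrix_ring_simps)
    show ?thesis
      using mderiv_add[OF mderiv_mult[OF Nd Y] Z] unfolding X1_def
      by (simp add: X2_def[abs_def] Na adj_simps)
  qed
  have Gu: "hform (X z) \<xi> \<xi> = hform (K z) (u z) (u z)" for z
    unfolding X_def u_def by (rule hform_congruence)
  have ua: "u a = \<xi>" by (simp add: u_def Na transpose_mat)
  have nonneg: "0 \<le> ?G z" if "z \<in> U" for z
  proof (cases "u z = 0")
    case True
    then show ?thesis unfolding Gu by (simp add: hform_def)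
  next
    case False
    then show ?thesis unfolding Gu using pos[OF that] by (simp add: less_imp_le)
  qed
  have posa: "0 < ?G a" unfolding Gu ua using pos[OF U(2) \<xi>] .
  have holu: "holomorphic_vec_on (\<lambda>z. u z $ i) UNIV" for i
  proof -
    have "holomorphic_vec_on (\<lambda>z. \<theta> (z - a) $ k $ i) UNIV" for k
      by (rule complex_linear_holomorphic) (simp_all add: \<theta>_add \<theta>_scale)
    then have "holomorphic_vec_on (\<lambda>z. \<Sum>k\<in>UNIV. (mat 1 $ k $ i - \<theta> (z - a) $ k $ i) * \<xi> $ k) UNIV"
      by (intro holomorphic_vec_on_intros)
    then show ?thesis by (simp add: u_def N_def matrix_vector_mult_def transpose_def)
  qed
  have key: "0 \<le> integral\<^sup>L (avg q) (\<lambda>w. Re (hform (X2 (T w) (T w)) \<xi> \<xi>) + Re (hform (X2 (\<i> *s T w) (\<i> *s T w)) \<xi> \<xi>))"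
  proof (rule second_order_mean_nonneg[where G="?G" and U=U and a=a and G'="\<lambda>z v. Re (hform (X1 z v) \<xi> \<xi>)"
          and G''="\<lambda>v w. Re (hform (X2 v w) \<xi> \<xi>)", OF U _ _ nonneg posa T])
    show "(?G has_derivative (\<lambda>v. Re (hform (X1 z v) \<xi> \<xi>))) (at z)" if "z \<in> U" for z
      by (rule hform_has_derivative[OF Xd[OF that]])
    show "((\<lambda>z. Re (hform (X1 z v) \<xi> \<xi>)) has_derivative (\<lambda>w. Re (hform (X2 v w) \<xi> \<xi>))) (at a)" for v
      by (rule hform_has_derivative[OF Xdd])
    show "\<exists>\<delta>0>0. \<forall>\<delta>. 0 < \<delta> \<and> \<delta> < \<delta>0 \<longrightarrow> ennreal (?G a) \<le> (\<integral>\<^sup>+w. ennreal (?G (a + \<delta> *\<^sub>R T w)) \<partial>avg q)"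
      unfolding Gu by (rule sub[OF holu]) (use ua \<xi> in simp)
  qed
  have "X2 v v + X2 (\<i> *s v) (\<i> *s v) = L v" for v
  proof -
    have \<theta>K: "\<theta> v ** (K a ** B) = P v ** B" for v B
    proof -
      have MKB: "M ** (K a ** B) = B" by (simp add: matrix_mul_assoc MK)
      show ?thesis by (simp only: \<theta>_def matrix_mul_assoc[symmetric] MKB)
    qed
    have a\<theta>: "adj (\<theta> v) = M ** adj (P v)" for v by (simp add: \<theta>_def adj_simps M_herm)
    \<comment> \<open>the terms P M P and their adjoints are homogeneous of type (2,0) and (0,2), so they cancel
      when v and \<i> v are added\<close>
    have e1: "X2 v v = K2 v v - cm 2 (P v ** (M ** P v)) - cm 2 (P v ** (M ** adj (P v))) - cm 2 (adj (P v) ** (M ** adj (P v)))" for v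
    proof -
      have "X2 v v = K2 v v - K1 a v ** adj (\<theta> v) - K1 a v ** adj (\<theta> v) + \<theta> v ** (K a ** adj (\<theta> v)) - \<theta> v ** K1 a v
           + \<theta> v ** (K a ** adj (\<theta> v)) - \<theta> v ** K1 a v"
        by (simp add: X2_def Y2_def matrix_ring_simps)
      also have "\<dots> = K2 v v - (P v + adj (P v)) ** (M ** adj (P v)) - (P v + adj (P v)) ** (M ** adj (P v)) + P v ** (M ** adj (P v))
           - P v ** (M ** (P v + adj (P v))) + P v ** (M ** adj (P v)) - P v ** (M ** (P v + adj (P v)))"
        unfolding \<theta>K a\<theta> K1_split by (simp add: \<theta>_def matrix_mul_assoc)
      also have "\<dots> = K2 v v - cm 2 (P v ** (M ** P v)) - cm 2 (P v ** (M ** adj (P v))) - cm 2 (adj (P v) ** (M ** adj (P v)))"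
        unfolding matrix_ring_simps by (rule mat_eqI) simp
      finally show ?thesis .
    qed
    show ?thesis
      unfolding L_alt e1 P_scale adj_simps matrix_ring_simps cm_simps
      by (rule mat_eqI) simp
  qed
  then have "Re (hform (X2 v v) \<xi> \<xi>) + Re (hform (X2 (\<i> *s v) (\<i> *s v)) \<xi> \<xi>) = Re (hform (L v) \<xi> \<xi>)" for v
    by (metis hform_linear(1) plus_complex.simps(1))
  with key show ?thesis by simp
qed

end

lemma matrix_inv_unique:
  fixes A B :: "complex^'r^'r"
  assumes "A ** B = mat 1" shows "matrix_inv A = B"
proof -
  have BA: "B ** A = mat 1" using assms matrix_left_right_inverse by blast
  then have "invertible A" using assms unfolding invertible_def by blast
  from matrix_inv_props(1)[OF this] have "B ** (A ** matrix_inv A) = B" by simp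
  then show ?thesis by (simp add: matrix_mul_assoc BA)
qed

context hermitian_jet
begin

lemma inv_herm: assumes "z \<in> U" shows "adj (matrix_inv (K z)) = matrix_inv (K z)"
proof -
  have "K z ** adj (matrix_inv (K z)) = adj (matrix_inv (K z) ** K z)"
    by (simp add: adj_simps herm assms)
  also have "\<dots> = mat 1" by (simp add: matrix_inv_props inv assms adj_simps)
  finally show ?thesis by (rule matrix_inv_unique[symmetric])
qed

lemma inv_pos:
  assumes z: "z \<in> U" and x: "x \<noteq> 0" shows "0 < Re (hform (conjm (matrix_inv (K z))) x x)"
proof -
  let ?M = "matrix_inv (K z)"
  have "?M = ?M ** (K z ** adj ?M)" by (simp add: inv_herm z matrix_inv_props inv)
  then have "hform ?M (cvec x) (cvec x) = hform (K z) (transpose ?M *v cvec x) (transpose ?M *v cvec x)"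
    using hform_congruence[of ?M "K z" "cvec x" "cvec x"] by simp
  moreover have "transpose ?M *v cvec x \<noteq> 0"
  proof
    assume "transpose ?M *v cvec x = 0"
    then have "transpose (K z) *v (transpose ?M *v cvec x) = 0" by (simp del: transpose_matrix_vector)
    then have "transpose (?M ** K z) *v cvec x = 0"
      by (simp add: matrix_vector_mul_assoc matrix_transpose_mul del: transpose_matrix_vector)
    then have "cvec x = 0" by (simp add: matrix_inv_props inv z transpose_mat)
    then show False using x by (simp add: vec_eq_iff)
  qed
  ultimately show ?thesis using pos[OF z] by (simp add: hform_conjm)
qed

text \<open>In the dual frame, the dual metric has the Gram matrix \<open>cnj (K\<^sup>-\<^sup>1)\<close>. The
  derivatives follow from \<open>d(K\<^sup>-\<^sup>1) = - K\<^sup>-\<^sup>1 dK K\<^sup>-\<^sup>1\<close>.\<close>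

lemma dual_jet:
  "hermitian_jet (\<lambda>z. conjm (matrix_inv (K z)))
     (\<lambda>z v. - conjm (matrix_inv (K z) ** (K1 z v ** matrix_inv (K z))))
     (\<lambda>v w. conjm (M ** (K1 a w ** (M ** (K1 a v ** M))) + M ** (K1 a v ** (M ** (K1 a w ** M))) - M ** (K2 v w ** M))) U a"
proof
  have inv_d: "mderiv (\<lambda>z. matrix_inv (K z)) (\<lambda>v. - (matrix_inv (K z) ** (K1 z v ** matrix_inv (K z)))) z" if z: "z \<in> U" for z
    using mderiv_inverse[OF dK[OF z] U(1) z inv] by (simp add: matrix_mul_assoc)
  show "mderiv (\<lambda>z. conjm (matrix_inv (K z))) (\<lambda>v. - conjm (matrix_inv (K z) ** (K1 z v ** matrix_inv (K z)))) z" if "z \<in> U" for z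
    using mderiv_conjm[OF inv_d[OF that]] by (simp add: conjm_simps)
  show "mderiv (\<lambda>z. - conjm (matrix_inv (K z) ** (K1 z v ** matrix_inv (K z))))
     (\<lambda>w. conjm (M ** (K1 a w ** (M ** (K1 a v ** M))) + M ** (K1 a v ** (M ** (K1 a w ** M))) - M ** (K2 v w ** M))) a" for v
  proof -
    have Md: "mderiv (\<lambda>z. matrix_inv (K z)) (\<lambda>w. - (M ** (K1 a w ** M))) a"
      using inv_d[OF U(2)] by (simp add: M_def)
    have "mderiv (\<lambda>z. matrix_inv (K z) ** (K1 z v ** matrix_inv (K z)))
       (\<lambda>w. M ** (K1 a v ** (- (M ** (K1 a w ** M))) + K2 v w ** M) + (- (M ** (K1 a w ** M))) ** (K1 a v ** M)) a"
      using mderiv_mult[OF Md mderiv_mult[OF ddK[of v] Md]] by (simp add: M_def)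
    from mderiv_neg[OF mderiv_conjm[OF this]]
    have "mderiv (\<lambda>z. - conjm (matrix_inv (K z) ** (K1 z v ** matrix_inv (K z))))
       (\<lambda>w. - conjm (M ** (K1 a v ** (- (M ** (K1 a w ** M))) + K2 v w ** M) + (- (M ** (K1 a w ** M))) ** (K1 a v ** M))) a" .
    moreover have "- conjm (M ** (K1 a v ** (- (M ** (K1 a w ** M))) + K2 v w ** M) + (- (M ** (K1 a w ** M))) ** (K1 a v ** M))
       = conjm (M ** (K1 a w ** (M ** (K1 a v ** M))) + M ** (K1 a v ** (M ** (K1 a w ** M))) - M ** (K2 v w ** M))" for w
      unfolding matrix_ring_simps matrix_mul_assoc by (rule mat_eqI) simp
    ultimately show ?thesis by simp
  qed
  show "adj (conjm (matrix_inv (K z))) = conjm (matrix_inv (K z))" if "z \<in> U" for z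
    by (simp add: conjm_simps inv_herm that)
  show "invertible (conjm (matrix_inv (K z)))" if "z \<in> U" for z
    unfolding invertible_def
    by (rule exI[of _ "conjm (K z)"]) (simp add: conjm_simps(6)[symmetric] matrix_inv_props inv that conjm_simps(5))
qed (rule U inv_pos; assumption?)+

text \<open>The reason for the sign is that the curvature of the dual bundle is the negative transpose of
  \<open>\<Theta>\<close>.\<close>

lemma dual_levi:
  "hermitian_jet.L (\<lambda>z. conjm (matrix_inv (K z)))
     (\<lambda>z v. - conjm (matrix_inv (K z) ** (K1 z v ** matrix_inv (K z))))
     (\<lambda>v w. conjm (M ** (K1 a w ** (M ** (K1 a v ** M))) + M ** (K1 a v ** (M ** (K1 a w ** M))) - M ** (K2 v w ** M))) a v
   = - conjm (M ** (L v ** M))"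
proof -
  interpret d: hermitian_jet "\<lambda>z. conjm (matrix_inv (K z))"
    "\<lambda>z v. - conjm (matrix_inv (K z) ** (K1 z v ** matrix_inv (K z)))"
    "\<lambda>v w. conjm (M ** (K1 a w ** (M ** (K1 a v ** M))) + M ** (K1 a v ** (M ** (K1 a w ** M))) - M ** (K2 v w ** M))" U a
    by (rule dual_jet)
  have dM: "d.M = conjm (K a)"
    unfolding d.M_def M_def[symmetric] by (rule matrix_inv_unique) (simp add: conjm_simps(6)[symmetric] MK conjm_simps(5))
  have dP: "d.P v = - conjm (M ** (adj (P v) ** M))" for v
    unfolding d.P_def jet_p_def M_def[symmetric] K1_split_i
    unfolding K1_split matrix_ring_simps
    by (rule mat_eqI) (simp add: algebra_simps)
  have KM: "K a ** (M ** B) = B" for B by (simp add: matrix_mul_assoc MK)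
  have dPMP: "d.P v ** (d.M ** adj (d.P v)) = conjm (M ** (adj (P v) ** (M ** (P v ** M))))"
    unfolding dP dM by (simp add: conjm_simps(7) adj_simps matrix_ring_simps M_herm conjm_simps(6)[symmetric]
        matrix_mul_assoc[symmetric] KM)
  show ?thesis
    unfolding d.L_alt dPMP L_alt K1_split_i
    unfolding K1_split matrix_ring_simps matrix_mul_assoc[symmetric] cm_simps
    by (rule mat_eqI) (simp add: algebra_simps)
qed

text \<open>The lower bound for the dual metric, tested at the covector \<open>cnj (K\<^sup>T \<eta>)\<close> dual
  to \<open>\<eta>\<close>, is the upper bound for the metric.\<close>

lemma levi_mean_zero:
  fixes T :: "(complex,'n) vec \<Rightarrow> (complex,'n) vec"
  assumes T: "linear T" "\<And>c w. T (c *s w) = c *s T w"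
    and sub: "\<And>u. (\<And>i. holomorphic_vec_on (\<lambda>z. u z $ i) UNIV) \<Longrightarrow> u a \<noteq> 0 \<Longrightarrow>
      \<exists>\<delta>0>0. \<forall>\<delta>. 0 < \<delta> \<and> \<delta> < \<delta>0 \<longrightarrow> ennreal (Re (hform (K a) (u a) (u a))) \<le>
        (\<integral>\<^sup>+w. ennreal (Re (hform (K (a + \<delta> *\<^sub>R T w)) (u (a + \<delta> *\<^sub>R T w)) (u (a + \<delta> *\<^sub>R T w)))) \<partial>avg q)"
    and dual_sub: "\<And>u. (\<And>i. holomorphic_vec_on (\<lambda>z. u z $ i) UNIV) \<Longrightarrow> u a \<noteq> 0 \<Longrightarrow>
      \<exists>\<delta>0>0. \<forall>\<delta>. 0 < \<delta> \<and> \<delta> < \<delta>0 \<longrightarrow> ennreal (Re (hform (conjm (matrix_inv (K a))) (u a) (u a))) \<le>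
        (\<integral>\<^sup>+w. ennreal (Re (hform (conjm (matrix_inv (K (a + \<delta> *\<^sub>R T w)))) (u (a + \<delta> *\<^sub>R T w)) (u (a + \<delta> *\<^sub>R T w)))) \<partial>avg q)"
  shows "integral\<^sup>L (avg q) (\<lambda>w. Re (hform (L (T w)) \<eta> \<eta>)) = 0"
proof (cases "\<eta> = 0")
  case True
  then show ?thesis by (simp add: hform_def)
next
  case False
  interpret d: hermitian_jet "\<lambda>z. conjm (matrix_inv (K z))"
    "\<lambda>z v. - conjm (matrix_inv (K z) ** (K1 z v ** matrix_inv (K z)))"
    "\<lambda>v w. conjm (M ** (K1 a w ** (M ** (K1 a v ** M))) + M ** (K1 a v ** (M ** (K1 a w ** M))) - M ** (K2 v w ** M))" U a
    by (rule dual_jet)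
  define c where "c = transpose (K a) *v \<eta>"
  have Mc: "transpose M *v c = \<eta>"
    by (simp add: c_def matrix_vector_mul_assoc matrix_transpose_mul[symmetric] MK transpose_mat del: transpose_matrix_vector)
  have "cvec c \<noteq> 0"
  proof
    assume "cvec c = 0"
    then have "c = 0" by (simp add: vec_eq_iff)
    then show False using Mc False by simp
  qed
  from d.levi_mean_nonneg[OF T this dual_sub]
  have "0 \<le> integral\<^sup>L (avg q) (\<lambda>w. Re (hform (- conjm (M ** (L (T w) ** M))) (cvec c) (cvec c)))"
    by (simp add: dual_levi)
  moreover have "Re (hform (- conjm (M ** (L v ** M))) (cvec c) (cvec c)) = - Re (hform (L v) \<eta> \<eta>)" for v
  proof -
    have "cvec (cvec c) = c" by (simp add: vec_eq_iff)
    moreover have "hform (M ** (L v ** M)) c c = hform (L v) \<eta> \<eta>"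
      using hform_congruence[of M "L v" c c] by (simp add: M_herm Mc del: transpose_matrix_vector)
    ultimately show ?thesis by (simp add: hform_linear hform_conjm)
  qed
  ultimately have "integral\<^sup>L (avg q) (\<lambda>w. Re (hform (L (T w)) \<eta> \<eta>)) \<le> 0" by simp
  moreover have "0 \<le> integral\<^sup>L (avg q) (\<lambda>w. Re (hform (L (T w)) \<eta> \<eta>))"
    by (rule levi_mean_nonneg[OF T False sub])
  ultimately show ?thesis by simp
qed

text \<open>The polarisation of \<open>L\<close>: the form \<open>4 (\<partial>\<partial>bar K - \<partial>K
  K\<^sup>-\<^sup>1 \<partial>bar K)(v, w)\<close>. The brackets are twice the \<open>(1,0)\<close>-part
  in \<open>v\<close> and twice the \<open>(0,1)\<close>-part in \<open>w\<close>.\<close>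

definition S where
  "S v w = (K2 v w - cm \<i> (K2 (\<i> *s v) w)) + cm \<i> (K2 v (\<i> *s w) - cm \<i> (K2 (\<i> *s v) (\<i> *s w)))
     - cm 4 (P v ** (M ** adj (P w)))"

lemma S_diagonal: "S v v = L v"
  unfolding S_def L_alt by (rule mat_eqI) (simp add: K2_symmetric[of "\<i> *s v" v] algebra_simps)

lemma L_herm: "adj (L v) = L v"
  unfolding L_alt by (simp add: adj_simps K2_herm M_herm matrix_mul_assoc)

text \<open>The derivative \<open>K2\<close> is real-bilinear, and the combination in \<open>S\<close> is made so
  that a factor \<open>\<i>\<close> in the first argument comes out as \<open>\<i>\<close> and in the
  second as \<open>- \<i>\<close>.\<close>

lemma S_sesquilinear: "sesquilinear (\<lambda>v w. hform (S v w) x x)"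
proof -
  have scal: "c *s v = Re c *\<^sub>R v + Im c *\<^sub>R (\<i> *s v)" for c and v :: "(complex,'n) vec"
    by (simp add: vec_eq_iff complex_eq_iff)
  have ii: "\<i> *s (\<i> *s v) = (- 1) *\<^sub>R v" for v :: "(complex,'n) vec"
    by (simp add: vec_eq_iff vector_smult_assoc)
  have l: "K2 (v + v') w = K2 v w + K2 v' w" "K2 v (w + w') = K2 v w + K2 v w'"
    "K2 (r *\<^sub>R v) w = cm (of_real r) (K2 v w)" "K2 v (r *\<^sub>R w) = cm (of_real r) (K2 v w)" for v v' w w' r
    by (auto intro!: mat_eqI simp: bilinear_ladd[OF K2_bilinear] bilinear_radd[OF K2_bilinear]
          bilinear_lmul[OF K2_bilinear] bilinear_rmul[OF K2_bilinear] scaleR_conv_of_real[where 'a=complex])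
  have i_lin: "\<i> *s (v + v') = \<i> *s v + \<i> *s v'" "\<i> *s (r *\<^sub>R v) = r *\<^sub>R (\<i> *s v)" for v v' :: "(complex,'n) vec" and r
    by (simp_all add: vec_eq_iff algebra_simps)
  have add1: "S (v + v') w = S v w + S v' w" for v v' w
    unfolding S_def i_lin l P_add matrix_ring_simps by (rule mat_eqI) (simp add: algebra_simps)
  have add2: "S v (w + w') = S v w + S v w'" for v w w'
    unfolding S_def i_lin l P_add matrix_ring_simps adj_simps by (rule mat_eqI) (simp add: algebra_simps)
  have i1: "S (\<i> *s v) w = cm \<i> (S v w)" for v w
    unfolding S_def ii l P_scale matrix_ring_simps by (rule mat_eqI) (simp add: algebra_simps)
  have i2: "S v (\<i> *s w) = cm (- \<i>) (S v w)" for v w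
    unfolding S_def ii l P_scale matrix_ring_simps adj_simps by (rule mat_eqI) (simp add: algebra_simps)
  have Pr: "P (r *\<^sub>R v) = cm (of_real r) (P v)" for r v
    unfolding scaleR_eq_vector_scalar_mult by (rule P_scale)
  have r1: "S (r *\<^sub>R v) w = cm (of_real r) (S v w)" for r v w
    unfolding S_def i_lin l Pr matrix_ring_simps by (rule mat_eqI) (simp add: algebra_simps)
  have r2: "S v (r *\<^sub>R w) = cm (of_real r) (S v w)" for r v w
    unfolding S_def i_lin l Pr matrix_ring_simps adj_simps by (rule mat_eqI) (simp add: algebra_simps)
  have c1: "S (c *s v) w = cm c (S v w)" for c v w
  proof -
    have "S (c *s v) w = cm (of_real (Re c)) (S v w) + cm (of_real (Im c)) (cm \<i> (S v w))"
      by (subst scal) (simp only: add1 r1 i1)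
    also have "\<dots> = cm c (S v w)" by (rule mat_eqI) (simp add: complex_eq_iff)
    finally show ?thesis .
  qed
  have c2: "S v (c *s w) = cm (cnj c) (S v w)" for c v w
  proof -
    have "S v (c *s w) = cm (of_real (Re c)) (S v w) + cm (of_real (Im c)) (cm (- \<i>) (S v w))"
      by (subst scal) (simp only: add2 r2 i2)
    also have "\<dots> = cm (cnj c) (S v w)" by (rule mat_eqI) (simp add: complex_eq_iff)
    finally show ?thesis .
  qed
  show ?thesis
    unfolding sesquilinear_def by (simp add: add1 add2 c1 c2 hform_linear)
qed

lemma S_zero_of_levi_mean_zero:
  assumes q: "1 \<le> q" "q \<le> CARD('n) - 1" "CARD('n) \<ge> 2"
    and zero: "\<And>r s A \<eta>. 0 < r \<Longrightarrow> 0 < s \<Longrightarrow> unitary A \<Longrightarrow>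
       integral\<^sup>L (avg q) (\<lambda>w. Re (hform (L (polyball_map q r s A w)) \<eta> \<eta>)) = 0"
  shows "S v w = 0"
proof (rule hform_zero)
  fix x
  have "hform (L v) x x = of_real (Re (hform (L v) x x))" for v
    using hform_adj[of "L v" x] by (simp add: L_herm complex_eq_iff)
  then have "integral\<^sup>L (avg q) (\<lambda>w. hform (S (polyball_map q r s A w) (polyball_map q r s A w)) x x) = 0"
    if "0 < r" "0 < s" "unitary A" for r s A
    using zero[OF that, of x] unfolding S_diagonal by (metis (no_types, lifting) Bochner_Integration.integral_cong integral_complex_of_real of_real_0)
  then show "hform (S v w) x x = 0"
    by (intro unitary_averages_zero[OF S_sesquilinear q])
qed

end

section \<open>From extension indices to vanishing curvature\<close>

lemma polyball_map_smult: "polyball_map q (\<delta> * r) (\<delta> * s) A w = \<delta> *\<^sub>R polyball_map q r s A w"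
proof -
  have "(\<chi> i. of_real (if i \<in> first_coords q then \<delta> * r else \<delta> * s) * w $ i)
      = complex_of_real \<delta> *s (\<chi> i. of_real (if i \<in> first_coords q then r else s) * w $ i)"
    by (simp add: vec_eq_iff)
  then show ?thesis by (simp add: polyball_map_def vector_scalar_commute scaleR_eq_vector_scalar_mult)
qed

lemma small_polyball_in_open:
  fixes A :: "complex^('n::{finite,linorder})^('n::{finite,linorder})"
  assumes "open U" "a \<in> U" "0 < r" "0 < s"
  shows "\<exists>\<delta>0>0. \<forall>\<delta>. 0 < \<delta> \<and> \<delta> < \<delta>0 \<longrightarrow> (+) a ` polyball q (\<delta> * r) (\<delta> * s) A \<subseteq> U"
proof -
  obtain R where R: "R > 0" "ball a R \<subseteq> U" using assms open_contains_ball by blast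
  have "bounded (polyball_map q r s A ` unit_polyball q)"
    using polyball_map_linear by (intro bounded_linear_image unit_polyball_bounded) (simp add: linear_conv_bounded_linear)
  then obtain B where B: "B > 0" "\<And>w. w \<in> unit_polyball q \<Longrightarrow> norm (polyball_map q r s A w) \<le> B"
    unfolding bounded_pos by auto
  show ?thesis
  proof (intro exI[of _ "R / B"] conjI allI impI)
    show "R / B > 0" using R B by simp
    fix \<delta> assume \<delta>: "0 < \<delta> \<and> \<delta> < R / B"
    show "(+) a ` polyball q (\<delta> * r) (\<delta> * s) A \<subseteq> U"
    proof
      fix z assume "z \<in> (+) a ` polyball q (\<delta> * r) (\<delta> * s) A"
      then obtain w where w: "w \<in> unit_polyball q" "z = a + \<delta> *\<^sub>R polyball_map q r s A w"
        using \<delta> assms by (auto simp: polyball_eq_image polyball_map_smult)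
      have "norm (\<delta> *\<^sub>R polyball_map q r s A w) \<le> \<delta> * B" using B(2)[OF w(1)] \<delta> by simp
      also have "\<dots> < R" using \<delta> B(1) by (simp add: pos_less_divide_eq)
      finally show "z \<in> U" using R(2) w(2) by (auto simp: dist_norm subset_iff)
    qed
  qed
qed

context hermitian_bundle
begin

text \<open>The Riesz isomorphism in a frame: \<open>\<nu>\<close> represents the functional with coordinates
  \<open>x\<close>, and its norm is the dual norm of \<open>x\<close>.\<close>

lemma section_of_covector:
  fixes x :: "(complex,'r) vec"
  assumes U: "(U, \<phi>) \<in> atlas E" and z: "z \<in> U"
  defines "\<nu> \<equiv> triv_inv E \<phi> z (cvec (matrix_inv (gram E h \<phi> z) *v x))"
  shows "\<nu> \<in> fibre E z" "h (triv_inv E \<phi> z (axis \<beta> 1)) \<nu> = x $ \<beta>"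
    "h \<nu> \<nu> = hform (conjm (matrix_inv (gram E h \<phi> z))) x x"
proof -
  let ?M = "matrix_inv (gram E h \<phi> z)"
  let ?y = "cvec (?M *v x)"
  note M = matrix_inv_props[OF gram_invertible[OF U z]]
  show f: "\<nu> \<in> fibre E z" unfolding \<nu>_def by (rule triv_inv_fibre[OF U z])
  show e: "h (triv_inv E \<phi> z (axis \<beta> 1)) \<nu> = x $ \<beta>" for \<beta>
  proof -
    have "h (triv_inv E \<phi> z (axis \<beta> 1)) \<nu> = (gram E h \<phi> z *v (?M *v x)) $ \<beta>"
      unfolding \<nu>_def gram_component[OF U z] by (simp add: matrix_vector_mult_def[of "gram E h \<phi> z"] mult.commute)
    then show ?thesis by (simp add: matrix_vector_mul_assoc M)
  qed
  have "h \<nu> \<nu> = (\<Sum>\<beta>\<in>UNIV. ?y $ \<beta> * x $ \<beta>)"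
    using frame_expansion[OF U z f f] by (simp add: e) (simp add: \<nu>_def chart_triv_inv[OF U z])
  also have "\<dots> = hform (conjm ?M) x x"
    by (simp add: hform_def matrix_vector_mult_def sum_distrib_left sum_distrib_right mult_ac)
  finally show "h \<nu> \<nu> = hform (conjm ?M) x x" .
qed

lemma covector_pairing:
  assumes U: "(U, \<phi>) \<in> atlas E" and z: "z \<in> U" and v: "v \<in> fibre E z"
  shows "h v (triv_inv E \<phi> z (cvec (matrix_inv (gram E h \<phi> z) *v x))) = (\<Sum>\<beta>\<in>UNIV. \<phi> v $ \<beta> * x $ \<beta>)"
  using frame_expansion[OF U z v section_of_covector(1)[OF U z]] by (simp add: section_of_covector(2)[OF U z])

lemma gram_jet:
  assumes U: "(U, \<phi>) \<in> atlas E" and a: "a \<in> U"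
  shows "mderiv (\<lambda>z. gram_deriv \<phi> z v) (\<lambda>w. \<chi> \<alpha> \<beta>. frechet_derivative (\<lambda>z. gram_deriv \<phi> z v $ \<alpha> $ \<beta>) (at a) w) a"
  unfolding mderiv_def vec_lambda_beta
  using gram_deriv_differentiable[OF U a] frechet_derivative_works by metis

end

context hermitian_bundle_ordered
begin

text \<open>The section with frame coordinates \<open>u\<close> competes in the infimum for its own value at
  \<open>a\<close>, unless it is not square integrable, and then the right-hand side is infinite.\<close>

lemma index_ge_1_submean:
  assumes rs: "0 < r" "0 < s" and A: "unitary A" and P: "(+) a ` polyball q r s A \<subseteq> U" and U: "(U, \<phi>) \<in> atlas E"
    and idx: "\<And>\<xi>. \<xi> \<in> fibre E a - {fzero E a} \<Longrightarrow> extension_index E h q a r s A \<xi> = 1"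
    and u: "\<And>i. holomorphic_vec_on (\<lambda>z. u z $ i) UNIV" "u a \<noteq> 0"
  shows "ennreal (Re (hform (gram E h \<phi> a) (u a) (u a))) \<le>
    (\<integral>\<^sup>+w. ennreal (Re (hform (gram E h \<phi> (a + polyball_map q r s A w)) (u (a + polyball_map q r s A w)) (u (a + polyball_map q r s A w)))) \<partial>avg q)"
    (is "_ \<le> ?I")
proof -
  let ?P = "(+) a ` polyball q r s A"
  let ?T = "polyball_map q r s A"
  let ?\<sigma> = "\<lambda>z. triv_inv E \<phi> z (u z)"
  note Pp = translated_polyball[OF rs A, of a q]
  have aU: "a \<in> U" using P Pp(3) by blast
  have a: "a \<in> \<Omega>" using chart_subset[OF U] aU by blast
  have PO: "?P \<subseteq> \<Omega>" using P chart_subset[OF U] by blast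
  have \<sigma>: "holomorphic_section E ?P ?\<sigma>"
    by (rule frame_section_holomorphic[OF U P Pp(1)]) (rule holomorphic_vec_on_subset[OF u(1)], simp)
  define H0 where "H0 = Re (h (?\<sigma> a) (?\<sigma> a))"
  have H0: "H0 = Re (hform (gram E h \<phi> a) (u a) (u a))" unfolding H0_def metric_in_frame[OF U aU] ..
  have H0pos: "0 < H0" unfolding H0 by (rule hform_gram_pos[OF U aU u(2)])
  have \<xi>: "?\<sigma> a \<in> fibre E a - {fzero E a}"
  proof -
    have "?\<sigma> a \<in> fibre E a" by (rule triv_inv_fibre[OF U aU])
    moreover have "?\<sigma> a \<noteq> fzero E a"
    proof
      assume "?\<sigma> a = fzero E a"
      then have "h (?\<sigma> a) (?\<sigma> a) = 0" using metric_zero(1)[OF a fibre_ops(1)[OF a]] by simp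
      then show False using H0pos by (simp add: H0_def)
    qed
    ultimately show ?thesis by simp
  qed
  have I_eq: "(\<integral>\<^sup>+w. ennreal (Re (h (?\<sigma> (a + ?T w)) (?\<sigma> (a + ?T w)))) \<partial>avg q) = ?I"
  proof (rule nn_integral_cong_AE, rule AE_mp[OF AE_avg], rule AE_I2, rule impI)
    fix w :: "(complex,'n) vec" assume "w \<in> unit_polyball q"
    then have "a + ?T w \<in> U" using P by (auto simp: polyball_eq_image[OF rs])
    then show "ennreal (Re (h (?\<sigma> (a + ?T w)) (?\<sigma> (a + ?T w)))) =
        ennreal (Re (hform (gram E h \<phi> (a + ?T w)) (u (a + ?T w)) (u (a + ?T w))))"
      by (simp add: metric_in_frame[OF U])
  qed
  show ?thesis
  proof (cases "?I = \<infinity>")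
    case True
    then show ?thesis by simp
  next
    case False
    then have "sq_integral h ?P ?\<sigma> < \<infinity>"
      using emeasure_polyball[OF rs A continuous_on_const, of q]
      by (simp add: sq_integral_polyball[OF rs A PO \<sigma>] I_eq ennreal_mult_less_top top.not_eq_extremum)
    then have "?\<sigma> \<in> A2 E h ?P" using \<sigma> by (simp add: A2_def)
    then have "extension_index E h q a r s A (?\<sigma> a) \<le> sq_integral h ?P ?\<sigma> / (emeasure lebesgue (polyball q r s A) * ennreal (Re (h (?\<sigma> a) (?\<sigma> a))))"
      unfolding extension_index_def by (intro Inf_lower) blast
    also have "\<dots> = ?I / ennreal H0"
      using sq_integral_ratio[OF rs A PO \<sigma> H0pos] unfolding I_eq H0_def .
    finally have "1 \<le> ?I / ennreal H0" unfolding idx[OF \<xi>] .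
    then have "1 * ennreal H0 \<le> ?I / ennreal H0 * ennreal H0" by (rule mult_right_mono) simp
    also have "?I / ennreal H0 * ennreal H0 = ?I"
      using H0pos by (simp add: ennreal_divide_times)
    finally show ?thesis by (simp add: H0)
  qed
qed

text \<open>Let \<open>\<nu>\<close> represent the holomorphic covector field \<open>u\<close>, and let
  \<open>\<sigma>\<close> be an extension of \<open>\<nu>(a)\<close> whose mean square is at most
  \<open>(1 + e) |\<nu>(a)|\<^sup>2\<close>. The function \<open>F = u(\<sigma>) = h(\<sigma>,
  \<nu>)\<close> is holomorphic although \<open>\<nu>\<close> is not, and \<open>F(a) =
  |\<nu>(a)|\<^sup>2\<close>. The mean value inequality and Cauchy-Schwarz give \<open>|\<nu>(a)|\<^sup>4
  \<le> mean |\<sigma>|\<^sup>2 \<cdot> mean |\<nu>|\<^sup>2\<close>; divide by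
  \<open>|\<nu>(a)|\<^sup>2\<close> and let \<open>e\<close> tend to 0.\<close>

lemma index_le_1_dual_submean:
  assumes rs: "0 < r" "0 < s" and A: "unitary A" and P: "(+) a ` polyball q r s A \<subseteq> U" and U: "(U, \<phi>) \<in> atlas E"
    and idx: "\<And>\<xi>. \<xi> \<in> fibre E a - {fzero E a} \<Longrightarrow> extension_index E h q a r s A \<xi> = 1"
    and u: "\<And>i. holomorphic_vec_on (\<lambda>z. u z $ i) UNIV" "u a \<noteq> 0"
  shows "ennreal (Re (hform (conjm (matrix_inv (gram E h \<phi> a))) (u a) (u a))) \<le>
    (\<integral>\<^sup>+w. ennreal (Re (hform (conjm (matrix_inv (gram E h \<phi> (a + polyball_map q r s A w)))) (u (a + polyball_map q r s A w)) (u (a + polyball_map q r s A w)))) \<partial>avg q)"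
    (is "_ \<le> ?I")
proof -
  let ?P = "(+) a ` polyball q r s A"
  let ?T = "polyball_map q r s A"
  let ?\<nu> = "\<lambda>z. triv_inv E \<phi> z (cvec (matrix_inv (gram E h \<phi> z) *v u z))"
  let ?g = "\<lambda>z. Re (hform (conjm (matrix_inv (gram E h \<phi> z))) (u z) (u z))"
  note Pp = translated_polyball[OF rs A, of a q]
  have aU: "a \<in> U" using P Pp(3) by blast
  have a: "a \<in> \<Omega>" using chart_subset[OF U] aU by blast
  have PO: "?P \<subseteq> \<Omega>" using P chart_subset[OF U] by blast
  have inP: "a + ?T w \<in> ?P" if "w \<in> unit_polyball q" for w
    using that by (auto simp: polyball_eq_image[OF rs])
  have g\<nu>: "Re (h (?\<nu> z) (?\<nu> z)) = ?g z" if "z \<in> U" for z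
    using section_of_covector(3)[OF U that] by simp
  define H0 where "H0 = ?g a"
  have \<nu>f: "?\<nu> z \<in> fibre E z" if "z \<in> U" for z by (rule triv_inv_fibre[OF U that])
  have \<nu>ne: "?\<nu> a \<noteq> fzero E a"
  proof
    assume "?\<nu> a = fzero E a"
    then have "u a $ \<beta> = 0" for \<beta>
      using section_of_covector(2)[OF U aU, of \<beta> "u a"] metric_zero(2)[OF a triv_inv_fibre[OF U aU]] by simp
    then show False using u(2) by (simp add: vec_eq_iff)
  qed
  have H0: "0 < H0" "h (?\<nu> a) (?\<nu> a) = of_real H0"
    using metric_pos[OF a \<nu>f[OF aU] \<nu>ne] metric_real[OF a \<nu>f[OF aU]] by (simp_all only: H0_def g\<nu>[OF aU])
  let ?m = "emeasure lebesgue (polyball q r s A)"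
  have gram_cont: "continuous_on U ?g"
  proof -
    have "continuous_on U (\<lambda>z. matrix_inv (gram E h \<phi> z) $ \<alpha> $ \<beta>)" for \<alpha> \<beta>
    proof (rule continuous_at_imp_continuous_on, rule ballI)
      fix z assume z: "z \<in> U"
      have "mderiv (\<lambda>z. matrix_inv (gram E h \<phi> z)) (\<lambda>v. - (matrix_inv (gram E h \<phi> z) ** gram_deriv \<phi> z v ** matrix_inv (gram E h \<phi> z))) z"
        by (rule mderiv_inverse[OF gram_mderiv[OF U z] chart_open[OF U] z gram_invertible[OF U]])
      then show "isCont (\<lambda>z. matrix_inv (gram E h \<phi> z) $ \<alpha> $ \<beta>) z"
        unfolding mderiv_def using has_derivative_continuous by blast
    qed
    moreover have "continuous_on U (\<lambda>z. u z $ i)" for i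
      by (rule continuous_on_subset[OF holomorphic_vec_on_continuous[OF u(1)]]) simp
    ultimately show ?thesis
      unfolding hform_def conjm_nth
      by (intro continuous_on_Re continuous_on_sum continuous_on_mult continuous_on_cnj)
  qed
  have bound: "ennreal H0 \<le> ennreal (1 + e) * ?I" if e: "e > 0" for e
  proof -
    have "extension_index E h q a r s A (?\<nu> a) < ennreal (1 + e)"
      using idx[of "?\<nu> a"] \<nu>f[OF aU] \<nu>ne e by (simp add: ennreal_less_iff flip: ennreal_1)
    then obtain \<sigma> where \<sigma>: "holomorphic_section E ?P \<sigma>" "\<sigma> a = ?\<nu> a"
      and lt: "sq_integral h ?P \<sigma> / (?m * ennreal (Re (h (?\<nu> a) (?\<nu> a)))) < ennreal (1 + e)"
      unfolding extension_index_def Inf_less_iff A2_def by blast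
    let ?N = "\<lambda>z. Re (h (\<sigma> z) (\<sigma> z))"
    let ?J = "\<integral>\<^sup>+w. ennreal (?N (a + ?T w)) \<partial>avg q"
    have "Re (h (?\<nu> a) (?\<nu> a)) = H0" using H0(2) by simp
    then have "?J / ennreal H0 < ennreal (1 + e)"
      using lt sq_integral_ratio[OF rs A PO \<sigma>(1) H0(1)] by simp
    then have "?J / ennreal H0 * ennreal H0 \<le> ennreal (1 + e) * ennreal H0"
      by (intro mult_right_mono) simp_all
    moreover have "?J / ennreal H0 * ennreal H0 = ?J" using H0(1) by (simp add: ennreal_divide_times)
    ultimately have J: "?J \<le> ennreal (1 + e) * ennreal H0" by simp
    let ?F = "\<lambda>z. \<Sum>\<beta>\<in>UNIV. \<phi> (\<sigma> z) $ \<beta> * u z $ \<beta>"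
    have F: "?F z = h (\<sigma> z) (?\<nu> z)" if "z \<in> ?P" for z
      using covector_pairing[OF U, of z "\<sigma> z" "u z"] that P holomorphic_sectionD(1)[OF \<sigma>(1) that] by auto
    have PU: "?P \<inter> U = ?P" using P by blast
    have Fhol: "holomorphic_vec_on ?F ?P"
      using holomorphic_sectionD(2)[OF \<sigma>(1) U] unfolding PU
      by (intro holomorphic_vec_on_intros holomorphic_vec_on_subset[OF u(1)]) auto
    have "ennreal H0 = ennreal (norm (?F a))"
      using F[OF Pp(3)] \<sigma>(2) H0 by simp
    also have "\<dots> \<le> (\<integral>\<^sup>+w. ennreal (norm (?F (a + ?T w))) \<partial>avg q)"
      by (rule polyball_mean_value_inequality[OF polyball_map_linear polyball_map_scale])
         (use Fhol in \<open>simp add: polyball_eq_image[OF rs]\<close>)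
    also have "\<dots> \<le> (\<integral>\<^sup>+w. ennreal (sqrt (if a + ?T w \<in> ?P then ?N (a + ?T w) else 0)) * ennreal (sqrt (if a + ?T w \<in> ?P then ?g (a + ?T w) else 0)) \<partial>avg q)"
    proof (rule nn_integral_mono_AE, rule AE_mp[OF AE_avg], rule AE_I2, rule impI)
      fix w :: "(complex,'n) vec" assume "w \<in> unit_polyball q"
      then have z: "a + ?T w \<in> ?P" by (rule inP)
      let ?z = "a + ?T w"
      have zO: "?z \<in> \<Omega>" and zU: "?z \<in> U" using z PO P by auto
      have "(norm (h (\<sigma> ?z) (?\<nu> ?z)))\<^sup>2 \<le> ?N ?z * ?g ?z"
        using metric_Cauchy_Schwarz[OF zO holomorphic_sectionD(1)[OF \<sigma>(1) z] \<nu>f[OF zU]] unfolding g\<nu>[OF zU] .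
      then have "norm (?F ?z) \<le> sqrt (?N ?z) * sqrt (?g ?z)"
        unfolding F[OF z] real_sqrt_mult[symmetric] by (rule real_le_rsqrt)
      moreover have "0 \<le> ?N ?z" using metric_nonneg[OF zO holomorphic_sectionD(1)[OF \<sigma>(1) z]] .
      moreover have "0 \<le> ?g ?z" using metric_nonneg[OF zO \<nu>f[OF zU]] unfolding g\<nu>[OF zU] .
      ultimately show "ennreal (norm (?F ?z)) \<le> ennreal (sqrt (if ?z \<in> ?P then ?N ?z else 0)) * ennreal (sqrt (if ?z \<in> ?P then ?g ?z else 0))"
        using z by (simp add: ennreal_mult[symmetric] ennreal_leI)
    qed
    finally have m1: "ennreal H0 \<le> (\<integral>\<^sup>+w. ennreal (sqrt (if a + ?T w \<in> ?P then ?N (a + ?T w) else 0)) * ennreal (sqrt (if a + ?T w \<in> ?P then ?g (a + ?T w) else 0)) \<partial>avg q)"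
      (is "_ \<le> integral\<^sup>N _ (\<lambda>w. ?f1 w * ?f2 w)") .
    have Tm: "(\<lambda>w. a + ?T w) \<in> borel_measurable borel"
      using polyball_map_linear
      by (intro borel_measurable_continuous_onI continuous_intros linear_continuous_on) (simp add: linear_conv_bounded_linear)
    have meas: "(\<lambda>w. ennreal (sqrt (if a + ?T w \<in> ?P then k (a + ?T w) else 0))) \<in> borel_measurable (avg q)" if "continuous_on ?P k" for k
    proof -
      have "(\<lambda>z. if z \<in> ?P then k z else 0) \<in> borel_measurable borel"
        using that Pp(1) by (intro borel_measurable_continuous_on_if) (auto simp: borel_open)
      from measurable_compose[OF Tm this]
      have m0: "(\<lambda>w. if a + ?T w \<in> ?P then k (a + ?T w) else 0) \<in> borel_measurable (avg q)"
        by (subst measurable_cong_sets[OF sets_avg refl])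
      have sqm: "sqrt \<in> borel_measurable borel"
        by (intro borel_measurable_continuous_onI continuous_on_real_sqrt continuous_on_id)
      from measurable_compose[OF measurable_compose[OF m0 sqm] measurable_ennreal] show ?thesis .
    qed
    have sq: "(\<integral>\<^sup>+w. (ennreal (sqrt (if a + ?T w \<in> ?P then k (a + ?T w) else 0)))\<^sup>2 \<partial>avg q) = (\<integral>\<^sup>+w. ennreal (k (a + ?T w)) \<partial>avg q)"
      if k: "\<And>z. z \<in> ?P \<Longrightarrow> 0 \<le> k z" for k
    proof (rule nn_integral_cong_AE, rule AE_mp[OF AE_avg], rule AE_I2, rule impI)
      fix w :: "(complex,'n) vec" assume "w \<in> unit_polyball q"
      then have z: "a + ?T w \<in> ?P" by (rule inP)
      then show "(ennreal (sqrt (if a + ?T w \<in> ?P then k (a + ?T w) else 0)))\<^sup>2 = ennreal (k (a + ?T w))"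
        using k[OF z] by (simp add: ennreal_power)
    qed
    have Nn: "0 \<le> ?N z" if "z \<in> ?P" for z
      using metric_nonneg[OF _ holomorphic_sectionD(1)[OF \<sigma>(1) that]] PO that by blast
    have gn: "0 \<le> ?g z" if "z \<in> ?P" for z
      using metric_nonneg[OF _ \<nu>f, of z] g\<nu>[of z] PO P that by (metis subsetD)
    have "ennreal H0 * ennreal H0 \<le> (\<integral>\<^sup>+w. ?f1 w * ?f2 w \<partial>avg q)\<^sup>2"
      unfolding power2_eq_square by (intro mult_mono m1) auto
    also have "\<dots> \<le> (\<integral>\<^sup>+w. (?f1 w)\<^sup>2 \<partial>avg q) * (\<integral>\<^sup>+w. (?f2 w)\<^sup>2 \<partial>avg q)"
      by (rule Cauchy_Schwarz_nn_integral; rule meas)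
         (rule section_norm_continuous[OF \<sigma>(1) Pp(1) PO], rule continuous_on_subset[OF gram_cont P])
    also have "(\<integral>\<^sup>+w. (?f1 w)\<^sup>2 \<partial>avg q) = ?J" by (rule sq[OF Nn])
    also have "(\<integral>\<^sup>+w. (?f2 w)\<^sup>2 \<partial>avg q) = ?I" by (rule sq[OF gn])
    also have "?J * ?I \<le> ennreal (1 + e) * ennreal H0 * ?I" by (rule mult_right_mono[OF J]) simp
    finally have "ennreal H0 * ennreal H0 \<le> ennreal H0 * (ennreal (1 + e) * ?I)" by (simp add: mult_ac)
    then show ?thesis using H0(1) by (simp add: ennreal_mult_le_mult_iff)
  qed
  have "ennreal H0 \<le> ?I"
  proof (cases "?I")
    case (real x)
    have "H0 \<le> x + \<epsilon>" if \<epsilon>: "\<epsilon> > 0" for \<epsilon>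
    proof -
      define e where "e = \<epsilon> / (x + 1)"
      have e: "e > 0" using \<epsilon> real(1) by (simp add: e_def)
      have "ennreal H0 \<le> ennreal ((1 + e) * x)"
        using bound[OF e] e real by (simp add: ennreal_mult)
      then have "H0 \<le> (1 + e) * x" using e real(1) by (subst (asm) ennreal_le_iff) auto
      also have "e * x \<le> \<epsilon>" using \<epsilon> real(1) by (simp add: e_def field_simps)
      then have "(1 + e) * x \<le> x + \<epsilon>" by (simp add: algebra_simps)
      finally show ?thesis .
    qed
    then have "H0 \<le> x" by (rule field_le_epsilon)
    then show ?thesis using real by (simp add: ennreal_leI)
  qed simp
  then show ?thesis by (simp add: H0_def)
qed

text \<open>Both sub-mean value properties hold on all small polyballs \<open>a + P\<close> of radii \<open>\<delta>
  r, \<delta> s\<close>, so the polarised curvature form \<open>S\<close> of the jet of \<open>H\<close>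
  vanishes. It remains to recognise \<open>S\<close> in the definition of the Chern curvature, whose
  coefficients are \<open>\<Theta>\<^sub>j\<^sub>k = - S(e\<^sub>j, e\<^sub>k) H\<^sup>-\<^sup>1 /
  4\<close>.\<close>

theorem curvature_zero_of_extension_index_eq_1:
  assumes q: "1 \<le> q" "q \<le> CARD('n) - 1" "CARD('n) \<ge> 2"
    and idx: "\<And>a r s A \<xi>. a \<in> \<Omega> \<Longrightarrow> 0 < r \<Longrightarrow> 0 < s \<Longrightarrow> unitary A \<Longrightarrow> (+) a ` polyball q r s A \<subseteq> \<Omega> \<Longrightarrow>
      \<xi> \<in> fibre E a - {fzero E a} \<Longrightarrow> extension_index E h q a r s A \<xi> = 1"
  shows "i_chern_curvature_zero E h"
proof -
  have "chern_curvature E h \<phi> j k a = 0" if U: "(U, \<phi>) \<in> atlas E" and a: "a \<in> U" for U \<phi> a j k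
  proof -
    define K2 where "K2 v w = (\<chi> \<alpha> \<beta>. frechet_derivative (\<lambda>z. gram_deriv \<phi> z v $ \<alpha> $ \<beta>) (at a) w)" for v w
    have K2d: "mderiv (\<lambda>z. gram_deriv \<phi> z v) (K2 v) a" for v
      unfolding K2_def by (rule gram_jet[OF U a])
    have opU: "open U" by (rule chart_open[OF U])
    have UO: "U \<subseteq> \<Omega>" by (rule chart_subset[OF U])
    interpret J: hermitian_jet "gram E h \<phi>" "gram_deriv \<phi>" K2 U a
    proof
      show "adj (gram E h \<phi> z) = gram E h \<phi> z" if "z \<in> U" for z
        by (rule mat_eqI) (simp add: gram_hermitian[OF U that, symmetric])
    qed (rule opU a gram_mderiv[OF U] K2d gram_invertible[OF U] hform_gram_pos[OF U]; assumption)+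
    have S0: "J.S v w = 0" for v w
    proof (rule J.S_zero_of_levi_mean_zero[OF q])
      fix r s :: real and A :: "((complex,'n) vec,'n) vec" and \<eta>
      assume rs: "0 < r" "0 < s" and A: "unitary A"
      obtain \<delta>0 where \<delta>0: "\<delta>0 > 0" "\<And>\<delta>. 0 < \<delta> \<Longrightarrow> \<delta> < \<delta>0 \<Longrightarrow> (+) a ` polyball q (\<delta> * r) (\<delta> * s) A \<subseteq> U"
        using small_polyball_in_open[OF opU a rs, of q A] by blast
      have i: "extension_index E h q a (\<delta> * r) (\<delta> * s) A \<xi> = 1"
        if "0 < \<delta>" "\<delta> < \<delta>0" "\<xi> \<in> fibre E a - {fzero E a}" for \<delta> \<xi>
        by (rule idx) (use that rs A \<delta>0(2)[OF that(1,2)] UO a in auto)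
      show "integral\<^sup>L (avg q) (\<lambda>w. Re (hform (J.L (polyball_map q r s A w)) \<eta> \<eta>)) = 0"
      proof (rule J.levi_mean_zero[OF polyball_map_linear polyball_map_scale])
        fix u :: "(complex,'n) vec \<Rightarrow> (complex,'r) vec"
        assume u: "\<And>i. holomorphic_vec_on (\<lambda>z. u z $ i) UNIV" "u a \<noteq> 0"
        show "\<exists>\<delta>0>0. \<forall>\<delta>. 0 < \<delta> \<and> \<delta> < \<delta>0 \<longrightarrow> ennreal (Re (hform (gram E h \<phi> a) (u a) (u a))) \<le>
          (\<integral>\<^sup>+w. ennreal (Re (hform (gram E h \<phi> (a + \<delta> *\<^sub>R polyball_map q r s A w)) (u (a + \<delta> *\<^sub>R polyball_map q r s A w)) (u (a + \<delta> *\<^sub>R polyball_map q r s A w)))) \<partial>avg q)"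
        proof (intro exI[of _ \<delta>0] conjI \<delta>0(1) allI impI)
          fix \<delta> assume \<delta>: "0 < \<delta> \<and> \<delta> < \<delta>0"
          have rs': "0 < \<delta> * r" "0 < \<delta> * s" using \<delta> rs by auto
          show "ennreal (Re (hform (gram E h \<phi> a) (u a) (u a))) \<le>
            (\<integral>\<^sup>+w. ennreal (Re (hform (gram E h \<phi> (a + \<delta> *\<^sub>R polyball_map q r s A w)) (u (a + \<delta> *\<^sub>R polyball_map q r s A w)) (u (a + \<delta> *\<^sub>R polyball_map q r s A w)))) \<partial>avg q)"
            using index_ge_1_submean[OF rs' A \<delta>0(2) U i u] \<delta> unfolding polyball_map_smult by simp
        qed
        show "\<exists>\<delta>0>0. \<forall>\<delta>. 0 < \<delta> \<and> \<delta> < \<delta>0 \<longrightarrow> ennreal (Re (hform (conjm (matrix_inv (gram E h \<phi> a))) (u a) (u a))) \<le>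
          (\<integral>\<^sup>+w. ennreal (Re (hform (conjm (matrix_inv (gram E h \<phi> (a + \<delta> *\<^sub>R polyball_map q r s A w)))) (u (a + \<delta> *\<^sub>R polyball_map q r s A w)) (u (a + \<delta> *\<^sub>R polyball_map q r s A w)))) \<partial>avg q)"
        proof (intro exI[of _ \<delta>0] conjI \<delta>0(1) allI impI)
          fix \<delta> assume \<delta>: "0 < \<delta> \<and> \<delta> < \<delta>0"
          have rs': "0 < \<delta> * r" "0 < \<delta> * s" using \<delta> rs by auto
          show "ennreal (Re (hform (conjm (matrix_inv (gram E h \<phi> a))) (u a) (u a))) \<le>
            (\<integral>\<^sup>+w. ennreal (Re (hform (conjm (matrix_inv (gram E h \<phi> (a + \<delta> *\<^sub>R polyball_map q r s A w)))) (u (a + \<delta> *\<^sub>R polyball_map q r s A w)) (u (a + \<delta> *\<^sub>R polyball_map q r s A w)))) \<partial>avg q)"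
            using index_le_1_dual_submean[OF rs' A \<delta>0(2) U i u] \<delta> unfolding polyball_map_smult by simp
        qed
      qed
    qed
    \<comment> \<open>W is the coefficient of dz_j in \<partial>H, and W' its derivative at a\<close>
    define W where "W z = jet_p (gram_deriv \<phi> z) (axis j 1)" for z
    have ax: "\<i> *s axis l 1 = axis l \<i>" for l :: 'n by (simp add: vec_eq_iff axis_def)
    have W_eq: "chern_connection E h \<phi> j z = W z ** matrix_inv (gram E h \<phi> z)" for z
    proof -
      have "(\<chi> \<alpha> \<beta>. wirtinger j (\<lambda>w. gram E h \<phi> w $ \<alpha> $ \<beta>) z) = W z"
        unfolding W_def jet_p_def ax by (rule mat_eqI) (simp add: wirtinger_def gram_deriv_def)
      then show ?thesis unfolding chern_connection_def by (rule arg_cong)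
    qed
    define W' where "W' w = cm (1/2) (K2 (axis j 1) w - cm \<i> (K2 (axis j \<i>) w))" for w
    have Wd: "mderiv W W' a"
    proof -
      have "((\<lambda>z. (1/2) * (gram_deriv \<phi> z (axis j 1) $ \<alpha> $ \<beta> - \<i> * gram_deriv \<phi> z (axis j \<i>) $ \<alpha> $ \<beta>))
          has_derivative (\<lambda>w. (1/2) * (K2 (axis j 1) w $ \<alpha> $ \<beta> - \<i> * K2 (axis j \<i>) w $ \<alpha> $ \<beta>))) (at a)" for \<alpha> \<beta>
        by (rule has_derivative_mult_right[OF has_derivative_diff[OF J.entry_deriv2
              has_derivative_mult_right[OF J.entry_deriv2]]])
      then show ?thesis by (simp add: mderiv_def W_def W'_def jet_p_def ax)
    qed
    have Md: "mderiv (\<lambda>z. matrix_inv (gram E h \<phi> z)) (\<lambda>v. - (J.M ** gram_deriv \<phi> a v ** J.M)) a"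
      using mderiv_inverse[OF gram_mderiv[OF U a] opU a gram_invertible[OF U]] by (simp add: J.M_def)
    have Cd: "mderiv (chern_connection E h \<phi> j) (\<lambda>v. W a ** (- (J.M ** gram_deriv \<phi> a v ** J.M)) + W' v ** J.M) a"
      using mderiv_mult[OF Wd Md] by (simp add: W_eq[abs_def] J.M_def)
    have fd: "frechet_derivative (\<lambda>w. chern_connection E h \<phi> j w $ \<alpha> $ \<beta>) (at a) v
        = (W a ** (- (J.M ** gram_deriv \<phi> a v ** J.M)) + W' v ** J.M) $ \<alpha> $ \<beta>" for \<alpha> \<beta> v
      using fun_cong[OF frechet_derivative_at[OF Cd[unfolded mderiv_def, rule_format, of \<alpha> \<beta>]], of v] by (rule sym)
    have "chern_curvature E h \<phi> j k a = - cm (1/4) (J.S (axis j 1) (axis k 1) ** J.M)"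
    proof (rule mat_eqI)
      fix \<alpha> \<beta>
      have Wa: "W a = J.P (axis j 1)" by (simp add: W_def J.P_def)
      have "cm (1/2) ((W a ** (- (J.M ** gram_deriv \<phi> a (axis k 1) ** J.M)) + W' (axis k 1) ** J.M)
          + cm \<i> (W a ** (- (J.M ** gram_deriv \<phi> a (axis k \<i>) ** J.M)) + W' (axis k \<i>) ** J.M))
         = cm (1/4) (J.S (axis j 1) (axis k 1) ** J.M)"
      proof -
        have g1: "gram_deriv \<phi> a (axis k \<i>) = cm \<i> (J.P (axis k 1)) - cm \<i> (adj (J.P (axis k 1)))"
          using J.K1_split_i[of "axis k 1"] by (simp add: ax)
        show ?thesis
          unfolding Wa g1 J.K1_split[of "axis k 1"] W'_def J.S_def ax matrix_ring_simps matrix_mul_assoc[symmetric] cm_simps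
          by (rule mat_eqI) (simp add: algebra_simps)
      qed
      from arg_cong[OF this, of "\<lambda>X. X $ \<alpha> $ \<beta>"]
      show "chern_curvature E h \<phi> j k a $ \<alpha> $ \<beta> = (- cm (1/4) (J.S (axis j 1) (axis k 1) ** J.M)) $ \<alpha> $ \<beta>"
        unfolding chern_curvature_def wirtinger_bar_def fd by simp
    qed
    then show ?thesis by (simp add: S0 matrix_ring_simps vec_eq_iff)
  qed
  note zero = this
  show ?thesis
    unfolding i_chern_curvature_zero_def
  proof (rule ballI)
    fix X assume X: "X \<in> atlas E"
    obtain U \<phi> where X_eq: "X = (U, \<phi>)" by (cases X)
    show "case X of (U, \<phi>) \<Rightarrow> \<forall>z\<in>U. \<forall>j k \<alpha> \<beta>. \<i> * chern_curvature E h \<phi> j k z $ \<alpha> $ \<beta> = 0"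
      unfolding X_eq prod.case
    proof (intro ballI allI)
      fix z j k \<alpha> \<beta> assume "z \<in> U"
      then show "\<i> * chern_curvature E h \<phi> j k z $ \<alpha> $ \<beta> = 0"
        by (simp only: zero[OF X[unfolded X_eq]] zero_index mult_zero_right)
    qed
  qed
qed

end

theorem theorem3p7:
  fixes \<Omega> :: "(complex^('n::{finite,linorder})) set"
    and E :: "('e, 'n, 'r::finite) vbundle"
    and h :: "'e \<Rightarrow> 'e \<Rightarrow> complex"
    and q :: nat
  assumes "CARD('n) \<ge> 2"
    and "open \<Omega>" and "connected \<Omega>" and "\<Omega> \<noteq> {}"
    and "holomorphic_vector_bundle \<Omega> E"
    and "smooth_hermitian_metric \<Omega> E h"
    and "1 \<le> q" and "q \<le> CARD('n) - 1"
  shows "i_chern_curvature_zero E h \<longleftrightarrow>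
    (\<forall>a\<in>\<Omega>. \<forall>r>0. \<forall>s>0. \<forall>A. unitary A \<longrightarrow> (+) a ` polyball q r s A \<subseteq> \<Omega> \<longrightarrow>
       (\<forall>\<xi>\<in>fibre E a - {fzero E a}. extension_index E h q a r s A \<xi> = 1))"
proof -
  interpret hermitian_bundle_ordered \<Omega> E h
    by unfold_locales (rule assms)+
  show ?thesis
  proof
    assume "i_chern_curvature_zero E h"
    then show "\<forall>a\<in>\<Omega>. \<forall>r>0. \<forall>s>0. \<forall>A. unitary A \<longrightarrow> (+) a ` polyball q r s A \<subseteq> \<Omega> \<longrightarrow>
       (\<forall>\<xi>\<in>fibre E a - {fzero E a}. extension_index E h q a r s A \<xi> = 1)"
      by (intro ballI allI impI) (rule extension_index_eq_1_of_flat, auto)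
  next
    assume idx: "\<forall>a\<in>\<Omega>. \<forall>r>0. \<forall>s>0. \<forall>A. unitary A \<longrightarrow> (+) a ` polyball q r s A \<subseteq> \<Omega> \<longrightarrow>
       (\<forall>\<xi>\<in>fibre E a - {fzero E a}. extension_index E h q a r s A \<xi> = 1)"
    show "i_chern_curvature_zero E h"
    proof (rule curvature_zero_of_extension_index_eq_1[OF assms(7,8,1)])
      show "extension_index E h q a r s A \<xi> = 1"
        if "a \<in> \<Omega>" "0 < r" "0 < s" "unitary A" "(+) a ` polyball q r s A \<subseteq> \<Omega>" "\<xi> \<in> fibre E a - {fzero E a}" for a r s A \<xi>
        using idx[rule_format, OF that] .
    qed
  qed
qed

end
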